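(* Let $N=2n$ and let $X\subseteq\mathbb{P}^{N}=\mathbb{P}^N_{\mathbb{C}}$ be an $n$-dimensional subvariety. If $\operatorname{Tan}X=\mathbb{P}^{N}$, then for generic points $x,y$ of $X$ (i.e. for $(x,y)$ in a nonempty Zariski open subset of $X\times X$) the projective tangent spaces $t_xX$ and $t_yX$ meet in exactly one point $P(x,y)$, and the rational map $$X\times X\dashrightarrow\mathbb{P}^{N},\qquad (x,y)\mapsto P(x,y)=t_xX\cap t_yX,$$ is dominant.
   Context: The base field is $\mathbb{C}$. A subvariety means an irreducible reduced closed subvariety. For a smooth point $x\in X$, $t_xX\subseteq\mathbb{P}^N$ denotes the projective (embedded) tangent space of $X$ at $x$, an $n$-dimensional linear subspace of $\mathbb{P}^N$. The tangent variety $\operatorname{Tan}X\subseteq\mathbb{P}^N$ is the closure of the union of all $t_xX$, where $x$ runs over the smooth points of $X$. *)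

theory Defs
  imports "HOL-Analysis.Analysis" "HOL-Library.Poly_Mapping" "HOL-Library.Extended_Nat"
begin

section \<open>Polynomials in finitely many variables\<close>

type_synonym 'v mpoly = "('v \<Rightarrow>\<^sub>0 nat) \<Rightarrow>\<^sub>0 complex"

definition mp_eval :: "('v::finite) mpoly \<Rightarrow> ('v \<Rightarrow> complex) \<Rightarrow> complex" where
  "mp_eval F a = (\<Sum>m\<in>Poly_Mapping.keys F.
     Poly_Mapping.lookup F m * (\<Prod>i\<in>UNIV. a i ^ Poly_Mapping.lookup m i))"

text \<open>The formal partial derivative. The truncated exponent subtraction is harmless: it only
  happens where the coefficient is 0.\<close>

definition mp_partial :: "'v \<Rightarrow> ('v::finite) mpoly \<Rightarrow> 'v mpoly" where
  "mp_partial i F = (\<Sum>m\<in>Poly_Mapping.keys F.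
     Poly_Mapping.single (m - Poly_Mapping.single i 1)
       (of_nat (Poly_Mapping.lookup m i) * Poly_Mapping.lookup F m))"

definition homogeneous :: "nat \<Rightarrow> ('v::finite) mpoly \<Rightarrow> bool" where
  "homogeneous d F \<longleftrightarrow>
     (\<forall>m\<in>Poly_Mapping.keys F. (\<Sum>i\<in>UNIV. Poly_Mapping.lookup m i) = d)"

definition bihomogeneous :: "nat \<Rightarrow> nat \<Rightarrow> ('v::finite + 'w::finite) mpoly \<Rightarrow> bool" where
  "bihomogeneous d e F \<longleftrightarrow>
     (\<forall>m\<in>Poly_Mapping.keys F. (\<Sum>i\<in>UNIV. Poly_Mapping.lookup m (Inl i)) = d \<and>
                              (\<Sum>j\<in>UNIV. Poly_Mapping.lookup m (Inr j)) = e)"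

section \<open>Projective space and its Zariski topology\<close>

text \<open>Complex projective space of dimension \<open>CARD('m) - 1\<close>: its points are the lines through
  the origin of \<open>complex ^ 'm\<close>.\<close>

typedef 'm proj = "{L :: (complex ^ 'm::finite) set. vec.subspace L \<and> vec.dim L = 1}"
proof -
  let ?L = "vec.span {axis (undefined::'m) (1::complex)}"
  have "vec.independent {axis (undefined::'m) (1::complex)}"
    by (simp add: vec.independent_insert)
  then have "vec.dim ?L = 1"
    by (simp add: vec.dim_eq_card_independent)
  then show ?thesis
    by (intro exI[of _ ?L]) simp
qed

definition hcoords :: "('m::finite) proj \<Rightarrow> (complex ^ 'm) set" where
  "hcoords p = Rep_proj p - {0}"

definition vanishes :: "('m::finite) mpoly \<Rightarrow> 'm proj \<Rightarrow> bool" where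
  "vanishes F p \<longleftrightarrow> (\<forall>v\<in>hcoords p. mp_eval F (($) v) = 0)"

text \<open>The topology with the principal open sets as basis; its closed sets are the zero loci of
  sets of homogeneous polynomials.\<close>

definition zariski :: "('m::finite) proj topology" where
  "zariski = topology_generated_by {{p. \<not> vanishes F p} | F d. homogeneous d F}"

text \<open>The Zariski topology of a product of two projective spaces (not the product topology):
  closed sets are zero loci of sets of bihomogeneous polynomials.\<close>

definition vanishes2 :: "('m::finite + 'k::finite) mpoly \<Rightarrow> 'm proj \<times> 'k proj \<Rightarrow> bool" where
  "vanishes2 F z \<longleftrightarrow> (\<forall>v\<in>hcoords (fst z). \<forall>w\<in>hcoords (snd z).
     mp_eval F (case_sum (($) v) (($) w)) = 0)"

definition zariski2 :: "(('m::finite) proj \<times> ('k::finite) proj) topology" where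
  "zariski2 = topology_generated_by {{z. \<not> vanishes2 F z} | F d e. bihomogeneous d e F}"

section \<open>Subvarieties and dimension\<close>

definition irreducible_in :: "'a topology \<Rightarrow> 'a set \<Rightarrow> bool" where
  "irreducible_in T S \<longleftrightarrow> S \<noteq> {} \<and> S \<subseteq> topspace T \<and>
     (\<forall>A B. closedin T A \<and> closedin T B \<and> S \<subseteq> A \<union> B \<longrightarrow> S \<subseteq> A \<or> S \<subseteq> B)"

text \<open>Over the complex numbers a reduced closed subscheme is determined by its set of
  (closed) points.\<close>

definition subvariety :: "('m::finite) proj set \<Rightarrow> bool" where
  "subvariety X \<longleftrightarrow> closedin zariski X \<and> irreducible_in zariski X"

text \<open>Krull dimension of a (nonempty) topological space.\<close>

definition krull_dim :: "'a topology \<Rightarrow> enat" where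
  "krull_dim T = Sup {enat k | k. \<exists>Z :: nat \<Rightarrow> 'a set.
     (\<forall>i\<le>k. closedin T (Z i) \<and> irreducible_in T (Z i)) \<and> (\<forall>i<k. Z i \<subset> Z (Suc i))}"

definition variety_dim :: "('m::finite) proj set \<Rightarrow> enat" where
  "variety_dim X = krull_dim (subtopology zariski X)"

section \<open>Tangent spaces and the tangent variety\<close>

text \<open>The homogeneous elements of the ideal of \<open>X\<close>; they generate it.\<close>

definition homogeneous_ideal :: "('m::finite) proj set \<Rightarrow> 'm mpoly set" where
  "homogeneous_ideal X = {F. (\<exists>d. homogeneous d F) \<and> (\<forall>p\<in>X. vanishes F p)}"

text \<open>The linear subspace of \<open>complex ^ 'm\<close> lying over the embedded tangent space.\<close>

definition tangent_cone :: "('m::finite) proj set \<Rightarrow> 'm proj \<Rightarrow> (complex ^ 'm) set" where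
  "tangent_cone X x = {w. \<forall>F\<in>homogeneous_ideal X. \<forall>v\<in>hcoords x.
     (\<Sum>i\<in>UNIV. mp_eval (mp_partial i F) (($) v) * w $ i) = 0}"

definition tangent_space :: "('m::finite) proj set \<Rightarrow> 'm proj \<Rightarrow> 'm proj set" where
  "tangent_space X x = {p. Rep_proj p \<subseteq> tangent_cone X x}"

text \<open>A point is smooth if the projective dimension \<open>vec.dim (tangent_cone X x) - 1\<close> of the
  tangent space equals the dimension of \<open>X\<close>.\<close>

definition smooth_point :: "('m::finite) proj set \<Rightarrow> 'm proj \<Rightarrow> bool" where
  "smooth_point X x \<longleftrightarrow> x \<in> X \<and> enat (vec.dim (tangent_cone X x)) = variety_dim X + 1"

definition Tan :: "('m::finite) proj set \<Rightarrow> 'm proj set" where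
  "Tan X = zariski closure_of (\<Union>x\<in>{x. smooth_point X x}. tangent_space X x)"

section \<open>Rational maps from a product\<close>

text \<open>Morphisms from a locally closed subset \<open>U\<close> of a product to projective space: locally given
  by bihomogeneous polynomials of equal bidegree; that these have no common zero on \<open>V\<close> is implied
  by \<open>0 \<notin> hcoords _\<close>.\<close>

definition regular_map_on ::
  "(('m::finite) proj \<times> ('k::finite) proj) set \<Rightarrow> ('m proj \<times> 'k proj \<Rightarrow> ('l::finite) proj) \<Rightarrow> bool"
  where
  "regular_map_on U f \<longleftrightarrow> (\<forall>z\<in>U. \<exists>V d e. \<exists>F :: 'l \<Rightarrow> ('m + 'k) mpoly.
     openin (subtopology zariski2 U) V \<and> z \<in> V \<and> (\<forall>i. bihomogeneous d e (F i)) \<and>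
     (\<forall>(p, q)\<in>V. \<forall>v\<in>hcoords p. \<forall>w\<in>hcoords q.
        (\<chi> i. mp_eval (F i) (case_sum (($) v) (($) w))) \<in> hcoords (f (p, q))))"

text \<open>A rational map on an irreducible \<open>Y\<close>, represented by a morphism \<open>f\<close> on a nonempty open
  subset \<open>U\<close> of \<open>Y\<close>, and its dominance (independent of the representative).\<close>

definition represents_rational_map ::
  "(('m::finite) proj \<times> ('k::finite) proj) set \<Rightarrow> ('m proj \<times> 'k proj) set \<Rightarrow>
     ('m proj \<times> 'k proj \<Rightarrow> ('l::finite) proj) \<Rightarrow> bool" where
  "represents_rational_map Y U f \<longleftrightarrow>
     openin (subtopology zariski2 Y) U \<and> U \<noteq> {} \<and> regular_map_on U f"

definition dominant_on ::
  "(('m::finite) proj \<times> ('k::finite) proj) set \<Rightarrow> ('m proj \<times> 'k proj \<Rightarrow> ('l::finite) proj) \<Rightarrow> bool"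
  where
  "dominant_on U f \<longleftrightarrow> zariski closure_of (f ` U) = UNIV"

end

(* Let x be a generic point of X and w a generic tangent vector at x. The tangent bundle of X has
   the dimension of the ambient space, so that, as Tan X is everything, the differentials of its
   projection are generically surjective; this says that the second fundamental form II(w, -) maps
   the tangent space at x onto the normal space, with kernel the line x. Let y(t) be a formal arc in
   X with y(0) = x and y'(0) = w, obtained by exponentiating a polynomial vector field tangent to X.
   Comparing coefficients up to order t^2, the tangent spaces at x and y(t) meet in one point,
   namely x + t w/2 + O(t^2), up to a scalar. Hence a form vanishing at all intersection points
   vanishes, to lowest order, in all directions w/2 at x; so it vanishes on the tangent space at x,
   and, x being generic, on Tan X.
   That the generic tangent space has dimension dim X follows from a chain of irreducible closed
   subsets, which yields algebraically independent functions, and from the extension of derivations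
   to algebraic extensions in characteristic 0. *)

theory Submission
  imports Defs "HOL-Computational_Algebra.Computational_Algebra"
begin

section \<open>Polynomials, evaluation and derivations\<close>

text \<open>The obstacle is the diagonal. Two tangent spaces are cut out by n linear equations each
  in 2n + 1 homogeneous coordinates, and their intersection point is the vector of maximal minors of
  these 2n equations. When the two base points coincide, the equations repeat and (for n > 0) all
  minors vanish, so the point x + t w/2 becomes visible only after division by a power of t. Formal
  power series make this division exact, and a polynomial vanishing on X pulls back to the zero
  series along the arc, so no limits or convergence occur. The factor 1/2 is a Taylor coefficient:
  as for a parabola, the tangents at parameters 0 and t meet over t/2. The vector fields tangent to
  X are cofactors of a matrix of gradients. They serve twice: to generate the arcs, and to carry
  vanishing on tangent vectors from a generic set to the tangent space at a prescribed smooth point.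
  That the minors do not all vanish identically and that the map is dominant both follow from one
  statement: no nonzero form vanishes at all the vectors of minors.\<close>

definition rhom :: "('a::comm_ring_1 \<Rightarrow> 'b::comm_ring_1) \<Rightarrow> bool" where
  "rhom h \<longleftrightarrow> (\<forall>x y. h (x + y) = h x + h y) \<and> (\<forall>x y. h (x * y) = h x * h y) \<and> h 1 = 1"

lemma rhomI: "\<lbrakk>\<And>x y. h (x + y) = h x + h y; \<And>x y. h (x * y) = h x * h y; h 1 = 1\<rbrakk> \<Longrightarrow> rhom h"
  by (simp add: rhom_def)

lemma rhom_add: "rhom h \<Longrightarrow> h (x + y) = h x + h y"
  and rhom_mult: "rhom h \<Longrightarrow> h (x * y) = h x * h y"
  and rhom_1: "rhom h \<Longrightarrow> h 1 = 1"
  by (simp_all add: rhom_def)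

lemma rhom_0: "rhom h \<Longrightarrow> h 0 = 0"
  by (metis add_cancel_left_left rhom_add)

lemma rhom_minus: "rhom h \<Longrightarrow> h (- x) = - h x"
  by (metis add.right_inverse rhom_0 rhom_add add_eq_0_iff)

lemma rhom_sum: "rhom h \<Longrightarrow> h (sum f A) = (\<Sum>x\<in>A. h (f x))"
  by (induction A rule: infinite_finite_induct) (auto simp: rhom_0 rhom_add)

lemma rhom_prod: "rhom h \<Longrightarrow> h (prod f A) = (\<Prod>x\<in>A. h (f x))"
  by (induction A rule: infinite_finite_induct) (auto simp: rhom_1 rhom_mult)

lemma rhom_of_nat: "rhom h \<Longrightarrow> h (of_nat k) = of_nat k"
  by (induction k) (auto simp: rhom_0 rhom_1 rhom_add)

lemma rhom_of_int: "rhom h \<Longrightarrow> h (of_int k) = of_int k"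
  by (cases k rule: int_cases2) (auto simp: rhom_of_nat rhom_minus)

lemma rhom_comp: "rhom h \<Longrightarrow> rhom g \<Longrightarrow> rhom (\<lambda>x. h (g x))"
  by (simp add: rhom_def)

definition Const :: "complex \<Rightarrow> 'v mpoly" where
  "Const c = Poly_Mapping.single 0 c"

definition Var :: "'v \<Rightarrow> 'v mpoly" where
  "Var i = Poly_Mapping.single (Poly_Mapping.single i 1) 1"

lemma rhom_Const: "rhom (Const :: complex \<Rightarrow> 'v mpoly)"
  by (rule rhomI) (simp_all add: Const_def single_add mult_single)

lemma Const_0 [simp]: "Const 0 = 0" and Const_1 [simp]: "Const 1 = 1"
  by (simp_all add: Const_def)

lemma mpoly_mono_induct [case_names mono add]:
  fixes F :: "'v mpoly"
  assumes mono: "\<And>m c. P (Poly_Mapping.single m c)" and add: "\<And>F G. P F \<Longrightarrow> P G \<Longrightarrow> P (F + G)"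
  shows "P F"
proof -
  have eq: "F = (\<Sum>m\<in>Poly_Mapping.keys F. Poly_Mapping.single m (Poly_Mapping.lookup F m))"
  proof (rule poly_mapping_eqI)
    fix k
    show "Poly_Mapping.lookup F k = Poly_Mapping.lookup (\<Sum>m\<in>Poly_Mapping.keys F. Poly_Mapping.single m (Poly_Mapping.lookup F m)) k"
      by (simp add: lookup_sum lookup_single when_def in_keys_iff)
  qed
  have "P (\<Sum>m\<in>M. Poly_Mapping.single m (Poly_Mapping.lookup F m))" if "finite M" for M
    using that
  proof (induction M)
    case empty
    show ?case using mono[of 0 0] by simp
  next
    case (insert x M)
    then show ?case by (simp add: mono add)
  qed
  with eq show ?thesis by (metis finite_keys)
qed

lemma single_sum_monom:
  "finite A \<Longrightarrow> Poly_Mapping.single (sum f A) (1::complex) = (\<Prod>i\<in>A. Poly_Mapping.single (f i) 1)"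
proof (induction A rule: finite_induct)
  case (insert x A)
  then show ?case by (simp add: mult_single flip: insert.IH)
qed (simp add: single_one)

lemma Var_power: "Var i ^ k = Poly_Mapping.single (Poly_Mapping.single i k) 1"
proof (induction k)
  case (Suc k)
  then show ?case by (simp add: Var_def mult_single single_add[symmetric])
qed (simp add: single_one)

lemma single_eq_prod_Var:
  fixes m :: "'v::finite \<Rightarrow>\<^sub>0 nat"
  shows "Poly_Mapping.single m c = Const c * (\<Prod>i\<in>UNIV. Var i ^ Poly_Mapping.lookup m i)"
proof -
  have m: "m = (\<Sum>i\<in>UNIV. Poly_Mapping.single i (Poly_Mapping.lookup m i))"
    by (rule poly_mapping_eqI) (simp add: lookup_sum lookup_single when_def)
  have "Poly_Mapping.single m 1 = (\<Prod>i\<in>UNIV. Var i ^ Poly_Mapping.lookup m i)"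
    by (subst m, subst single_sum_monom) (auto simp: Var_power)
  then show ?thesis
    by (metis Const_def mult_single add_0 mult.right_neutral)
qed

lemma mpoly_induct [case_names Const Var add mult]:
  fixes F :: "'v::finite mpoly"
  assumes "\<And>c. P (Const c)" "\<And>i. P (Var i)" and add: "\<And>F G. P F \<Longrightarrow> P G \<Longrightarrow> P (F + G)"
    and mult: "\<And>F G. P F \<Longrightarrow> P G \<Longrightarrow> P (F * G)"
  shows "P F"
proof (induction F rule: mpoly_mono_induct)
  case (mono m c)
  have 1: "P 1" using assms(1)[of 1] by simp
  have pow: "P (Var i ^ k)" for i k
    by (induction k) (auto intro: 1 assms)
  have "P (\<Prod>i\<in>A. Var i ^ Poly_Mapping.lookup m i)" for A
    by (induction A rule: infinite_finite_induct) (auto intro: 1 mult pow)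
  then show ?case by (auto simp: single_eq_prod_Var intro: mult assms)
qed (auto intro: add)

lemma sum_keys_superset:
  assumes "finite M" "Poly_Mapping.keys F \<subseteq> M" "\<And>m. f m 0 = 0"
  shows "(\<Sum>m\<in>Poly_Mapping.keys F. f m (Poly_Mapping.lookup F m)) = (\<Sum>m\<in>M. f m (Poly_Mapping.lookup F m))"
  by (rule sum.mono_neutral_left) (use assms in \<open>auto simp: in_keys_iff\<close>)

text \<open>Both supports can be enlarged to their union, where the summand is additive. Evaluation
  and partial derivatives are both sums of this shape.\<close>

lemma sum_keys_add:
  fixes F G :: "'a \<Rightarrow>\<^sub>0 'b::monoid_add" and f :: "'a \<Rightarrow> 'b \<Rightarrow> 'c::comm_monoid_add"
  assumes "\<And>m. f m 0 = 0" "\<And>m c d. f m (c + d) = f m c + f m d"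
  shows "(\<Sum>m\<in>Poly_Mapping.keys (F + G). f m (Poly_Mapping.lookup (F + G) m)) =
     (\<Sum>m\<in>Poly_Mapping.keys F. f m (Poly_Mapping.lookup F m)) + (\<Sum>m\<in>Poly_Mapping.keys G. f m (Poly_Mapping.lookup G m))"
proof -
  let ?M = "Poly_Mapping.keys F \<union> Poly_Mapping.keys G"
  have "Poly_Mapping.keys (F + G) \<subseteq> ?M" by (rule Poly_Mapping.keys_add)
  then show ?thesis
    by (subst (1 2 3) sum_keys_superset[where M = ?M])
      (use assms in \<open>auto simp: lookup_add sum.distrib\<close>)
qed

text \<open>Coefficients are transported along \<open>\<kappa>\<close>: the identity gives values,
  \<open>Const\<close> gives substitution of polynomials, \<open>fps_const\<close> gives evaluation
  on formal arcs, and constant univariate polynomials give the restriction to a line.\<close>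

definition meval :: "(complex \<Rightarrow> 'a::comm_ring_1) \<Rightarrow> ('v::finite) mpoly \<Rightarrow> ('v \<Rightarrow> 'a) \<Rightarrow> 'a" where
  "meval \<kappa> F a = (\<Sum>m\<in>Poly_Mapping.keys F.
     \<kappa> (Poly_Mapping.lookup F m) * (\<Prod>i\<in>UNIV. a i ^ Poly_Mapping.lookup m i))"

lemma mp_eval_meval: "mp_eval = meval (\<lambda>c. c)"
  by (intro ext) (simp add: mp_eval_def meval_def)

lemma rhom_id: "rhom (\<lambda>c. c)"
  by (simp add: rhom_def)

lemma meval_single:
  assumes "rhom \<kappa>"
  shows "meval \<kappa> (Poly_Mapping.single m c) a = \<kappa> c * (\<Prod>i\<in>UNIV. a i ^ Poly_Mapping.lookup m i)"
  using rhom_0[OF assms] by (cases "c = 0") (auto simp: meval_def)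

lemma meval_add:
  assumes "rhom \<kappa>" shows "meval \<kappa> (F + G) a = meval \<kappa> F a + meval \<kappa> G a"
  unfolding meval_def
  by (rule sum_keys_add[where f = "\<lambda>m c. \<kappa> c * (\<Prod>i\<in>UNIV. a i ^ Poly_Mapping.lookup m i)"])
    (use assms in \<open>auto simp: rhom_0 rhom_add distrib_right\<close>)

lemma meval_mult:
  assumes k: "rhom \<kappa>" shows "meval \<kappa> (F * G) a = meval \<kappa> F a * meval \<kappa> G a"
proof (induction F rule: mpoly_mono_induct)
  case (mono m c)
  show ?case
    by (induction G rule: mpoly_mono_induct)
      (simp_all add: k meval_single mult_single meval_add rhom_mult lookup_add power_add prod.distrib algebra_simps)
qed (simp_all add: k meval_add distrib_right)

lemma rhom_meval: "rhom \<kappa> \<Longrightarrow> rhom (\<lambda>F. meval \<kappa> F a)"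
  by (rule rhomI) (use meval_single[of \<kappa> 0 1 a] in \<open>simp_all add: meval_add meval_mult rhom_1\<close>)

lemma rhom_mp_eval: "rhom (\<lambda>F. mp_eval F a)"
  by (simp add: mp_eval_meval rhom_id rhom_meval)

lemma meval_Const [simp]: "rhom \<kappa> \<Longrightarrow> meval \<kappa> (Const c) a = \<kappa> c"
  by (simp add: Const_def meval_single)

lemma meval_Var [simp]: "rhom \<kappa> \<Longrightarrow> meval \<kappa> (Var i) a = a i"
proof -
  assume "rhom \<kappa>"
  moreover have "(\<Prod>j\<in>UNIV. a j ^ Poly_Mapping.lookup (Poly_Mapping.single i (1::nat)) j) = (\<Prod>j\<in>UNIV. if j = i then a j else 1)"
    by (rule prod.cong) (auto simp: lookup_single when_def)
  ultimately show ?thesis by (simp add: Var_def meval_single rhom_1)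
qed

lemmas mp_eval_Const [simp] = meval_Const[OF rhom_id, folded mp_eval_meval]
  and mp_eval_Var [simp] = meval_Var[OF rhom_id, folded mp_eval_meval]
  and mp_eval_add [simp] = rhom_add[OF rhom_mp_eval]
  and mp_eval_mult [simp] = rhom_mult[OF rhom_mp_eval]
  and mp_eval_0 [simp] = rhom_0[OF rhom_mp_eval]
  and mp_eval_1 [simp] = rhom_1[OF rhom_mp_eval]
  and mp_eval_sum = rhom_sum[OF rhom_mp_eval]
  and mp_eval_prod = rhom_prod[OF rhom_mp_eval]

text \<open>Universal property of the polynomial ring.\<close>

lemma rhom_eq_meval:
  assumes h: "rhom h" and "\<And>c. h (Const c) = \<kappa> c"
  shows "h F = meval \<kappa> F (\<lambda>i. h (Var i))"
proof -
  have k: "rhom \<kappa>"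
    using rhom_comp[OF h rhom_Const] assms(2) by simp
  show ?thesis
    by (induction F rule: mpoly_induct)
      (use assms in \<open>simp_all add: k rhom_add[OF h] rhom_mult[OF h] meval_add meval_mult\<close>)
qed

lemma meval_comp:
  assumes k: "rhom \<kappa>" and h: "rhom h"
  shows "h (meval \<kappa> F a) = meval (\<lambda>c. h (\<kappa> c)) F (\<lambda>i. h (a i))"
  using rhom_eq_meval[of "\<lambda>F. h (meval \<kappa> F a)" "\<lambda>c. h (\<kappa> c)" F]
  by (simp add: rhom_comp[OF h rhom_meval[OF k]] k)

lemma mp_eval_subst:
  "mp_eval (meval Const F a) b = mp_eval F (\<lambda>i. mp_eval (a i) b)"
  using meval_comp[OF rhom_Const rhom_mp_eval, where a = a and F = F] by (simp add: mp_eval_meval rhom_id)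

lemma mp_partial_single:
  "mp_partial i (Poly_Mapping.single m c) =
     Poly_Mapping.single (m - Poly_Mapping.single i 1) (of_nat (Poly_Mapping.lookup m i) * c)"
  by (cases "c = 0") (auto simp: mp_partial_def)

lemma mp_partial_add: "mp_partial i (F + G) = mp_partial i F + mp_partial i G"
  unfolding mp_partial_def
  by (rule sum_keys_add[where f = "\<lambda>m c. Poly_Mapping.single (m - Poly_Mapping.single i 1) (of_nat (Poly_Mapping.lookup m i) * c)"])
   (auto simp: single_add[symmetric] distrib_left)

lemma monom_diff_add:
  fixes m m' :: "'v \<Rightarrow>\<^sub>0 nat"
  assumes "Poly_Mapping.lookup m i > 0"
  shows "m + m' - Poly_Mapping.single i 1 = m - Poly_Mapping.single i 1 + m'"
  using assms by (intro poly_mapping_eqI) (auto simp: lookup_minus lookup_add lookup_single when_def)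

lemma mp_partial_mult: "mp_partial i (F * G) = mp_partial i F * G + F * mp_partial i G"
proof (induction F rule: mpoly_mono_induct)
  case (mono m c)
  show ?case
  proof (induction G rule: mpoly_mono_induct)
    case (mono m' c')
    \<comment> \<open>If the exponent of \<open>i\<close> is 0, the exponents may differ by
      truncation, but then the coefficient is 0.\<close>
    have 1: "Poly_Mapping.single (m + m' - Poly_Mapping.single i 1) (of_nat (Poly_Mapping.lookup m i) * c * c')
       = Poly_Mapping.single (m - Poly_Mapping.single i 1 + m') (of_nat (Poly_Mapping.lookup m i) * c * c')"
      using monom_diff_add[of m i m'] by (cases "Poly_Mapping.lookup m i = 0") auto
    have 2: "Poly_Mapping.single (m + m' - Poly_Mapping.single i 1) (c * (of_nat (Poly_Mapping.lookup m' i) * c'))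
       = Poly_Mapping.single (m + (m' - Poly_Mapping.single i 1)) (c * (of_nat (Poly_Mapping.lookup m' i) * c'))"
      using monom_diff_add[of m' i m] by (cases "Poly_Mapping.lookup m' i = 0") (auto simp: add.commute)
    have "mp_partial i (Poly_Mapping.single m c * Poly_Mapping.single m' c') =
        Poly_Mapping.single (m + m' - Poly_Mapping.single i 1)
          (of_nat (Poly_Mapping.lookup m i) * c * c' + c * (of_nat (Poly_Mapping.lookup m' i) * c'))"
      unfolding mult_single mp_partial_single by (simp add: lookup_add algebra_simps)
    then show ?case
      unfolding single_add 1 2 mp_partial_single mult_single .
  qed (simp_all add: mp_partial_add distrib_left)
qed (simp_all add: mp_partial_add distrib_right)

lemma mp_partial_Const [simp]: "mp_partial i (Const c) = 0"
  by (simp add: Const_def mp_partial_single)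

lemma mp_partial_0 [simp]: "mp_partial i 0 = 0"
  using mp_partial_Const[of i 0] by simp

lemma mp_partial_1 [simp]: "mp_partial i 1 = 0"
  using mp_partial_Const[of i 1] by simp

lemma mp_partial_Var [simp]: "mp_partial i (Var j) = (if i = j then 1 else 0)"
  by (auto simp: Var_def mp_partial_single lookup_single when_def)

lemma mp_partial_sum: "mp_partial i (sum f A) = (\<Sum>x\<in>A. mp_partial i (f x))"
  by (induction A rule: infinite_finite_induct) (auto simp: mp_partial_add)

section \<open>Homogeneity\<close>

text \<open>Weights treat the homogeneous and the bihomogeneous case uniformly.\<close>

definition whomog :: "('v \<Rightarrow> nat) \<Rightarrow> nat \<Rightarrow> ('v::finite) mpoly \<Rightarrow> bool" where
  "whomog wt d F \<longleftrightarrow> (\<forall>m\<in>Poly_Mapping.keys F. (\<Sum>i\<in>UNIV. wt i * Poly_Mapping.lookup m i) = d)"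

lemma homogeneous_whomog: "homogeneous d F \<longleftrightarrow> whomog (\<lambda>_. 1) d F"
  by (simp add: homogeneous_def whomog_def)

lemma sum_plus_UNIV:
  "(\<Sum>i\<in>(UNIV :: ('a::finite + 'b::finite) set). f i) = (\<Sum>i\<in>UNIV. f (Inl i)) + (\<Sum>j\<in>UNIV. f (Inr j))"
  by (simp add: UNIV_Plus_UNIV[symmetric] sum.Plus del: UNIV_Plus_UNIV)

lemma bihomogeneous_whomog:
  "bihomogeneous d e F \<longleftrightarrow>
     whomog (case_sum (\<lambda>_. 1) (\<lambda>_. 0)) d F \<and> whomog (case_sum (\<lambda>_. 0) (\<lambda>_. 1)) e F"
  by (auto simp: bihomogeneous_def whomog_def sum_plus_UNIV)

lemma whomog_0 [simp]: "whomog wt d 0"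
  by (simp add: whomog_def)

lemma whomog_single: "(\<Sum>i\<in>UNIV. wt i * Poly_Mapping.lookup m i) = d \<Longrightarrow> whomog wt d (Poly_Mapping.single m c)"
  by (cases "c = 0") (simp_all add: whomog_def)

lemma whomog_Const: "whomog wt 0 (Const c)"
  unfolding Const_def by (rule whomog_single) simp

lemma whomog_1: "whomog wt 0 1"
  using whomog_Const[of wt 1] by simp

lemma whomog_Var: "whomog wt (wt i) (Var i)"
  unfolding Var_def by (rule whomog_single) (simp add: lookup_single when_def if_distrib cong: if_cong)

lemma whomog_add: "whomog wt d F \<Longrightarrow> whomog wt d G \<Longrightarrow> whomog wt d (F + G)"
  unfolding whomog_def using Poly_Mapping.keys_add[of F G] by blast

lemma whomog_sum: "(\<And>x. x \<in> A \<Longrightarrow> whomog wt d (f x)) \<Longrightarrow> whomog wt d (sum f A)"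
  by (induction A rule: infinite_finite_induct) (auto simp: whomog_add)

lemma whomog_mult: "whomog wt d F \<Longrightarrow> whomog wt e G \<Longrightarrow> whomog wt (d + e) (F * G)"
  unfolding whomog_def using keys_mult[of F G]
  by (fastforce simp: lookup_add distrib_left sum.distrib)

lemma whomog_prod: "(\<And>x. x \<in> A \<Longrightarrow> whomog wt (d x) (f x)) \<Longrightarrow> whomog wt (sum d A) (prod f A)"
  by (induction A rule: infinite_finite_induct) (auto simp: whomog_mult whomog_1)

lemma whomog_power: "whomog wt d F \<Longrightarrow> whomog wt (k * d) (F ^ k)"
  by (induction k) (auto simp: whomog_mult whomog_1)

text \<open>A monomial that survives differentiation contains \<open>i\<close>, so its weight is at
  least \<open>wt i\<close> and the subtraction is exact for it.\<close>

lemma whomog_partial: "whomog wt d F \<Longrightarrow> whomog wt (d - wt i) (mp_partial i F)"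
  unfolding mp_partial_def
proof (rule whomog_sum)
  fix m assume F: "whomog wt d F" and m: "m \<in> Poly_Mapping.keys F"
  let ?s = "Poly_Mapping.single (m - Poly_Mapping.single i 1) (of_nat (Poly_Mapping.lookup m i) * Poly_Mapping.lookup F m)"
  show "whomog wt (d - wt i) ?s"
  proof (cases "Poly_Mapping.lookup m i = 0")
    case False
    have "(\<Sum>j\<in>UNIV. wt j * Poly_Mapping.lookup m j) =
      (\<Sum>j\<in>UNIV. wt j * Poly_Mapping.lookup (m - Poly_Mapping.single i 1) j + (if j = i then wt i else 0))"
    proof (rule sum.cong)
      fix j
      obtain k where "Poly_Mapping.lookup m i = Suc k" using False not0_implies_Suc by blast
      then show "wt j * Poly_Mapping.lookup m j =
          wt j * Poly_Mapping.lookup (m - Poly_Mapping.single i 1) j + (if j = i then wt i else 0)"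
        by (auto simp: lookup_minus lookup_single when_def)
    qed simp
    also have "\<dots> = (\<Sum>j\<in>UNIV. wt j * Poly_Mapping.lookup (m - Poly_Mapping.single i 1) j) + wt i"
      by (simp add: sum.distrib)
    finally show ?thesis using F m by (intro whomog_single) (auto simp: whomog_def)
  qed simp
qed

lemma homogeneous_partial: "homogeneous d F \<Longrightarrow> homogeneous (d - 1) (mp_partial i F)"
  unfolding homogeneous_whomog by (rule whomog_partial)

lemma whomog_meval:
  assumes "whomog wt d F" "\<And>i. whomog wt' (wt i) (a i)"
  shows "whomog wt' d (meval Const F a)"
  unfolding meval_def
proof (rule whomog_sum)
  fix m assume "m \<in> Poly_Mapping.keys F"
  then have d: "d = 0 + (\<Sum>i\<in>UNIV. Poly_Mapping.lookup m i * wt i)"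
    using assms(1) by (simp add: whomog_def mult.commute)
  show "whomog wt' d (Const (Poly_Mapping.lookup F m) * (\<Prod>i\<in>UNIV. a i ^ Poly_Mapping.lookup m i))"
    unfolding d by (intro whomog_mult whomog_Const whomog_prod whomog_power assms)
qed

lemma whomog_eval:
  assumes "whomog wt d F"
  shows "meval \<kappa> F (\<lambda>i. t ^ wt i * a i) = t ^ d * meval \<kappa> F a"
  unfolding meval_def sum_distrib_left
proof (rule sum.cong)
  fix m assume m: "m \<in> Poly_Mapping.keys F"
  have "(\<Prod>i\<in>UNIV. (t ^ wt i * a i) ^ Poly_Mapping.lookup m i) =
      t ^ (\<Sum>i\<in>UNIV. wt i * Poly_Mapping.lookup m i) * (\<Prod>i\<in>UNIV. a i ^ Poly_Mapping.lookup m i)"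
    by (simp add: power_mult_distrib prod.distrib power_sum power_mult)
  then show "\<kappa> (Poly_Mapping.lookup F m) * (\<Prod>i\<in>UNIV. (t ^ wt i * a i) ^ Poly_Mapping.lookup m i) =
    t ^ d * (\<kappa> (Poly_Mapping.lookup F m) * (\<Prod>i\<in>UNIV. a i ^ Poly_Mapping.lookup m i))"
    using assms m by (simp add: whomog_def algebra_simps)
qed simp

lemma homogeneous_eval:
  "homogeneous d F \<Longrightarrow> meval \<kappa> F (\<lambda>i. t * a i) = t ^ d * meval \<kappa> F a"
  using whomog_eval[of "\<lambda>_. 1" d F \<kappa> t a] by (simp add: homogeneous_whomog)

lemma homogeneous_mp_eval:
  "homogeneous d F \<Longrightarrow> mp_eval F (\<lambda>i. t * a i) = t ^ d * mp_eval F a"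
  unfolding mp_eval_meval by (rule homogeneous_eval)

lemma homogeneous_decomposition:
  fixes F :: "'v::finite mpoly"
  shows "\<exists>D c. (\<forall>d. homogeneous d (c d)) \<and> F = (\<Sum>d<D. c d)"
proof (induction F rule: mpoly_mono_induct)
  case (mono m c)
  let ?d = "\<Sum>i\<in>UNIV. Poly_Mapping.lookup m i"
  have "\<forall>d. homogeneous d (if d = ?d then Poly_Mapping.single m c else 0)"
    using whomog_single[of "\<lambda>_. 1" m ?d c] by (simp add: homogeneous_whomog)
  moreover have "Poly_Mapping.single m c = (\<Sum>d<Suc ?d. if d = ?d then Poly_Mapping.single m c else 0)"
    by simp
  ultimately show ?case
    by (intro exI[of _ "Suc ?d"] exI[of _ "\<lambda>d. if d = ?d then Poly_Mapping.single m c else 0"] conjI)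
next
  case (add F G)
  then obtain D c D' c' where 1: "\<forall>d. homogeneous d (c d)" "F = (\<Sum>d<D. c d)"
     and 2: "\<forall>d. homogeneous d (c' d)" "G = (\<Sum>d<D'. c' d)" by blast
  let ?c = "\<lambda>d. (if d < D then c d else 0) + (if d < D' then c' d else 0)"
  have "F = (\<Sum>d<max D D'. if d < D then c d else 0)" "G = (\<Sum>d<max D D'. if d < D' then c' d else 0)"
    unfolding 1 2 by (rule sum.mono_neutral_cong_left; auto)+
  then have "F + G = (\<Sum>d<max D D'. ?c d)" by (simp add: sum.distrib)
  moreover have "\<forall>d. homogeneous d (?c d)"
    using 1 2 by (simp add: homogeneous_whomog whomog_add)
  ultimately show ?case by (intro exI[of _ "max D D'"] exI[of _ ?c] conjI)
qed

lemma Euler_homogeneous: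
  fixes F :: "'v::finite mpoly"
  assumes "homogeneous d F"
  shows "(\<Sum>i\<in>UNIV. mp_partial i F * Var i) = of_nat d * F"
proof -
  have mono: "(\<Sum>i\<in>UNIV. mp_partial i (Poly_Mapping.single m c) * Var i) =
      of_nat (\<Sum>i\<in>UNIV. Poly_Mapping.lookup m i) * Poly_Mapping.single m c" for m :: "'v \<Rightarrow>\<^sub>0 nat" and c
  proof -
    have "mp_partial i (Poly_Mapping.single m c) * Var i = of_nat (Poly_Mapping.lookup m i) * Poly_Mapping.single m c" for i
    proof (cases "Poly_Mapping.lookup m i = 0")
      case False
      then have "m - Poly_Mapping.single i 1 + Poly_Mapping.single i 1 = m"
        by (intro poly_mapping_eqI) (auto simp: lookup_minus lookup_add lookup_single when_def)
      then show ?thesis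
        by (simp add: mp_partial_single Var_def mult_single flip: single_of_nat)
    qed (simp add: mp_partial_single)
    then show ?thesis by (simp add: sum_distrib_right)
  qed
  have F: "F = (\<Sum>m\<in>Poly_Mapping.keys F. Poly_Mapping.single m (Poly_Mapping.lookup F m))"
    by (rule poly_mapping_eqI) (simp add: lookup_sum lookup_single when_def in_keys_iff)
  have "(\<Sum>i\<in>UNIV. mp_partial i F * Var i) =
      (\<Sum>m\<in>Poly_Mapping.keys F. \<Sum>i\<in>UNIV. mp_partial i (Poly_Mapping.single m (Poly_Mapping.lookup F m)) * Var i)"
    by (subst F, subst sum.swap) (simp add: mp_partial_sum sum_distrib_right)
  also have "\<dots> = (\<Sum>m\<in>Poly_Mapping.keys F. of_nat d * Poly_Mapping.single m (Poly_Mapping.lookup F m))"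
    by (rule sum.cong) (use assms in \<open>auto simp: mono homogeneous_def\<close>)
  also have "\<dots> = of_nat d * F"
    by (subst (2) F) (simp add: sum_distrib_left)
  finally show ?thesis .
qed

text \<open>Irreducibility of affine space: on the line through \<open>a\<close> and
  \<open>b\<close> both polynomials restrict to nonzero univariate ones, and their product has a
  point where it does not vanish.\<close>

lemma mp_eval_prod_nonzero:
  fixes F G :: "'v::finite mpoly"
  assumes "mp_eval F a \<noteq> 0" "mp_eval G b \<noteq> 0"
  shows "\<exists>c. mp_eval F c \<noteq> 0 \<and> mp_eval G c \<noteq> 0"
proof -
  define q where "q = (\<lambda>F. meval (\<lambda>c. [:c:]) F (\<lambda>i. [:a i, b i - a i:]))"
  have k: "rhom (\<lambda>c::complex. [:c:])"
    by (rule rhomI) (auto simp: one_pCons)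
  have poly_hom: "rhom (\<lambda>p. poly p t)" for t :: complex
    by (simp add: rhom_def)
  have q: "poly (q F) t = mp_eval F (\<lambda>i. a i + t * (b i - a i))" for F t
    unfolding q_def by (subst meval_comp[OF k poly_hom]) (simp add: mp_eval_meval)
  have "poly (q F) 0 \<noteq> 0" "poly (q G) 1 \<noteq> 0"
    using assms by (simp_all add: q)
  then have "q F * q G \<noteq> 0" by auto
  then obtain t where "poly (q F * q G) t \<noteq> 0"
    using poly_all_0_iff_0 by blast
  then show ?thesis using q by (metis mult_zero_left mult_zero_right poly_mult)
qed

text \<open>For nonempty \<open>C\<close> this says that the vanishing ideal is prime. Closedness is
  not asked for, so that images of polynomial maps, such as graphs and a parametrised tangent
  bundle, are covered.\<close>

definition irr :: "(('v::finite) \<Rightarrow> complex) set \<Rightarrow> bool" where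
  "irr C \<longleftrightarrow> C \<noteq> {} \<and> (\<forall>F G. (\<exists>a\<in>C. mp_eval F a \<noteq> 0) \<longrightarrow> (\<exists>a\<in>C. mp_eval G a \<noteq> 0) \<longrightarrow>
     (\<exists>a\<in>C. mp_eval F a \<noteq> 0 \<and> mp_eval G a \<noteq> 0))"

definition VI :: "(('v::finite) \<Rightarrow> complex) set \<Rightarrow> 'v mpoly set" where
  "VI C = {F. \<forall>a\<in>C. mp_eval F a = 0}"

lemma irr_mult: "irr C \<Longrightarrow> F \<notin> VI C \<Longrightarrow> G \<notin> VI C \<Longrightarrow> F * G \<notin> VI C"
  unfolding irr_def VI_def mem_Collect_eq mp_eval_mult mult_eq_0_iff by meson

lemma irr_prod: "irr C \<Longrightarrow> (\<And>x. x \<in> A \<Longrightarrow> f x \<notin> VI C) \<Longrightarrow> prod f A \<notin> VI C"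
proof (induction A rule: infinite_finite_induct)
  case (insert x A)
  then show ?case by (simp add: irr_mult)
qed (auto simp: irr_def VI_def)

lemma irr_power: "irr C \<Longrightarrow> F \<notin> VI C \<Longrightarrow> F ^ k \<notin> VI C"
  using irr_prod[of C "{..<k}" "\<lambda>_. F"] by simp

lemma VI_0 [simp]: "0 \<in> VI C" by (simp add: VI_def)
lemma VI_add: "F \<in> VI C \<Longrightarrow> G \<in> VI C \<Longrightarrow> F + G \<in> VI C" by (simp add: VI_def)
lemma VI_mult: "F \<in> VI C \<Longrightarrow> F * G \<in> VI C" "G \<in> VI C \<Longrightarrow> F * G \<in> VI C" by (simp_all add: VI_def)
lemma VI_diff: "F \<in> VI C \<Longrightarrow> G \<in> VI C \<Longrightarrow> F - G \<in> VI C"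
  by (simp add: VI_def rhom_minus[OF rhom_mp_eval] diff_conv_add_uminus del: add_uminus_conv_diff)
lemma VI_sum: "(\<And>x. x \<in> A \<Longrightarrow> f x \<in> VI C) \<Longrightarrow> sum f A \<in> VI C"
  by (simp add: VI_def mp_eval_sum)

lemma VI_of_nat: "of_nat k * F \<in> VI C \<Longrightarrow> k > 0 \<Longrightarrow> F \<in> VI C"
  by (simp add: VI_def rhom_of_nat[OF rhom_mp_eval])

section \<open>Extension of derivations\<close>

text \<open>The subring generated by some of the variables stays inside the ring in all of them, so
  variables can be adjoined one at a time without a change of type.\<close>

inductive_set pring :: "'v set \<Rightarrow> ('v::finite) mpoly set" for A where
  Const: "Const c \<in> pring A"
| Var: "i \<in> A \<Longrightarrow> Var i \<in> pring A"
| add: "F \<in> pring A \<Longrightarrow> G \<in> pring A \<Longrightarrow> F + G \<in> pring A"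
| mult: "F \<in> pring A \<Longrightarrow> G \<in> pring A \<Longrightarrow> F * G \<in> pring A"

lemma pring_UNIV: "F \<in> pring UNIV"
  by (induction F rule: mpoly_induct) (auto intro: pring.intros)

lemma pring_0: "0 \<in> pring A" and pring_1: "1 \<in> pring A"
  using pring.Const[of 0 A] pring.Const[of 1 A] by simp_all

lemma pring_minus: "F \<in> pring A \<Longrightarrow> - F \<in> pring A"
  using pring.mult[OF pring.Const[of "-1"], of F A] by (simp add: rhom_minus[OF rhom_Const, of 1, simplified])

lemma pring_diff: "F \<in> pring A \<Longrightarrow> G \<in> pring A \<Longrightarrow> F - G \<in> pring A"
  using pring.add[OF _ pring_minus[of G A], of F] by simp

lemma pring_sum: "(\<And>x. x \<in> B \<Longrightarrow> f x \<in> pring A) \<Longrightarrow> sum f B \<in> pring A"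
  by (induction B rule: infinite_finite_induct) (auto simp: pring_0 pring.add)

lemma pring_partial: "F \<in> pring A \<Longrightarrow> i \<notin> A \<Longrightarrow> mp_partial i F = 0"
  by (induction rule: pring.induct) (auto simp: mp_partial_add mp_partial_mult)

lemma pring_empty: "F \<in> pring {} \<Longrightarrow> \<exists>c. F = Const c"
proof (induction rule: pring.induct)
  case (add F G) then show ?case using rhom_add[OF rhom_Const] by metis
next
  case (mult F G) then show ?case using rhom_mult[OF rhom_Const] by metis
qed auto

text \<open>By \<open>pring_insert\<close>, the ring over \<open>insert k A\<close> consists of the
  values of these univariate polynomials at \<open>Var k\<close>; division with remainder is carried
  out on them.\<close>

definition pcoeffs :: "'v set \<Rightarrow> ('v::finite) mpoly poly set" where
  "pcoeffs A = {p. \<forall>k. coeff p k \<in> pring A}"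

lemma pcoeffs_add: "p \<in> pcoeffs A \<Longrightarrow> q \<in> pcoeffs A \<Longrightarrow> p + q \<in> pcoeffs A"
  by (simp add: pcoeffs_def pring.add)
lemma pcoeffs_diff: "p \<in> pcoeffs A \<Longrightarrow> q \<in> pcoeffs A \<Longrightarrow> p - q \<in> pcoeffs A"
  by (simp add: pcoeffs_def pring_diff)
lemma pcoeffs_mult: "p \<in> pcoeffs A \<Longrightarrow> q \<in> pcoeffs A \<Longrightarrow> p * q \<in> pcoeffs A"
  by (simp add: pcoeffs_def coeff_mult pring_sum pring.mult)
lemma pcoeffs_monom: "c \<in> pring A \<Longrightarrow> monom c k \<in> pcoeffs A"
  by (simp add: pcoeffs_def coeff_monom pring_0)
text \<open>The library's \<open>pderiv\<close> needs a coefficient ring without zero divisors, a class instance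
  that multivariate polynomials only have for linearly ordered variables.\<close>

definition pdiff :: "'a::comm_ring_1 poly \<Rightarrow> 'a poly" where
  "pdiff p = (\<Sum>i<degree p. monom (of_nat (Suc i) * coeff p (Suc i)) i)"

lemma coeff_pdiff: "coeff (pdiff p) j = of_nat (Suc j) * coeff p (Suc j)"
  by (simp add: pdiff_def coeff_sum coeff_monom coeff_eq_0 if_distrib cong: if_cong del: of_nat_Suc)

lemma pdiff_0: "pdiff 0 = 0"
  by (simp add: pdiff_def)

lemma pdiff_pCons: "pdiff (pCons c p) = p + pCons 0 (pdiff p)"
  by (rule poly_eqI, case_tac n) (simp_all add: coeff_pdiff coeff_pCons algebra_simps)

lemma pcoeffs_pdiff: "p \<in> pcoeffs A \<Longrightarrow> pdiff p \<in> pcoeffs A"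
  by (simp add: pcoeffs_def coeff_pdiff pring.mult rhom_of_nat[OF rhom_Const, symmetric] pring.Const
      del: of_nat_Suc)

lemma pring_insert:
  assumes "F \<in> pring (insert k A)"
  shows "\<exists>p\<in>pcoeffs A. F = poly p (Var k)"
  using assms
proof (induction rule: pring.induct)
  case (Const c)
  then show ?case
    by (intro bexI[of _ "monom (Const c) 0"]) (auto intro: pcoeffs_monom pring.intros simp: poly_monom)
next
  case (Var i)
  show ?case
  proof (cases "i = k")
    case True
    then show ?thesis by (intro bexI[of _ "monom 1 1"]) (auto intro: pcoeffs_monom simp: pring_1 poly_monom)
  next
    case False
    then show ?thesis using Var
      by (intro bexI[of _ "monom (Var i) 0"]) (auto intro: pcoeffs_monom pring.intros simp: poly_monom)
  qed
next
  case (add F G)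
  then show ?case by (metis poly_add pcoeffs_add)
next
  case (mult F G)
  then show ?case by (metis poly_mult pcoeffs_mult)
qed

text \<open>Leading coefficients are not invertible, so each reduction step multiplies
  \<open>g\<close> by that of \<open>p\<close> before it cancels the top term; the powers collect on
  the left.\<close>

lemma pseudo_division:
  fixes p g :: "('v::finite) mpoly poly"
  assumes p: "p \<in> pcoeffs A" "degree p = Suc e" and "g \<in> pcoeffs A"
  shows "\<exists>m q r. q \<in> pcoeffs A \<and> r \<in> pcoeffs A \<and> degree r \<le> e \<and> smult (lead_coeff p ^ m) g = p * q + r"
  using assms(3)
proof (induction "degree g" arbitrary: g rule: less_induct)
  case less
  show ?case
  proof (cases "degree g \<le> e")
    case True
    then show ?thesis
      by (intro exI[of _ 0] exI[of _ 0] exI[of _ g]) (use less in \<open>auto simp: pcoeffs_def pring_0\<close>)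
  next
    case False
    let ?l = "lead_coeff p" and ?d = "degree g - degree p"
    define g' where "g' = smult ?l g - monom (lead_coeff g) ?d * p"
    have l: "?l \<in> pring A" using p by (simp add: pcoeffs_def)
    have sm: "smult ?l g \<in> pcoeffs A"
      using less.prems l by (simp add: pcoeffs_def pring.mult)
    have mp: "monom (lead_coeff g) ?d * p \<in> pcoeffs A"
      using less.prems p by (intro pcoeffs_mult pcoeffs_monom) (auto simp: pcoeffs_def)
    have g': "g' \<in> pcoeffs A" unfolding g'_def using sm mp by (rule pcoeffs_diff)
    have "degree g' \<le> degree g"
      unfolding g'_def
      by (intro degree_diff_le degree_smult_le order_trans[OF degree_mult_le])
        (use False p degree_monom_le[of "lead_coeff g" "degree g - Suc e"] in auto)
    moreover have "coeff g' (degree g) = 0"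
      unfolding g'_def using False p by (simp add: coeff_monom_mult)
    ultimately have "degree g' < degree g"
      using False eq_zero_or_degree_less[of g' "degree g"] by auto
    from less.hyps[OF this g'] obtain m q r where IH: "q \<in> pcoeffs A" "r \<in> pcoeffs A" "degree r \<le> e"
       "smult (?l ^ m) g' = p * q + r" by blast
    have "smult (?l ^ Suc m) g = p * (q + smult (?l ^ m) (monom (lead_coeff g) ?d)) + r"
    proof -
      have "smult (?l ^ Suc m) g = smult (?l ^ m) (g' + monom (lead_coeff g) ?d * p)"
        by (simp add: g'_def mult.commute)
      also have "\<dots> = p * (q + smult (?l ^ m) (monom (lead_coeff g) ?d)) + r"
        by (simp add: smult_add_right IH algebra_simps)
      finally show ?thesis .
    qed
    moreover have "q + smult (?l ^ m) (monom (lead_coeff g) ?d) \<in> pcoeffs A"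
    proof -
      have "?l ^ m \<in> pring A" by (induction m) (auto simp: pring_1 l pring.mult)
      then show ?thesis using IH less.prems
        by (intro pcoeffs_add) (auto simp: pcoeffs_def coeff_monom intro!: pring.mult pring_0)
    qed
    ultimately show ?thesis using IH by blast
  qed
qed

section \<open>Polynomial vector fields as derivations modulo a vanishing ideal\<close>

definition vfield :: "('v \<Rightarrow> ('v::finite) mpoly) \<Rightarrow> 'v mpoly \<Rightarrow> 'v mpoly" where
  "vfield \<alpha> F = (\<Sum>i\<in>UNIV. \<alpha> i * mp_partial i F)"

lemma vfield_add: "vfield \<alpha> (F + G) = vfield \<alpha> F + vfield \<alpha> G"
  by (simp add: vfield_def mp_partial_add distrib_left sum.distrib)

lemma vfield_mult: "vfield \<alpha> (F * G) = vfield \<alpha> F * G + F * vfield \<alpha> G"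
  by (simp add: vfield_def mp_partial_mult sum.distrib sum_distrib_left sum_distrib_right algebra_simps)

lemma vfield_Const [simp]: "vfield \<alpha> (Const c) = 0"
  by (simp add: vfield_def)

lemma vfield_Var [simp]: "vfield \<alpha> (Var i) = \<alpha> i"
  by (simp add: vfield_def if_distrib cong: if_cong)

lemma vfield_0 [simp]: "vfield \<alpha> 0 = 0"
  by (simp add: vfield_def)

lemma vfield_poly:
  "vfield \<alpha> (poly p x) = poly (map_poly (vfield \<alpha>) p) x + poly (pdiff p) x * vfield \<alpha> x"
proof (induction p)
  case (pCons c p)
  then show ?case
    by (simp add: vfield_add vfield_mult pdiff_pCons map_poly_pCons algebra_simps)
qed (simp add: pdiff_0)

lemma poly_VI: "(\<And>k. coeff p k \<in> VI C) \<Longrightarrow> poly p x \<in> VI C"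
  by (simp add: poly_altdef VI_sum VI_mult)

text \<open>Among the relations for \<open>Var k\<close> over \<open>A\<close> that are nontrivial modulo \<open>VI C\<close>, one of minimal degree
  generates all others up to a power of its leading coefficient, and in characteristic 0 it is
  separable; so it determines the value of the extended derivation on \<open>Var k\<close>.\<close>

lemma extend_derivation_step:
  fixes C :: "('v::finite \<Rightarrow> complex) set"
  assumes C: "irr C" and k: "k \<notin> A"
    and D: "\<And>F. F \<in> VI C \<Longrightarrow> F \<in> pring A \<Longrightarrow> vfield \<alpha> F \<in> VI C"
  shows "\<exists>\<alpha>' u. u \<notin> VI C \<and> (\<forall>i\<in>A. \<alpha>' i = u * \<alpha> i) \<and>
     (\<forall>F\<in>VI C. F \<in> pring (insert k A) \<longrightarrow> vfield \<alpha>' F \<in> VI C)"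
proof -
  have pc: "vfield (\<lambda>i. if i = k then w else u * \<alpha> i) c = u * vfield \<alpha> c" if "c \<in> pring A" for c u w
    unfolding vfield_def sum_distrib_left
    by (rule sum.cong) (auto simp: pring_partial[OF that k] mult.assoc)
  have vp: "vfield (\<lambda>i. if i = k then w else u * \<alpha> i) (poly p (Var k)) =
      u * poly (map_poly (vfield \<alpha>) p) (Var k) + poly (pdiff p) (Var k) * w"
    if "p \<in> pcoeffs A" for p u w
  proof -
    have "map_poly (vfield (\<lambda>i. if i = k then w else u * \<alpha> i)) p = smult u (map_poly (vfield \<alpha>) p)"
      by (rule poly_eqI) (use that in \<open>simp add: coeff_map_poly pcoeffs_def pc\<close>)
    then show ?thesis by (simp add: vfield_poly)
  qed
  have Dp: "poly (map_poly (vfield \<alpha>) p) x \<in> VI C" if "p \<in> pcoeffs A" "\<And>j. coeff p j \<in> VI C" for p x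
    by (rule poly_VI) (use that in \<open>simp add: coeff_map_poly D pcoeffs_def\<close>)
  define good where "good = (\<lambda>p. p \<in> pcoeffs A \<and> poly p (Var k) \<in> VI C \<and> (\<exists>j. coeff p j \<notin> VI C))"
  show ?thesis
  proof (cases "\<exists>p. good p")
    \<comment> \<open>The transcendental case: no relation constrains the value on
      \<open>Var k\<close>, and 0 is chosen.\<close>
    case False
    show ?thesis
    proof (intro exI conjI ballI impI)
      show "1 \<notin> VI C" using C by (auto simp: irr_def VI_def)
      show "(if i = k then 0 else 1 * \<alpha> i) = 1 * \<alpha> i" if "i \<in> A" for i using that k by auto
      fix F assume "F \<in> VI C" "F \<in> pring (insert k A)"
      then obtain p where p: "p \<in> pcoeffs A" "F = poly p (Var k)" using pring_insert by blast
      then have "coeff p j \<in> VI C" for j using False \<open>F \<in> VI C\<close> by (auto simp: good_def)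
      then show "vfield (\<lambda>i. if i = k then 0 else 1 * \<alpha> i) F \<in> VI C"
        unfolding p(2) vp[OF p(1)] using Dp[OF p(1)] by simp
    qed
  next
    case True
    then obtain p where gp: "good p" and min: "\<And>q. good q \<Longrightarrow> degree p \<le> degree q"
      using ex_has_least_nat[of good _ degree] by blast
    have p: "p \<in> pcoeffs A" "poly p (Var k) \<in> VI C" using gp by (auto simp: good_def)
    have small: "coeff r j \<in> VI C" if "r \<in> pcoeffs A" "poly r (Var k) \<in> VI C" "degree r < degree p" for r j
      using min[of r] that by (fastforce simp: good_def)
    \<comment> \<open>Otherwise the leading term could be dropped, leaving a relation that is still
      nontrivial and has smaller degree.\<close>
    have lead: "lead_coeff p \<notin> VI C"
    proof
      assume l: "lead_coeff p \<in> VI C"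
      let ?q = "p - monom (lead_coeff p) (degree p)"
      have "poly ?q (Var k) \<in> VI C" using p l by (simp add: poly_monom VI_diff VI_mult)
      moreover have q: "?q \<in> pcoeffs A"
        using p by (intro pcoeffs_diff pcoeffs_monom) (auto simp: pcoeffs_def)
      moreover have "\<not> (\<forall>j. coeff ?q j \<in> VI C)"
      proof
        assume "\<forall>j. coeff ?q j \<in> VI C"
        then have "coeff p j \<in> VI C" for j
          using l by (cases "j = degree p") (force simp: coeff_monom split: if_splits)+
        then show False using gp by (auto simp: good_def)
      qed
      ultimately have gq: "good ?q" by (simp add: good_def)
      have "degree ?q \<le> degree p" by (rule degree_diff_le) (auto simp: degree_monom_le)
      with min[OF gq] have dq: "degree ?q = degree p" by simp
      moreover have "coeff ?q (degree p) = 0" by simp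
      ultimately have "?q = 0" by (metis leading_coeff_0_iff)
      then show False using \<open>\<not> (\<forall>j. coeff ?q j \<in> VI C)\<close> by simp
    qed
    have "degree p \<noteq> 0"
    proof
      assume "degree p = 0"
      then have "poly p (Var k) = lead_coeff p" by (auto elim!: degree_eq_zeroE)
      with lead p show False by simp
    qed
    then obtain e where e: "degree p = Suc e" using not0_implies_Suc by blast
    \<comment> \<open>For x = \<open>Var k\<close> the extension D must satisfy 0 = q(x) + p'(x)
      D(x), where q is \<open>p\<close> with differentiated coefficients. Scaling the whole
      derivation by u = p'(x) clears the denominator and leaves the value w = - q(x).\<close>
    define u where "u = poly (pdiff p) (Var k)"
    have u: "u \<notin> VI C"
    proof
      assume "u \<in> VI C"
      moreover have "degree (pdiff p) < degree p"
        unfolding e by (rule le_imp_less_Suc) (auto intro!: degree_le simp: coeff_pdiff e coeff_eq_0)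
      ultimately have "coeff (pdiff p) e \<in> VI C"
        using small pcoeffs_pdiff[OF p(1)] by (auto simp: u_def)
      then have "of_nat (Suc e) * lead_coeff p \<in> VI C" by (simp add: coeff_pdiff e)
      then show False using lead VI_of_nat by blast
    qed
    define w where "w = - poly (map_poly (vfield \<alpha>) p) (Var k)"
    define \<alpha>' where "\<alpha>' = (\<lambda>i. if i = k then w else u * \<alpha> i)"
    have Dp0: "vfield \<alpha>' (poly p (Var k)) = 0"
      unfolding \<alpha>'_def vp[OF p(1)] by (simp add: u_def w_def)
    show ?thesis
    proof (intro exI conjI ballI impI)
      show "u \<notin> VI C" by (fact u)
      show "\<alpha>' i = u * \<alpha> i" if "i \<in> A" for i using that k by (auto simp: \<alpha>'_def)
      fix F assume F: "F \<in> VI C" "F \<in> pring (insert k A)"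
      then obtain g where g: "g \<in> pcoeffs A" "F = poly g (Var k)" using pring_insert by blast
      obtain m q r where qr: "q \<in> pcoeffs A" "r \<in> pcoeffs A" "degree r \<le> e"
        "smult (lead_coeff p ^ m) g = p * q + r" using pseudo_division[OF p(1) e g(1)] by blast
      let ?L = "lead_coeff p ^ m"
      have eq: "?L * F = poly p (Var k) * poly q (Var k) + poly r (Var k)"
        using arg_cong[OF qr(4), of "\<lambda>p. poly p (Var k)"] by (simp add: g(2))
      have "poly r (Var k) = ?L * F - poly p (Var k) * poly q (Var k)" using eq by simp
      then have rV: "poly r (Var k) \<in> VI C" using F p by (simp add: VI_diff VI_mult)
      then have rc: "coeff r j \<in> VI C" for j using small[OF qr(2)] qr(3) e by simp
      have "vfield \<alpha>' (poly r (Var k)) \<in> VI C"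
        unfolding \<alpha>'_def vp[OF qr(2)] using rc
        by (intro VI_add VI_mult Dp qr poly_VI) (auto simp: coeff_pdiff intro: VI_mult)
      moreover have "vfield \<alpha>' (poly p (Var k) * poly q (Var k)) \<in> VI C"
        unfolding vfield_mult Dp0 using p by (simp add: VI_mult)
      ultimately have "vfield \<alpha>' (?L * F) \<in> VI C" unfolding eq vfield_add by (rule VI_add[rotated])
      \<comment> \<open>The Leibniz term containing \<open>vfield \<alpha>' ?L\<close> lies in the
        ideal because \<open>F\<close> does; primality then cancels \<open>?L\<close>.\<close>
      then have "?L * vfield \<alpha>' F + vfield \<alpha>' ?L * F - vfield \<alpha>' ?L * F \<in> VI C"
        unfolding vfield_mult using F by (intro VI_diff) (auto simp: VI_mult add.commute)
      then have "?L * vfield \<alpha>' F \<in> VI C" by simp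
      then show "vfield \<alpha>' F \<in> VI C" using irr_mult[OF C irr_power[OF C lead]] by blast
    qed
  qed
qed

text \<open>On \<open>pring Y\<close> the ideal is zero, so the partial derivative in direction
  \<open>i\<close> preserves it trivially. The other variables are adjoined one by one, and the
  scalings that clear denominators multiply up to \<open>u\<close>.\<close>

lemma extend_derivation:
  fixes C :: "('v::finite \<Rightarrow> complex) set"
  assumes C: "irr C" and indep: "\<And>F. F \<in> VI C \<Longrightarrow> F \<in> pring Y \<Longrightarrow> F = 0"
  shows "\<exists>\<alpha> u. u \<notin> VI C \<and> (\<forall>l\<in>Y. \<alpha> l = (if l = i then u else 0)) \<and> (\<forall>F\<in>VI C. vfield \<alpha> F \<in> VI C)"
proof -
  have "\<exists>\<alpha> u. u \<notin> VI C \<and> (\<forall>l\<in>Y. \<alpha> l = (if l = i then u else 0)) \<and>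
      (\<forall>F\<in>VI C. F \<in> pring (Y \<union> B) \<longrightarrow> vfield \<alpha> F \<in> VI C)" if "finite B" for B
    using that
  proof (induction B)
    case empty
    have "1 \<notin> VI C" using C by (auto simp: irr_def VI_def)
    moreover have "vfield \<alpha> F \<in> VI C" if "F \<in> VI C" "F \<in> pring Y" for \<alpha> F
      using indep[OF that] by simp
    ultimately show ?case
      by (intro exI[of _ "\<lambda>l. if l = i then 1 else 0"] exI[of _ 1]) auto
  next
    case (insert k B)
    then obtain \<alpha> u where IH: "u \<notin> VI C" "\<forall>l\<in>Y. \<alpha> l = (if l = i then u else 0)"
        "\<forall>F\<in>VI C. F \<in> pring (Y \<union> B) \<longrightarrow> vfield \<alpha> F \<in> VI C" by blast
    show ?case
    proof (cases "k \<in> Y \<union> B")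
      case True
      then have "Y \<union> insert k B = Y \<union> B" by auto
      then show ?thesis using IH by (metis (no_types, lifting))
    next
      case False
      obtain \<alpha>' u' where 1: "u' \<notin> VI C" "\<forall>i\<in>Y \<union> B. \<alpha>' i = u' * \<alpha> i"
        "\<forall>F\<in>VI C. F \<in> pring (insert k (Y \<union> B)) \<longrightarrow> vfield \<alpha>' F \<in> VI C"
        using extend_derivation_step[OF C False, of \<alpha>] IH by blast
      show ?thesis
        by (rule exI[of _ \<alpha>'], rule exI[of _ "u' * u"])
          (use 1 IH in \<open>auto simp: irr_mult[OF C]\<close>)
    qed
  qed
  from this[OF finite, of UNIV] show ?thesis by (simp only: Un_UNIV_right pring_UNIV simp_thms)
qed

text \<open>The projection to the algebraically independent variables \<open>Y\<close> is dominant,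
  and in characteristic 0 its differential is onto at generic points. Here \<open>e\<close> is the
  product of the denominators of the lifted coordinate derivations.\<close>

lemma generic_submersion:
  fixes C :: "('v::finite \<Rightarrow> complex) set"
  assumes C: "irr C" and indep: "\<And>F. F \<in> VI C \<Longrightarrow> F \<in> pring Y \<Longrightarrow> F = 0"
  shows "\<exists>e. e \<notin> VI C \<and> (\<forall>a\<in>C. mp_eval e a \<noteq> 0 \<longrightarrow> (\<forall>\<beta>. \<exists>\<alpha>. (\<forall>l\<in>Y. \<alpha> l = \<beta> l) \<and>
     (\<forall>F\<in>VI C. (\<Sum>l\<in>UNIV. \<alpha> l * mp_eval (mp_partial l F) a) = 0)))"
proof -
  have "\<forall>i. \<exists>\<alpha> u. u \<notin> VI C \<and> (\<forall>l\<in>Y. \<alpha> l = (if l = i then u else 0)) \<and> (\<forall>F\<in>VI C. vfield \<alpha> F \<in> VI C)"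
    using extend_derivation[OF C indep] by blast
  then obtain \<alpha> u where au: "\<And>i. u i \<notin> VI C" "\<And>i l. l \<in> Y \<Longrightarrow> \<alpha> i l = (if l = i then u i else 0)"
    "\<And>i F. F \<in> VI C \<Longrightarrow> vfield (\<alpha> i) F \<in> VI C" by metis
  show ?thesis
  proof (intro exI conjI ballI impI allI)
    show "prod u UNIV \<notin> VI C" by (rule irr_prod[OF C au(1)])
    fix a \<beta> assume a: "a \<in> C" "mp_eval (prod u UNIV) a \<noteq> 0"
    then have nz: "mp_eval (u i) a \<noteq> 0" for i by (simp add: mp_eval_prod)
    \<comment> \<open>The \<open>Y\<close>-part of the \<open>i\<close>-th lifted field is
      \<open>u i\<close> times a unit vector, which explains the division.\<close>
    let ?\<alpha> = "\<lambda>l. \<Sum>i\<in>Y. \<beta> i / mp_eval (u i) a * mp_eval (\<alpha> i l) a"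
    show "?\<alpha> l = \<beta> l" if "l \<in> Y" for l
    proof -
      have "?\<alpha> l = (\<Sum>i\<in>Y. if i = l then \<beta> l else 0)"
        by (rule sum.cong) (use that nz in \<open>auto simp: au(2)\<close>)
      then show ?thesis using that by simp
    qed
    fix F assume F: "F \<in> VI C"
    have "(\<Sum>l\<in>UNIV. ?\<alpha> l * mp_eval (mp_partial l F) a) =
        (\<Sum>i\<in>Y. \<beta> i / mp_eval (u i) a * mp_eval (vfield (\<alpha> i) F) a)"
      unfolding vfield_def mp_eval_sum sum_distrib_left sum_distrib_right
      by (subst sum.swap) (simp add: mult.assoc)
    also have "\<dots> = 0" using au(3)[OF F] a by (simp add: VI_def)
    finally show "(\<Sum>l\<in>UNIV. ?\<alpha> l * mp_eval (mp_partial l F) a) = 0" .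
  qed
qed

lemma mpoly_eq_0_if_eval_0:
  assumes "\<And>a. mp_eval F a = 0"
  shows "F = 0"
proof -
  have "\<forall>F\<in>pring A. (\<forall>a. mp_eval F a = 0) \<longrightarrow> F = 0" if "finite A" for A
    using that
  proof (induction A)
    case empty
    then show ?case using pring_empty by fastforce
  next
    case (insert k A)
    show ?case
    proof (intro ballI impI)
      fix F assume F: "F \<in> pring (insert k A)" "\<forall>a. mp_eval F a = 0"
      then obtain p where p: "p \<in> pcoeffs A" "F = poly p (Var k)" using pring_insert by blast
      have ev: "mp_eval G (a(k := t)) = mp_eval G a" if "G \<in> pring A" for G a t
        using that insert.hyps by (induction rule: pring.induct) auto
      have evp: "mp_eval (poly q (Var k)) a = poly (map_poly (\<lambda>c. mp_eval c a) q) (a k)" for q a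
        by (induction q) (simp_all add: map_poly_pCons)
      have "mp_eval (coeff p j) a = 0" for j a
      proof -
        have "poly (map_poly (\<lambda>c. mp_eval c a) p) t = 0" for t
        proof -
          have "map_poly (\<lambda>c. mp_eval c a) p = map_poly (\<lambda>c. mp_eval c (a(k := t))) p"
            by (rule poly_eqI) (use p in \<open>simp add: coeff_map_poly ev pcoeffs_def\<close>)
          then show ?thesis using evp[of p "a(k := t)"] F(2) p(2) by simp
        qed
        then have "map_poly (\<lambda>c. mp_eval c a) p = 0" using poly_all_0_iff_0 by blast
        then have "coeff (map_poly (\<lambda>c. mp_eval c a) p) j = 0" by simp
        then show ?thesis by (simp add: coeff_map_poly)
      qed
      then have "coeff p j = 0" for j using insert.IH p(1) by (auto simp: pcoeffs_def)
      then have "p = 0" by (simp add: poly_eqI)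
      then show "F = 0" by (simp add: p(2))
    qed
  qed
  from bspec[OF this[OF finite] pring_UNIV, of F] show ?thesis using assms by blast
qed

section \<open>Determinants and cofactors\<close>

text \<open>Matrices are functions here, so that a row is replaced by function update and entries
  are mapped along homomorphisms between polynomials, power series and numbers.\<close>

definition mdet :: "('n::finite \<Rightarrow> 'n \<Rightarrow> 'a::comm_ring_1) \<Rightarrow> 'a" where
  "mdet M = det (\<chi> i j. M i j)"

text \<open>As row \<open>l\<close> is overwritten, the vector \<open>cof M l\<close> is the
  generalised cross product of the other rows: it is annihilated by each of them.\<close>

definition cof :: "('n::finite \<Rightarrow> 'n \<Rightarrow> 'a::comm_ring_1) \<Rightarrow> 'n \<Rightarrow> 'n \<Rightarrow> 'a" where
  "cof M l k = mdet (M(l := (\<lambda>j. if j = k then 1 else 0)))"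

lemma rhom_mdet: "rhom h \<Longrightarrow> h (mdet M) = mdet (\<lambda>i j. h (M i j))"
  by (simp add: mdet_def det_def rhom_sum rhom_mult rhom_prod rhom_of_int)

lemma rhom_cof: "rhom h \<Longrightarrow> h (cof M l k) = cof (\<lambda>i j. h (M i j)) l k"
  unfolding cof_def
  by (subst rhom_mdet, assumption, rule arg_cong[of _ _ mdet])
    (auto simp: fun_eq_iff rhom_0 rhom_1)

lemma whomog_mdet:
  assumes "\<And>i j. whomog wt (\<delta> i) (M i j)"
  shows "whomog wt (sum \<delta> UNIV) (mdet M)"
proof -
  have "whomog wt 0 (of_int k)" for k
    using whomog_Const[of wt "of_int k"] by (simp add: rhom_of_int[OF rhom_Const])
  then have "whomog wt (0 + sum \<delta> UNIV) (of_int (sign p) * (\<Prod>i\<in>UNIV. M i (p i)))" for p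
    by (intro whomog_mult whomog_prod assms)
  then show ?thesis by (simp add: mdet_def det_def whomog_sum)
qed

lemma whomog_cof:
  assumes "\<And>i j. i \<noteq> l \<Longrightarrow> whomog wt (\<delta> i) (M i j)" "\<delta> l = 0"
  shows "whomog wt (sum \<delta> UNIV) (cof M l k)"
  unfolding cof_def by (rule whomog_mdet) (use assms in \<open>auto simp: whomog_1\<close>)

lemma sum_cof: "(\<Sum>k\<in>UNIV. q k * cof M l k) = mdet (M(l := q))"
proof -
  let ?e = "\<lambda>k. \<chi> j. if j = k then 1 else 0"
  have q: "(\<chi> j. q j) = (\<Sum>k\<in>UNIV. q k *s ?e k)"
    by (simp add: vec_eq_iff if_distrib cong: if_cong)
  have M: "(\<chi> i j. (M(l := p)) i j) = (\<chi> i. if i = l then (\<chi> j. p j) else (\<chi> j. M i j))" for p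
    by (simp add: vec_eq_iff)
  have "mdet (M(l := q)) = det (\<chi> i. if i = l then (\<Sum>k\<in>UNIV. q k *s ?e k) else (\<chi> j. M i j))"
    unfolding mdet_def M q ..
  also have "\<dots> = (\<Sum>k\<in>UNIV. q k * cof M l k)"
    unfolding cof_def mdet_def M by (subst det_linear_row_sum) (simp_all add: det_row_mul)
  finally show ?thesis by simp
qed

lemma mdet_identical_rows: "i \<noteq> l \<Longrightarrow> mdet (M(l := M i)) = 0"
  unfolding mdet_def by (rule det_identical_rows[of i l]) (auto simp: row_def)

lemma row_cof: "(\<Sum>k\<in>UNIV. M i k * cof M l k) = (if i = l then mdet M else 0)"
  by (simp add: sum_cof mdet_identical_rows)

lemma mdet_solve:
  fixes M :: "'n::finite \<Rightarrow> 'n \<Rightarrow> 'a::field"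
  assumes "mdet M \<noteq> 0"
  shows "\<exists>z. \<forall>i. (\<Sum>j\<in>UNIV. M i j * z j) = c i"
proof (intro exI allI)
  fix i
  have "(\<Sum>j\<in>UNIV. M i j * (\<Sum>l\<in>UNIV. c l / mdet M * cof M l j)) =
      (\<Sum>l\<in>UNIV. c l / mdet M * (\<Sum>j\<in>UNIV. M i j * cof M l j))"
    unfolding sum_distrib_left by (subst sum.swap) (simp add: mult_ac)
  then show "(\<Sum>j\<in>UNIV. M i j * (\<Sum>l\<in>UNIV. c l / mdet M * cof M l j)) = c i"
    using assms by (simp add: row_cof if_distrib cong: if_cong)
qed

lemma mdet_nonzero_iff_kernel:
  fixes M :: "'n::finite \<Rightarrow> 'n \<Rightarrow> 'a::field"
  shows "mdet M \<noteq> 0 \<longleftrightarrow> (\<forall>z. (\<forall>i. (\<Sum>j\<in>UNIV. M i j * z j) = 0) \<longrightarrow> z = (\<lambda>_. 0))"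
proof -
  let ?A = "\<chi> i j. M i j"
  have v: "(?A *v (\<chi> j. z j) = 0) \<longleftrightarrow> (\<forall>i. (\<Sum>j\<in>UNIV. M i j * z j) = 0)" for z
    by (simp add: matrix_vector_mult_def vec_eq_iff)
  have "mdet M \<noteq> 0 \<longleftrightarrow> (\<forall>x. ?A *v x = 0 \<longrightarrow> x = 0)"
    unfolding mdet_def invertible_det_nz[symmetric] invertible_left_inverse matrix_left_invertible_ker ..
  also have "\<dots> \<longleftrightarrow> (\<forall>z. ?A *v (\<chi> j. z j) = 0 \<longrightarrow> (\<chi> j. z j) = (0 :: 'a^'n))"
    by (metis vec_nth_inverse)
  finally show ?thesis unfolding v by (simp add: vec_eq_iff fun_eq_iff)
qed

lemma mdet_nonzero_if_surj:
  fixes M :: "'n::finite \<Rightarrow> 'n \<Rightarrow> 'a::field"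
  assumes "\<And>c. \<exists>z. \<forall>i. (\<Sum>j\<in>UNIV. M i j * z j) = c i"
  shows "mdet M \<noteq> 0"
proof -
  let ?A = "\<chi> i j. M i j"
  have "surj ((*v) ?A)"
    unfolding surj_def
  proof
    fix y :: "'a^'n"
    obtain z where "\<forall>i. (\<Sum>j\<in>UNIV. M i j * z j) = y $ i" using assms[of "($) y"] by blast
    then have "y = ?A *v (\<chi> j. z j)"
      by (simp add: matrix_vector_mult_def vec_eq_iff)
    then show "\<exists>x. y = ?A *v x" by blast
  qed
  then show ?thesis
    unfolding mdet_def invertible_det_nz[symmetric] invertible_right_inverse matrix_right_invertible_surjective .
qed

text \<open>Cramer's rule recovers \<open>w\<close> from its products with all rows; those with the
  rows in \<open>R\<close> are 0, so only cofactor vectors of the remaining rows occur.\<close>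

lemma kernel_representation:
  fixes M :: "'n::finite \<Rightarrow> 'n \<Rightarrow> 'a::field"
  assumes "mdet M \<noteq> 0" and "\<And>i. i \<in> R \<Longrightarrow> (\<Sum>j\<in>UNIV. M i j * w j) = 0"
  shows "w k = (\<Sum>j\<in>-R. (\<Sum>l\<in>UNIV. M j l * w l) / mdet M * cof M j k)"
proof -
  let ?z = "\<lambda>k. w k - (\<Sum>j\<in>-R. (\<Sum>l\<in>UNIV. M j l * w l) / mdet M * cof M j k)"
  have "(\<Sum>k\<in>UNIV. M i k * ?z k) = 0" for i
  proof -
    have "(\<Sum>k\<in>UNIV. M i k * ?z k) = (\<Sum>k\<in>UNIV. M i k * w k) -
        (\<Sum>j\<in>-R. (\<Sum>l\<in>UNIV. M j l * w l) / mdet M * (\<Sum>k\<in>UNIV. M i k * cof M j k))"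
      unfolding right_diff_distrib sum_subtractf sum_distrib_left
      by (subst (2) sum.swap) (simp add: mult_ac)
    also have "\<dots> = 0"
      unfolding row_cof using assms by (simp add: if_distrib cong: if_cong)
    finally show ?thesis .
  qed
  then have "?z = (\<lambda>_. 0)"
    by (intro mdet_nonzero_iff_kernel[THEN iffD1, OF assms(1), rule_format])
  from fun_cong[OF this, of k] show ?thesis by (simp only: right_minus_eq)
qed

lemma dual_independent:
  fixes t :: "'k \<Rightarrow> 'a::field ^ 'n"
  assumes Y: "finite Y" and d: "\<And>l. l \<in> Y \<Longrightarrow> d l \<noteq> 0"
    and dual: "\<And>l y. l \<in> Y \<Longrightarrow> y \<in> Y \<Longrightarrow> (\<Sum>k\<in>UNIV. c l k * t y $ k) = (if y = l then d l else 0)"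
  shows "inj_on t Y" "vec.independent (t ` Y)"
proof -
  show inj: "inj_on t Y"
    by (rule inj_onI) (metis d dual)
  show "vec.independent (t ` Y)"
  proof
    assume "vec.dependent (t ` Y)"
    then obtain u y where y: "y \<in> Y" "u (t y) \<noteq> 0" and 0: "(\<Sum>v\<in>t ` Y. u v *s v) = 0"
      using vec.dependent_finite[of "t ` Y"] Y by auto
    have "(\<Sum>x\<in>Y. u (t x) *s t x) = 0" using 0 inj by (simp add: sum.reindex)
    then have "(\<Sum>k\<in>UNIV. c y k * (\<Sum>x\<in>Y. u (t x) * t x $ k)) = 0"
      by (simp add: vec_eq_iff)
    moreover have "(\<Sum>k\<in>UNIV. c y k * (\<Sum>x\<in>Y. u (t x) * t x $ k)) =
        (\<Sum>x\<in>Y. u (t x) * (\<Sum>k\<in>UNIV. c y k * t x $ k))"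
      unfolding sum_distrib_left by (subst sum.swap) (simp add: mult_ac)
    moreover have "\<dots> = (\<Sum>x\<in>Y. if x = y then u (t y) * d y else 0)"
      by (rule sum.cong) (use y in \<open>auto simp: dual\<close>)
    ultimately show False using y Y d by simp
  qed
qed

lemma dim_kernel:
  fixes M :: "'n::finite \<Rightarrow> 'n \<Rightarrow> 'a::field"
  assumes M: "mdet M \<noteq> 0"
  shows "vec.dim {w :: 'a^'n. \<forall>i\<in>R. (\<Sum>j\<in>UNIV. M i j * w $ j) = 0} = card (- R)"
proof (rule vec.dim_unique)
  let ?a = "\<lambda>j. \<chi> k. cof M j k"
  have ind: "inj_on ?a (- R)" "vec.independent (?a ` (- R))"
    by (rule dual_independent[of "- R" "\<lambda>_. mdet M" M]; use M in \<open>auto simp: row_cof\<close>)+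
  show "?a ` (- R) \<subseteq> {w. \<forall>i\<in>R. (\<Sum>j\<in>UNIV. M i j * w $ j) = 0}"
    by (auto simp: row_cof)
  show "vec.independent (?a ` (- R))" by (fact ind)
  show "card (?a ` (- R)) = card (- R)" using ind by (simp add: card_image)
  show "{w. \<forall>i\<in>R. (\<Sum>j\<in>UNIV. M i j * w $ j) = 0} \<subseteq> vec.span (?a ` (- R))"
  proof
    fix w :: "'a^'n" assume "w \<in> {w. \<forall>i\<in>R. (\<Sum>j\<in>UNIV. M i j * w $ j) = 0}"
    then have "w $ k = (\<Sum>j\<in>-R. (\<Sum>l\<in>UNIV. M j l * w $ l) / mdet M * cof M j k)" for k
      by (intro kernel_representation[OF M]) auto
    then have "w = (\<Sum>j\<in>-R. ((\<Sum>l\<in>UNIV. M j l * w $ l) / mdet M) *s ?a j)"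
      unfolding vec_eq_iff sum_component vector_smult_component vec_lambda_beta by blast
    moreover have "(\<Sum>j\<in>-R. ((\<Sum>l\<in>UNIV. M j l * w $ l) / mdet M) *s ?a j) \<in> vec.span (?a ` (- R))"
      by (intro vec.span_sum vec.span_scale vec.span_base) auto
    ultimately show "w \<in> vec.span (?a ` (- R))" by simp
  qed
qed

text \<open>A maximal independent subset of \<open>Gr\<close> is completed to a basis of the whole
  space, whose vectors become the rows; \<open>R\<close> marks those taken from \<open>Gr\<close>.
  The dimension of the common kernel is then the number of added rows.\<close>

lemma frame_exists:
  fixes Gr :: "('n::finite \<Rightarrow> complex) set"
  obtains M :: "'n \<Rightarrow> 'n \<Rightarrow> complex" and R :: "'n set" where "mdet M \<noteq> 0" "\<And>i. i \<in> R \<Longrightarrow> M i \<in> Gr"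
    "vec.dim {w :: complex^'n. \<forall>g\<in>Gr. (\<Sum>j\<in>UNIV. g j * w $ j) = 0} = card (- R)"
proof -
  let ?G = "vec_lambda ` Gr"
  obtain B where B: "B \<subseteq> ?G" "vec.independent B" "?G \<subseteq> vec.span B"
    using vec.maximal_independent_subset[of ?G] by metis
  obtain B' where B': "B \<subseteq> B'" "vec.independent B'" "UNIV \<subseteq> vec.span B'"
    using vec.maximal_independent_subset_extend[of B UNIV] B(2) by auto
  have "card B' = vec.dim (UNIV :: (complex^'n) set)"
    using vec.basis_card_eq_dim[of B' UNIV] B' by auto
  then have card: "card B' = CARD('n)"
    by (simp add: vec.dim_UNIV card_cart_basis)
  then have "finite B'" using card_gt_0_iff[of B'] by simp
  then obtain \<beta> :: "'n \<Rightarrow> complex^'n" where \<beta>: "bij_betw \<beta> UNIV B'"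
    using finite_same_card_bij[of "UNIV :: 'n set" B'] card by auto
  define M where "M = (\<lambda>i j. \<beta> i $ j)"
  define R where "R = {i. \<beta> i \<in> B}"
  have "rows (\<chi> i j. M i j) = B'"
    using \<beta> by (auto simp: rows_def row_def M_def bij_betw_def vec_lambda_eta)
  then have M: "mdet M \<noteq> 0"
    using B'(3) unfolding mdet_def invertible_det_nz[symmetric] invertible_left_inverse
      matrix_left_invertible_span_rows_gen by auto
  have "M i \<in> Gr" if "i \<in> R" for i
  proof -
    have "\<beta> i \<in> vec_lambda ` Gr" using that B(1) by (auto simp: R_def)
    then obtain g where "g \<in> Gr" "\<beta> i = vec_lambda g" by auto
    then show ?thesis by (simp add: M_def vec_lambda_inverse)
  qed
  have Gr: "(\<Sum>j\<in>UNIV. g j * w j) = 0"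
    if w: "\<And>i. i \<in> R \<Longrightarrow> (\<Sum>j\<in>UNIV. M i j * w j) = 0" and g: "g \<in> Gr" for g w
  proof -
    have "vec_lambda g \<in> vec.span B" using g B by auto
    moreover have "vec.subspace {v :: complex^'n. (\<Sum>j\<in>UNIV. v $ j * w j) = 0}"
      by (auto simp: vec.subspace_def sum.distrib distrib_right mult.assoc simp flip: sum_distrib_left)
    moreover have "(\<Sum>j\<in>UNIV. b $ j * w j) = 0" if "b \<in> B" for b
    proof -
      have "b \<in> range \<beta>" using that B' \<beta> by (auto simp: bij_betw_def)
      then obtain i where "b = \<beta> i" by blast
      then show ?thesis using w[of i] that by (auto simp: R_def M_def)
    qed
    ultimately have "vec_lambda g \<in> {v. (\<Sum>j\<in>UNIV. v $ j * w j) = 0}"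
      using vec.span_minimal[of B "{v. (\<Sum>j\<in>UNIV. v $ j * w j) = 0}"] by blast
    then show ?thesis by simp
  qed
  have "{w :: complex^'n. \<forall>g\<in>Gr. (\<Sum>j\<in>UNIV. g j * w $ j) = 0} =
      {w. \<forall>i\<in>R. (\<Sum>j\<in>UNIV. M i j * w $ j) = 0}"
    using Gr \<open>\<And>i. i \<in> R \<Longrightarrow> M i \<in> Gr\<close> by blast
  then have "vec.dim {w :: complex^'n. \<forall>g\<in>Gr. (\<Sum>j\<in>UNIV. g j * w $ j) = 0} = card (- R)"
    by (simp add: dim_kernel[OF M])
  then show ?thesis using that M \<open>\<And>i. i \<in> R \<Longrightarrow> M i \<in> Gr\<close> by blast
qed

lemma mp_eval_diff [simp]: "mp_eval (F - G) a = mp_eval F a - mp_eval G a"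
  using rhom_add[OF rhom_mp_eval, of "F - G" G a] by simp

lemma mp_eval_minus [simp]: "mp_eval (- F) a = - mp_eval F a"
  by (rule rhom_minus[OF rhom_mp_eval])

lemma mp_partial_diff: "mp_partial i (F - G) = mp_partial i F - mp_partial i G"
  using mp_partial_add[of i "F - G" G] by simp

section \<open>Projective sets and their cones\<close>

lemma proj_line: "vec.subspace (Rep_proj p)" "vec.dim (Rep_proj p) = 1"
  using Rep_proj[of p] by auto

lemma span_hcoords: "v \<in> hcoords p \<Longrightarrow> vec.span {v} = Rep_proj p"
proof -
  assume v: "v \<in> hcoords p"
  then have "vec.independent {v}" by (simp add: hcoords_def vec.independent_insert)
  then have "vec.dim (vec.span {v}) = 1" by (simp add: vec.dim_eq_card_independent)
  moreover have "vec.span {v} \<subseteq> Rep_proj p"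
    using v by (intro vec.span_minimal proj_line) (auto simp: hcoords_def)
  ultimately show ?thesis
    by (intro vec.subspace_dim_equal) (auto simp: proj_line)
qed

lemma hcoords_nonempty: "\<exists>v. v \<in> hcoords p"
proof (rule ccontr)
  assume "\<not> ?thesis"
  then have "Rep_proj p \<subseteq> {0}" by (auto simp: hcoords_def)
  then have "vec.dim (Rep_proj p) = 0" by simp
  then show False by (simp add: proj_line)
qed

lemma hcoords_multiple:
  assumes "v \<in> hcoords p" "w \<in> hcoords p" obtains t where "t \<noteq> 0" "w = t *s v"
proof -
  have "w \<in> vec.span {v}" using assms span_hcoords[OF assms(1)] by (simp add: hcoords_def)
  then obtain t where "w = t *s v" by (auto simp: vec.span_singleton)
  moreover then have "t \<noteq> 0" using assms by (auto simp: hcoords_def)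
  ultimately show ?thesis using that by blast
qed

lemma hcoords_scale: "v \<in> hcoords p \<Longrightarrow> t \<noteq> 0 \<Longrightarrow> t *s v \<in> hcoords p"
  by (auto simp: hcoords_def vec.subspace_scale[OF proj_line(1)])

lemma hcoords_nonzero: "v \<in> hcoords p \<Longrightarrow> v \<noteq> 0"
  by (simp add: hcoords_def)

lemma obtain_proj:
  fixes v :: "complex ^ 'm::finite"
  assumes "v \<noteq> 0" obtains p where "v \<in> hcoords p" "Rep_proj p = vec.span {v}"
proof
  have "vec.independent {v}" using assms by (simp add: vec.independent_insert)
  then have "vec.dim (vec.span {v}) = 1" by (simp add: vec.dim_eq_card_independent)
  then show 1: "Rep_proj (Abs_proj (vec.span {v})) = vec.span {v}"
    by (subst Abs_proj_inverse) auto
  show "v \<in> hcoords (Abs_proj (vec.span {v}))"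
    using assms by (simp add: hcoords_def 1 vec.span_base)
qed

lemma scale_nth: "($) (t *s v) = (\<lambda>i. t * v $ i)"
  by auto

lemma vanishes_iff:
  assumes "homogeneous d F" "v \<in> hcoords p"
  shows "vanishes F p \<longleftrightarrow> mp_eval F (($) v) = 0"
proof
  assume 0: "mp_eval F (($) v) = 0"
  show "vanishes F p"
    unfolding vanishes_def
  proof
    fix w assume "w \<in> hcoords p"
    then obtain t where "w = t *s v" using assms(2) hcoords_multiple by blast
    then show "mp_eval F (($) w) = 0"
      using 0 by (simp add: scale_nth homogeneous_mp_eval[OF assms(1)])
  qed
qed (use assms in \<open>simp add: vanishes_def\<close>)

lemma vanishes2_iff:
  assumes F: "bihomogeneous d e F" and v: "v \<in> hcoords p" "w \<in> hcoords q"
  shows "vanishes2 F (p, q) \<longleftrightarrow> mp_eval F (case_sum (($) v) (($) w)) = 0"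
proof
  assume 0: "mp_eval F (case_sum (($) v) (($) w)) = 0"
  show "vanishes2 F (p, q)"
    unfolding vanishes2_def fst_conv snd_conv
  proof (intro ballI)
    fix v' w' assume "v' \<in> hcoords p" "w' \<in> hcoords q"
    then obtain s t where st: "v' = s *s v" "w' = t *s w" using v hcoords_multiple by metis
    have 1: "case_sum (($) v') (($) w') = (\<lambda>i. s ^ (case_sum (\<lambda>_. 1) (\<lambda>_. 0) i) *
        (t ^ (case_sum (\<lambda>_. 0) (\<lambda>_. 1) i) * case_sum (($) v) (($) w) i))"
      unfolding st by (auto simp: fun_eq_iff split: sum.splits)
    have F': "whomog (case_sum (\<lambda>_. 1) (\<lambda>_. 0)) d F" "whomog (case_sum (\<lambda>_. 0) (\<lambda>_. 1)) e F"
      using F by (simp_all add: bihomogeneous_whomog)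
    show "mp_eval F (case_sum (($) v') (($) w')) = 0"
      using 0 unfolding 1 mp_eval_meval whomog_eval[OF F'(1)] whomog_eval[OF F'(2)] by simp
  qed
qed (use v in \<open>simp add: vanishes2_def\<close>)

section \<open>The Zariski topology in terms of single forms, and affine cones\<close>

lemma topspace_zariski [simp]: "topspace (zariski :: 'm::finite proj topology) = UNIV"
proof -
  have "\<not> vanishes 1 p" for p :: "'m proj"
    using hcoords_nonempty[of p] by (auto simp: vanishes_def)
  moreover have "homogeneous 0 (1 :: 'm mpoly)" by (simp add: homogeneous_whomog whomog_1)
  ultimately have "UNIV \<in> {{p :: 'm proj. \<not> vanishes F p} | F d. homogeneous d F}" by auto
  then show ?thesis unfolding zariski_def topology_generated_by_topspace by blast
qed

lemma openin_zariski_basis: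
  fixes O' :: "'m::finite proj set"
  assumes "openin zariski O'" "p \<in> O'"
  shows "\<exists>F d. homogeneous d F \<and> \<not> vanishes F p \<and> (\<forall>q. \<not> vanishes F q \<longrightarrow> q \<in> O')"
proof -
  have "generate_topology_on {{p :: 'm proj. \<not> vanishes F p} | F d. homogeneous d F} O'"
    using assms(1) unfolding zariski_def openin_topology_generated_by_iff .
  then show ?thesis using assms(2)
  proof (induction)
    case (Int a b)
    then obtain F d G e where F: "homogeneous d F" "\<not> vanishes F p" "\<forall>q. \<not> vanishes F q \<longrightarrow> q \<in> a"
      and G: "homogeneous e G" "\<not> vanishes G p" "\<forall>q. \<not> vanishes G q \<longrightarrow> q \<in> b" by blast
    have FG: "homogeneous (d + e) (F * G)"
      using F G by (simp add: homogeneous_whomog whomog_mult)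
    have iff: "vanishes (F * G) q \<longleftrightarrow> vanishes F q \<or> vanishes G q" for q
    proof -
      obtain v where "v \<in> hcoords q" using hcoords_nonempty by blast
      then show ?thesis using F G FG by (simp add: vanishes_iff)
    qed
    show ?case using FG F G by (intro exI[of _ "F * G"] exI[of _ "d + e"]) (auto simp: iff)
  qed blast+
qed

lemma closedin_zariski_separate:
  fixes C :: "'m::finite proj set"
  assumes "closedin zariski C" "p \<notin> C"
  shows "\<exists>F d. homogeneous d F \<and> \<not> vanishes F p \<and> (\<forall>q\<in>C. vanishes F q)"
  using openin_zariski_basis[of "- C" p] assms
  by (auto simp: closedin_def Compl_eq_Diff_UNIV)

lemma closedin_vanishes: "homogeneous d F \<Longrightarrow> closedin zariski {p. vanishes F p}"
proof -
  assume "homogeneous d F"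
  then have "openin zariski {p. \<not> vanishes F p}"
    unfolding zariski_def by (intro topology_generated_by_Basis) auto
  moreover have "{p. \<not> vanishes F p} = topspace zariski - {p. vanishes F p}" by auto
  ultimately show ?thesis by (simp add: closedin_def)
qed

text \<open>The vertex is left out, so that every element is a vector of homogeneous
  coordinates.\<close>

definition affine_cone :: "('m::finite) proj set \<Rightarrow> ('m \<Rightarrow> complex) set" where
  "affine_cone X = {a. \<exists>p\<in>X. vec_lambda a \<in> hcoords p}"

lemma cone_mem: "p \<in> X \<Longrightarrow> v \<in> hcoords p \<Longrightarrow> ($) v \<in> affine_cone X"
  by (auto simp: affine_cone_def)

lemma cone_scale: "a \<in> affine_cone X \<Longrightarrow> t \<noteq> 0 \<Longrightarrow> (\<lambda>i. t * a i) \<in> affine_cone X"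
proof -
  assume "a \<in> affine_cone X" "t \<noteq> 0"
  then obtain p where "p \<in> X" "t *s vec_lambda a \<in> hcoords p"
    by (auto simp: affine_cone_def intro: hcoords_scale)
  moreover have "t *s vec_lambda a = vec_lambda (\<lambda>i. t * a i)" by (simp add: vec_eq_iff)
  ultimately show ?thesis by (auto simp: affine_cone_def)
qed

lemma cone_nonzero: "a \<in> affine_cone X \<Longrightarrow> \<exists>i. a i \<noteq> 0"
  by (force simp: affine_cone_def vec_eq_iff dest!: hcoords_nonzero)

lemma cone_homogeneous: "homogeneous d F \<Longrightarrow> (F \<in> VI (affine_cone X)) \<longleftrightarrow> (\<forall>p\<in>X. vanishes F p)"
  unfolding VI_def vanishes_def affine_cone_def by (fastforce simp: vec_lambda_inverse)

lemma homogeneous_ideal_iff: "F \<in> homogeneous_ideal X \<longleftrightarrow> (\<exists>d. homogeneous d F) \<and> F \<in> VI (affine_cone X)"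
  using cone_homogeneous by (auto simp: homogeneous_ideal_def)

lemma poly_scaled_eval:
  fixes F :: "'v::finite mpoly"
  obtains q :: "complex poly" where "\<And>t. poly q t = mp_eval F (\<lambda>i. t * a i)"
proof
  fix t :: complex
  have k: "rhom (\<lambda>c::complex. [:c:])"
    by (rule rhomI) (auto simp: one_pCons)
  have poly_hom: "rhom (\<lambda>p. poly p t)"
    by (simp add: rhom_def)
  show "poly (meval (\<lambda>c. [:c:]) F (\<lambda>i. [:0, a i:])) t = mp_eval F (\<lambda>i. t * a i)"
    by (subst meval_comp[OF k poly_hom]) (simp add: mp_eval_meval)
qed

text \<open>The topology sees only forms, while \<open>irr\<close> concerns all polynomials.
  Irreducibility gives one point of \<open>X\<close> at which some homogeneous component of
  \<open>F\<close> and one of \<open>G\<close> are nonzero; along the line over this point both are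
  then nonzero polynomials in the scaling factor.\<close>

lemma irr_cone:
  fixes X :: "'m::finite proj set"
  assumes X: "irreducible_in zariski X"
  shows "irr (affine_cone X)"
  unfolding irr_def
proof (intro conjI allI impI)
  obtain p where "p \<in> X" using X by (auto simp: irreducible_in_def)
  then show "affine_cone X \<noteq> {}" using cone_mem hcoords_nonempty by fastforce
  fix F G :: "'m mpoly"
  assume FG: "\<exists>a\<in>affine_cone X. mp_eval F a \<noteq> 0" "\<exists>a\<in>affine_cone X. mp_eval G a \<noteq> 0"
  obtain D c D' c' where F: "\<And>d. homogeneous d (c d)" "F = (\<Sum>d<D. c d)"
    and G: "\<And>d. homogeneous d (c' d)" "G = (\<Sum>d<D'. c' d)"
    using homogeneous_decomposition by metis
  have cl: "closedin zariski (\<Inter>d\<in>UNIV. {p. d < D \<longrightarrow> vanishes (c d) p})"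
    if "\<And>d. homogeneous d (c d)" for D and c :: "nat \<Rightarrow> 'm mpoly"
  proof (rule closedin_INT)
    fix d show "closedin zariski {p. d < D \<longrightarrow> vanishes (c d) p}"
      by (cases "d < D") (use closedin_vanishes[OF that] closedin_topspace[of zariski] in auto)
  qed auto
  have nsub: "\<not> X \<subseteq> (\<Inter>d\<in>UNIV. {p. d < D \<longrightarrow> vanishes (c d) p})"
    if "\<And>d. homogeneous d (c d)" "F = (\<Sum>d<D. c d)" "\<exists>a\<in>affine_cone X. mp_eval F a \<noteq> 0" for F D c
  proof
    assume sub: "X \<subseteq> (\<Inter>d\<in>UNIV. {p. d < D \<longrightarrow> vanishes (c d) p})"
    from that(3) obtain a p where a: "mp_eval F a \<noteq> 0" "p \<in> X" "vec_lambda a \<in> hcoords p"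
      by (auto simp: affine_cone_def)
    have "mp_eval (c d) a = 0" if "d < D" for d
      using sub a that by (force simp: vanishes_def vec_lambda_inverse)
    then show False using a that(2) by (simp add: mp_eval_sum)
  qed
  obtain p where p: "p \<in> X" and "p \<notin> (\<Inter>d\<in>UNIV. {p. d < D \<longrightarrow> vanishes (c d) p})"
     and "p \<notin> (\<Inter>d\<in>UNIV. {p. d < D' \<longrightarrow> vanishes (c' d) p})"
    using X cl[OF F(1), of D] cl[OF G(1), of D'] nsub[OF F FG(1)] nsub[OF G FG(2)]
    unfolding irreducible_in_def by (meson Un_iff subsetI)
  then obtain d d' where d: "d < D" "\<not> vanishes (c d) p" "d' < D'" "\<not> vanishes (c' d') p" by auto
  obtain v where v: "v \<in> hcoords p" using hcoords_nonempty by blast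
  have nz: "q \<noteq> 0" if "\<And>d. homogeneous d (c d)" "F = (\<Sum>d<D. c d)" "d < D" "\<not> vanishes (c d) p"
    "\<And>t. poly q t = mp_eval F (\<lambda>i. t * v $ i)" for F D c d and q :: "complex poly"
  proof
    assume "q = 0"
    then have "poly (\<Sum>d<D. monom (mp_eval (c d) (($) v)) d) t = 0" for t
      using that(5)[of t] by (simp add: that(2) mp_eval_sum poly_sum poly_monom
          homogeneous_mp_eval[OF that(1)] mult.commute)
    then have "(\<Sum>d<D. monom (mp_eval (c d) (($) v)) d) = 0"
      using poly_all_0_iff_0 by blast
    then have "coeff (\<Sum>d<D. monom (mp_eval (c d) (($) v)) d) d = 0" by simp
    then show False using that(3,4) vanishes_iff[OF that(1) v]
      by (simp add: coeff_sum coeff_monom)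
  qed
  obtain qF where qF: "\<And>t. poly qF t = mp_eval F (\<lambda>i. t * v $ i)" using poly_scaled_eval by blast
  obtain qG where qG: "\<And>t. poly qG t = mp_eval G (\<lambda>i. t * v $ i)" using poly_scaled_eval by blast
  \<comment> \<open>The factor t excludes the vertex t = 0, which is not on the cone.\<close>
  have "qF * qG * [:0, 1:] \<noteq> 0"
    using nz[OF F d(1,2) qF] nz[OF G d(3,4) qG] by auto
  then obtain t where "poly (qF * qG * [:0, 1:]) t \<noteq> 0" using poly_all_0_iff_0 by blast
  then have "t \<noteq> 0" "mp_eval F (\<lambda>i. t * v $ i) \<noteq> 0" "mp_eval G (\<lambda>i. t * v $ i) \<noteq> 0"
    using qF[of t] qG[of t] by auto
  then show "\<exists>a\<in>affine_cone X. mp_eval F a \<noteq> 0 \<and> mp_eval G a \<noteq> 0"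
    using cone_scale[OF cone_mem[OF p v]] by blast
qed

text \<open>A positive finite supremum in \<open>enat\<close> is attained. The value 0 is also the
  supremum of the empty set, so for n = 0 the chain consisting of \<open>X\<close> is given
  directly.\<close>

lemma krull_chain:
  fixes X :: "'m::finite proj set"
  assumes X: "subvariety X" and dim: "variety_dim X = enat n"
  obtains Z where "\<And>i. i \<le> n \<Longrightarrow> closedin zariski (Z i) \<and> irreducible_in zariski (Z i)"
    "\<And>i. i < n \<Longrightarrow> Z i \<subset> Z (Suc i)" "Z n \<subseteq> X"
proof (cases n)
  case 0
  then show ?thesis using that[of "\<lambda>_. X"] X by (simp add: subvariety_def)
next
  case (Suc n')
  let ?T = "subtopology zariski X"
  define S where "S = {enat k | k. \<exists>Z. (\<forall>i\<le>k. closedin ?T (Z i) \<and> irreducible_in ?T (Z i)) \<and>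
    (\<forall>i<k. Z i \<subset> Z (Suc i))}"
  have sup: "Sup S = enat n" using dim by (simp add: variety_dim_def krull_dim_def S_def)
  have "enat n \<in> S"
  proof (rule ccontr)
    assume n: "enat n \<notin> S"
    have "s \<le> enat n'" if "s \<in> S" for s
    proof -
      have "s \<le> enat n" "s \<noteq> enat n" using Sup_upper[OF that] sup that n by auto
      then show ?thesis using Suc by (cases s) auto
    qed
    then have "Sup S \<le> enat n'" by (rule Sup_least)
    then show False using sup Suc by simp
  qed
  then obtain Z where Z: "\<forall>i\<le>n. closedin ?T (Z i) \<and> irreducible_in ?T (Z i)" "\<forall>i<n. Z i \<subset> Z (Suc i)"
    unfolding S_def by auto
  have Xc: "closedin zariski X" using X by (simp add: subvariety_def)
  have cl: "closedin ?T A \<longleftrightarrow> closedin zariski A \<and> A \<subseteq> X" for A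
    using closedin_closed_subtopology[OF Xc] by blast
  have irr: "irreducible_in zariski A" if "irreducible_in ?T A" "A \<subseteq> X" for A
    unfolding irreducible_in_def
  proof (intro conjI allI impI)
    show "A \<noteq> {}" "A \<subseteq> topspace zariski" using that by (auto simp: irreducible_in_def)
    fix B C assume BC: "closedin zariski B \<and> closedin zariski C \<and> A \<subseteq> B \<union> C"
    then have "closedin ?T (B \<inter> X)" "closedin ?T (C \<inter> X)" "A \<subseteq> (B \<inter> X) \<union> (C \<inter> X)"
      using that Xc by (auto simp: cl)
    then have "A \<subseteq> B \<inter> X \<or> A \<subseteq> C \<inter> X" using that(1) unfolding irreducible_in_def by blast
    then show "A \<subseteq> B \<or> A \<subseteq> C" by auto
  qed
  show ?thesis
    by (rule that[of Z]) (use Z cl irr in auto)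
qed

section \<open>Algebraic independence and tangent vectors\<close>

lemma pring_eval_cong: "F \<in> pring A \<Longrightarrow> rhom \<kappa> \<Longrightarrow> (\<And>i. i \<in> A \<Longrightarrow> a i = b i) \<Longrightarrow> meval \<kappa> F a = meval \<kappa> F b"
  by (induction rule: pring.induct) (auto simp: meval_add meval_mult)

text \<open>Each strict inclusion of primes contributes an element that is algebraically independent of the
  previous ones: the constant term of a relation lies in the larger prime.\<close>

lemma independent_elements:
  fixes C :: "nat \<Rightarrow> ('v::finite \<Rightarrow> complex) set"
  assumes "\<And>i. i \<le> k \<Longrightarrow> irr (C i)"
    and "\<And>i. i < k \<Longrightarrow> VI (C (Suc i)) \<subseteq> VI (C i)"
    and "\<And>i. i < k \<Longrightarrow> \<exists>g. g \<in> VI (C i) \<and> g \<notin> VI (C (Suc i))"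
    and "k \<le> CARD('v)"
  shows "\<exists>(f :: 'v \<Rightarrow> 'v mpoly) Y. card Y = k \<and> (\<forall>F\<in>pring Y. meval Const F f \<in> VI (C k) \<longrightarrow> F = 0)"
  using assms
proof (induction k)
  case 0
  then have "C 0 \<noteq> {}" by (simp add: irr_def)
  have "F = 0" if "F \<in> pring {}" "meval Const F f \<in> VI (C 0)" for F :: "'v mpoly" and f :: "'v \<Rightarrow> 'v mpoly"
  proof -
    from pring_empty[OF that(1)] obtain c where c: "F = Const c" by blast
    then show ?thesis using that(2) \<open>C 0 \<noteq> {}\<close> by (auto simp: VI_def rhom_Const)
  qed
  then show ?case by (intro exI[of _ Var] exI[of _ "{}"]) auto
next
  case (Suc k)
  from Suc.IH Suc.prems obtain f :: "'v \<Rightarrow> 'v mpoly" and Y where Y: "card Y = k"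
    and ind: "\<And>F. F \<in> pring Y \<Longrightarrow> meval Const F f \<in> VI (C k) \<Longrightarrow> F = 0"
    by (metis Suc_leD le_SucI less_SucI)
  obtain g where g: "g \<in> VI (C k)" "g \<notin> VI (C (Suc k))" using Suc.prems(3) by blast
  \<comment> \<open>The functions are indexed by variable names, so that relations among them have
    type \<open>'v mpoly\<close>; the bound on \<open>k\<close> leaves a fresh name.\<close>
  have "Y \<noteq> UNIV" using Y Suc.prems(4) by auto
  then obtain y where y: "y \<notin> Y" by auto
  let ?f = "f(y := g)"
  have key: "p = 0" if "p \<in> pcoeffs Y" "meval Const (poly p (Var y)) ?f \<in> VI (C (Suc k))" for p
    using that
  proof (induction p)
    case (pCons c p)
    have c: "c \<in> pring Y" using pCons.prems(1) by (force simp: pcoeffs_def dest: spec[of _ 0])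
    have p: "p \<in> pcoeffs Y" using pCons.prems(1) by (auto simp: pcoeffs_def dest: spec[of _ "Suc _"])
    have cf: "meval Const c ?f = meval Const c f"
      by (rule pring_eval_cong[OF c rhom_Const]) (use y in auto)
    have eq: "meval Const (poly (pCons c p) (Var y)) ?f = meval Const c f + g * meval Const (poly p (Var y)) ?f"
      by (simp add: meval_add meval_mult rhom_Const cf)
    have "meval Const c f + g * meval Const (poly p (Var y)) ?f - g * meval Const (poly p (Var y)) ?f \<in> VI (C k)"
      using pCons.prems(2) Suc.prems(2)[of k] g(1) unfolding eq by (intro VI_diff VI_mult) auto
    then have "c = 0" using ind[OF c] by simp
    then have "g * meval Const (poly p (Var y)) ?f \<in> VI (C (Suc k))"
      using pCons.prems(2) unfolding eq by (simp add: rhom_0[OF rhom_meval[OF rhom_Const]])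
    \<comment> \<open>\<open>g\<close> is outside the smaller prime and can be cancelled, which
      lowers the degree of the relation.\<close>
    then have "meval Const (poly p (Var y)) ?f \<in> VI (C (Suc k))"
      using g(2) irr_mult[OF Suc.prems(1)[of "Suc k"]] by blast
    then have "p = 0" by (rule pCons.IH[OF p])
    then show ?case using \<open>c = 0\<close> by simp
  qed simp
  have "F = 0" if "F \<in> pring (insert y Y)" "meval Const F ?f \<in> VI (C (Suc k))" for F
    using pring_insert[OF that(1)] key that(2) by fastforce
  moreover have "card (insert y Y) = Suc k" using Y y by simp
  ultimately show ?case by blast
qed

section \<open>Renaming of variables, and tangent vectors dual to independent functions\<close>

definition ren :: "('v \<Rightarrow> 'w) \<Rightarrow> ('v::finite) mpoly \<Rightarrow> ('w::finite) mpoly" where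
  "ren h F = meval Const F (\<lambda>i. Var (h i))"

lemma rhom_ren: "rhom (ren h)"
  unfolding ren_def by (rule rhom_meval[OF rhom_Const])

lemma ren_simps [simp]: "ren h (Const c) = Const c" "ren h (Var i) = Var (h i)"
  by (simp_all add: ren_def rhom_Const)

lemma meval_ren: "rhom \<kappa> \<Longrightarrow> meval \<kappa> (ren h F) a = meval \<kappa> F (\<lambda>i. a (h i))"
  unfolding ren_def using meval_comp[OF rhom_Const rhom_meval, of \<kappa> F "\<lambda>i. Var (h i)" a] by simp

lemma mp_eval_ren [simp]: "mp_eval (ren h F) a = mp_eval F (\<lambda>i. a (h i))"
  by (simp add: mp_eval_meval meval_ren rhom_id)

lemma mp_partial_ren: "inj h \<Longrightarrow> mp_partial (h i) (ren h F) = ren h (mp_partial i F)"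
  by (induction F rule: mpoly_induct)
    (auto simp: mp_partial_add mp_partial_mult rhom_add[OF rhom_ren] rhom_mult[OF rhom_ren]
       rhom_0[OF rhom_ren] rhom_1[OF rhom_ren] inj_eq)

lemma mp_partial_ren_0: "i \<notin> range h \<Longrightarrow> mp_partial i (ren h F) = 0"
  by (induction F rule: mpoly_induct)
    (auto simp: mp_partial_add mp_partial_mult rhom_add[OF rhom_ren] rhom_mult[OF rhom_ren])

lemma pring_ren: "F \<in> pring (h ` Y) \<Longrightarrow> \<exists>G\<in>pring Y. F = ren h G"
proof (induction rule: pring.induct)
  case (Const c) then show ?case by (intro bexI[of _ "Const c"]) (auto intro: pring.intros)
next
  case (Var i) then show ?case by (metis imageE ren_simps(2) pring.Var)
next
  case (add F G) then show ?case by (metis rhom_add[OF rhom_ren] pring.add)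
next
  case (mult F G) then show ?case by (metis rhom_mult[OF rhom_ren] pring.mult)
qed

text \<open>The preimage of a prime ideal under a homomorphism is prime.\<close>

lemma irr_param:
  assumes C: "irr C" and \<theta>: "\<And>F. F \<in> VI C' \<longleftrightarrow> \<theta> F \<in> VI C" and h: "rhom \<theta>"
  shows "irr C'"
proof -
  have ne: "C' \<noteq> {}"
  proof
    assume "C' = {}"
    then have "1 \<in> VI C'" by (simp add: VI_def)
    then have "1 \<in> VI C" using \<theta> rhom_1[OF h] by metis
    then show False using C by (auto simp: VI_def irr_def)
  qed
  have "F * G \<notin> VI C'" if "F \<notin> VI C'" "G \<notin> VI C'" for F G
    using that irr_mult[OF C] by (simp add: \<theta> rhom_mult[OF h])
  then show ?thesis using ne unfolding irr_def VI_def by simp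
qed

text \<open>\<open>generic_submersion\<close> treats independent variables, so it is applied to the
  graph of \<open>f\<close> over \<open>C\<close>, where the values of \<open>f\<close> are
  coordinates. Hence n + 1 independent functions force at least n + 1 independent tangent vectors at
  a generic point.\<close>

lemma generic_dual_tangents:
  fixes C :: "('v::finite \<Rightarrow> complex) set" and f :: "'v \<Rightarrow> 'v mpoly"
  assumes C: "irr C" and ind: "\<And>F. F \<in> pring Y \<Longrightarrow> meval Const F f \<in> VI C \<Longrightarrow> F = 0"
  shows "\<exists>e. e \<notin> VI C \<and> (\<forall>a\<in>C. mp_eval e a \<noteq> 0 \<longrightarrow> (\<exists>t. \<forall>y.
    (\<forall>F\<in>VI C. (\<Sum>k\<in>UNIV. t y k * mp_eval (mp_partial k F) a) = 0) \<and>
    (\<forall>l\<in>Y. (\<Sum>k\<in>UNIV. mp_eval (mp_partial k (f l)) a * t y k) = (if y = l then 1 else 0))))"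
proof -
  let ?g = "\<lambda>a. case_sum (\<lambda>i. mp_eval (f i) a) a"
  let ?\<theta> = "\<lambda>F. meval Const F (case_sum f Var)"
  have ev: "mp_eval (?\<theta> F) a = mp_eval F (?g a)" for F a
  proof -
    have "(\<lambda>i. mp_eval (case_sum f Var i) a) = ?g a" by (auto split: sum.splits)
    then show ?thesis by (simp add: mp_eval_subst)
  qed
  have \<theta>: "F \<in> VI (?g ` C) \<longleftrightarrow> ?\<theta> F \<in> VI C" for F by (simp add: VI_def ev)
  have irr: "irr (?g ` C)" by (rule irr_param[OF C \<theta> rhom_meval[OF rhom_Const]])
  have indep: "F = 0" if "F \<in> VI (?g ` C)" "F \<in> pring (Inl ` Y)" for F
  proof -
    from pring_ren[OF that(2)] obtain G where G: "G \<in> pring Y" "F = ren Inl G" by blast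
    then have "?\<theta> F = meval Const G f" by (simp add: meval_ren rhom_Const)
    then show ?thesis using ind[OF G(1)] that(1) G(2) by (simp add: \<theta> rhom_0[OF rhom_ren])
  qed
  obtain e where e: "e \<notin> VI (?g ` C)" and sub: "\<And>a \<beta>. a \<in> ?g ` C \<Longrightarrow> mp_eval e a \<noteq> 0 \<Longrightarrow>
      \<exists>\<alpha>. (\<forall>l\<in>Inl ` Y. \<alpha> l = \<beta> l) \<and> (\<forall>F\<in>VI (?g ` C). (\<Sum>l\<in>UNIV. \<alpha> l * mp_eval (mp_partial l F) a) = 0)"
    using generic_submersion[OF irr indep] by blast
  show ?thesis
  proof (intro exI[of _ "?\<theta> e"] conjI ballI impI)
    show "?\<theta> e \<notin> VI C" using e \<theta> by blast
    fix a assume a: "a \<in> C" "mp_eval (?\<theta> e) a \<noteq> 0"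
    have ex: "\<exists>t. (\<forall>F\<in>VI C. (\<Sum>k\<in>UNIV. t k * mp_eval (mp_partial k F) a) = 0) \<and>
      (\<forall>l\<in>Y. (\<Sum>k\<in>UNIV. mp_eval (mp_partial k (f l)) a * t k) = (if y = l then 1 else 0))" for y
    proof -
      obtain \<alpha> where \<alpha>: "\<And>l. l \<in> Y \<Longrightarrow> \<alpha> (Inl l) = (if y = l then 1 else 0)"
        "\<And>F. F \<in> VI (?g ` C) \<Longrightarrow> (\<Sum>l\<in>UNIV. \<alpha> l * mp_eval (mp_partial l F) (?g a)) = 0"
        using sub[of "?g a" "case_sum (\<lambda>l. if y = l then 1 else 0) (\<lambda>_. 0)"] a by (auto simp: ev)
      have pr: "mp_partial (Inl i) (ren Inr F) = 0" "mp_partial (Inr i) (ren Inr F) = ren Inr (mp_partial i F)"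
        for i and F :: "'v mpoly"
        by (auto intro!: mp_partial_ren_0 mp_partial_ren)
      show ?thesis
      proof (intro exI[of _ "\<lambda>k. \<alpha> (Inr k)"] conjI ballI)
        fix F assume "F \<in> VI C"
        then have "ren Inr F \<in> VI (?g ` C)" by (simp add: VI_def)
        from \<alpha>(2)[OF this] show "(\<Sum>k\<in>UNIV. \<alpha> (Inr k) * mp_eval (mp_partial k F) a) = 0"
          by (simp add: sum_plus_UNIV pr)
      next
        fix l assume l: "l \<in> Y"
        \<comment> \<open>These equations of the graph equate the \<open>Inl\<close>-part of a
          tangent vector with the differential of \<open>f l\<close> on its
          \<open>Inr\<close>-part.\<close>
        have mem: "ren Inr (f l) - Var (Inl l) \<in> VI (?g ` C)"
          by (auto simp: VI_def)
        have pd: "mp_eval (mp_partial (Inl i) (ren Inr (f l) - Var (Inl l))) (?g a) = (if i = l then - 1 else 0)"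
          "mp_eval (mp_partial (Inr i) (ren Inr (f l) - Var (Inl l))) (?g a) = mp_eval (mp_partial i (f l)) a" for i
          by (simp_all add: pr mp_partial_diff)
        have "(\<Sum>k\<in>UNIV. \<alpha> (Inr k) * mp_eval (mp_partial k (f l)) a) - \<alpha> (Inl l) = 0"
          using \<alpha>(2)[OF mem] unfolding sum_plus_UNIV pd by (simp add: if_distrib cong: if_cong)
        then show "(\<Sum>k\<in>UNIV. mp_eval (mp_partial k (f l)) a * \<alpha> (Inr k)) = (if y = l then 1 else 0)"
          using \<alpha>(1)[OF l] by (simp add: mult.commute)
      qed
    qed
    show "\<exists>t. \<forall>y. (\<forall>F\<in>VI C. (\<Sum>k\<in>UNIV. t y k * mp_eval (mp_partial k F) a) = 0) \<and>
      (\<forall>l\<in>Y. (\<Sum>k\<in>UNIV. mp_eval (mp_partial k (f l)) a * t y k) = (if y = l then 1 else 0))"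
      by (rule choice, rule allI, rule ex)
  qed
qed

section \<open>Frames at smooth points\<close>

text \<open>All polynomials of the ideal of the cone are used, whereas \<open>tangent_cone\<close>
  uses forms; \<open>tangent_cone_frame\<close> shows that both agree where a frame is
  nondegenerate.\<close>

definition tng :: "('m::finite) proj set \<Rightarrow> ('m \<Rightarrow> complex) \<Rightarrow> ('m \<Rightarrow> complex) \<Rightarrow> bool" where
  "tng X a w \<longleftrightarrow> (\<forall>G\<in>VI (affine_cone X). (\<Sum>k\<in>UNIV. mp_eval (mp_partial k G) a * w k) = 0)"

text \<open>A frame consists of equations of \<open>X\<close>, indexed by \<open>R\<close>, whose gradients are linearly independent at
  some point of \<open>X\<close>, completed by constant rows to a square matrix; the cofactors of the constant
  rows are then polynomial vector fields tangent to \<open>X\<close>.\<close>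

definition frame_row :: "'m set \<Rightarrow> ('m \<Rightarrow> 'm mpoly) \<Rightarrow> ('m \<Rightarrow> 'm \<Rightarrow> complex) \<Rightarrow> 'm \<Rightarrow> 'm \<Rightarrow> ('m::finite) mpoly" where
  "frame_row R F r i j = (if i \<in> R then mp_partial j (F i) else Const (r i j))"

text \<open>The dimension of \<open>X\<close> is encoded in \<open>vfield_VI\<close>: where the
  determinant is nonzero the cofactor vectors outside \<open>R\<close> span the kernel of the
  equations in \<open>R\<close>, so their tangency says that these equations already cut out the
  tangent space.\<close>

locale frame =
  fixes X :: "('m::finite) proj set" and R :: "'m set" and F :: "'m \<Rightarrow> 'm mpoly"
    and r :: "'m \<Rightarrow> 'm \<Rightarrow> complex" and dg :: "'m \<Rightarrow> nat"
  assumes irrC: "irr (affine_cone X)"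
    and F_VI: "i \<in> R \<Longrightarrow> F i \<in> VI (affine_cone X)" and F_hom: "i \<in> R \<Longrightarrow> homogeneous (dg i) (F i)"
    and Delta_VI: "mdet (frame_row R F r) \<notin> VI (affine_cone X)"
    and vfield_VI: "G \<in> VI (affine_cone X) \<Longrightarrow> j \<notin> R \<Longrightarrow> vfield (cof (frame_row R F r) j) G \<in> VI (affine_cone X)"
begin

abbreviation "C \<equiv> affine_cone X"
abbreviation "M \<equiv> frame_row R F r"
abbreviation "\<Delta> \<equiv> mdet M"
abbreviation "Mv a \<equiv> (\<lambda>i j. mp_eval (M i j) a)"

lemma eval_Delta: "mp_eval \<Delta> a = mdet (Mv a)"
  by (rule rhom_mdet[OF rhom_mp_eval])

lemma eval_cof: "mp_eval (cof M l k) a = cof (Mv a) l k"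
  by (rule rhom_cof[OF rhom_mp_eval])

lemma tng_iff:
  assumes "a \<in> C" "mp_eval \<Delta> a \<noteq> 0"
  shows "tng X a w \<longleftrightarrow> (\<forall>i\<in>R. (\<Sum>j\<in>UNIV. Mv a i j * w j) = 0)"
proof
  show "tng X a w \<Longrightarrow> \<forall>i\<in>R. (\<Sum>j\<in>UNIV. Mv a i j * w j) = 0"
    by (auto simp: tng_def frame_row_def F_VI)
  assume w: "\<forall>i\<in>R. (\<Sum>j\<in>UNIV. Mv a i j * w j) = 0"
  show "tng X a w"
    unfolding tng_def
  proof
    fix G assume G: "G \<in> VI C"
    have "(\<Sum>k\<in>UNIV. mp_eval (mp_partial k G) a * cof (Mv a) j k) = 0" if "j \<in> - R" for j
      using vfield_VI[OF G, of j] that assms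
      by (simp add: VI_def vfield_def mp_eval_sum eval_cof mult.commute)
    then have 0: "(\<Sum>j\<in>-R. (\<Sum>l\<in>UNIV. Mv a j l * w l) / mdet (Mv a) *
        (\<Sum>k\<in>UNIV. mp_eval (mp_partial k G) a * cof (Mv a) j k)) = 0" by simp
    have wk: "w k = (\<Sum>j\<in>-R. (\<Sum>l\<in>UNIV. Mv a j l * w l) / mdet (Mv a) * cof (Mv a) j k)" for k
      by (rule kernel_representation) (use assms w in \<open>auto simp: eval_Delta\<close>)
    have "(\<Sum>k\<in>UNIV. mp_eval (mp_partial k G) a * w k) = (\<Sum>k\<in>UNIV. mp_eval (mp_partial k G) a *
        (\<Sum>j\<in>-R. (\<Sum>l\<in>UNIV. Mv a j l * w l) / mdet (Mv a) * cof (Mv a) j k))"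
      by (intro sum.cong refl arg_cong2[where f = "(*)"] wk)
    also have "\<dots> = (\<Sum>j\<in>-R. (\<Sum>l\<in>UNIV. Mv a j l * w l) / mdet (Mv a) *
        (\<Sum>k\<in>UNIV. mp_eval (mp_partial k G) a * cof (Mv a) j k))"
      unfolding sum_distrib_left by (subst sum.swap) (simp add: mult_ac)
    finally show "(\<Sum>k\<in>UNIV. mp_eval (mp_partial k G) a * w k) = 0" using 0 by simp
  qed
qed

lemma tng_cof:
  assumes "a \<in> C"
  shows "tng X a (\<lambda>k. \<Sum>j\<in>-R. s j * mp_eval (cof M j k) a)"
  unfolding tng_def
proof
  fix G assume G: "G \<in> VI C"
  have "(\<Sum>k\<in>UNIV. mp_eval (mp_partial k G) a * (\<Sum>j\<in>-R. s j * mp_eval (cof M j k) a)) =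
      (\<Sum>j\<in>-R. s j * mp_eval (vfield (cof M j) G) a)"
    unfolding sum_distrib_left vfield_def mp_eval_sum by (subst sum.swap) (simp add: mult_ac)
  also have "\<dots> = 0"
    using vfield_VI[OF G] assms by (simp add: VI_def)
  finally show "(\<Sum>k\<in>UNIV. mp_eval (mp_partial k G) a * (\<Sum>j\<in>-R. s j * mp_eval (cof M j k) a)) = 0" .
qed

lemma tng_representation:
  assumes "a \<in> C" "mp_eval \<Delta> a \<noteq> 0" "tng X a w"
  shows "w = (\<lambda>k. \<Sum>j\<in>-R. (\<Sum>l\<in>UNIV. Mv a j l * w l) / mp_eval \<Delta> a * mp_eval (cof M j k) a)"
proof
  fix k
  show "w k = (\<Sum>j\<in>-R. (\<Sum>l\<in>UNIV. Mv a j l * w l) / mp_eval \<Delta> a * mp_eval (cof M j k) a)"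
    unfolding eval_Delta eval_cof
    by (rule kernel_representation) (use assms tng_iff in \<open>auto simp: eval_Delta\<close>)
qed

text \<open>The tangent vector \<open>w\<close> extends to a combination of the cofactor fields with
  constant coefficients. The value of \<open>G\<close> on this field is a polynomial in the base
  point that vanishes where \<open>e\<close> does not, hence on the whole cone.\<close>

lemma vanishing_spreads:
  assumes e: "e \<notin> VI C"
    and G: "\<And>a w. a \<in> C \<Longrightarrow> mp_eval e a \<noteq> 0 \<Longrightarrow> tng X a w \<Longrightarrow> mp_eval G w = 0"
    and a: "a \<in> C" "mp_eval \<Delta> a \<noteq> 0" "tng X a w"
  shows "mp_eval G w = 0"
proof -
  define s where "s = (\<lambda>j. (\<Sum>l\<in>UNIV. Mv a j l * w l) / mp_eval \<Delta> a)"
  define H where "H = meval Const G (\<lambda>k. \<Sum>j\<in>-R. Const (s j) * cof M j k)"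
  have H: "mp_eval H b = mp_eval G (\<lambda>k. \<Sum>j\<in>-R. s j * mp_eval (cof M j k) b)" for b
    by (simp add: H_def mp_eval_subst mp_eval_sum)
  have "e * H \<in> VI C"
    using G[OF _ _ tng_cof] by (auto simp: VI_def H)
  then have "H \<in> VI C" using irr_mult[OF irrC e] by blast
  then have "mp_eval H a = 0" using a by (simp add: VI_def)
  then show ?thesis using tng_representation[OF a] by (simp add: H s_def)
qed

end

lemma tangent_cone_at:
  assumes v: "v \<in> hcoords x"
  shows "tangent_cone X x = {w. \<forall>F\<in>homogeneous_ideal X. (\<Sum>i\<in>UNIV. mp_eval (mp_partial i F) (($) v) * w $ i) = 0}"
    (is "_ = ?T")
proof
  show "tangent_cone X x \<subseteq> ?T" using v by (auto simp: tangent_cone_def)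
  show "?T \<subseteq> tangent_cone X x"
    unfolding tangent_cone_def
  proof (intro subsetI CollectI ballI)
    fix w F v' assume w: "w \<in> ?T" and F: "F \<in> homogeneous_ideal X" and "v' \<in> hcoords x"
    then obtain t where t: "v' = t *s v" using v hcoords_multiple by metis
    obtain d where "homogeneous d F" using F by (auto simp: homogeneous_ideal_def)
    then have "homogeneous (d - 1) (mp_partial i F)" for i
      by (rule homogeneous_partial)
    then have "mp_eval (mp_partial i F) (($) v') = t ^ (d - 1) * mp_eval (mp_partial i F) (($) v)" for i
      unfolding t scale_nth by (rule homogeneous_mp_eval)
    then have "(\<Sum>i\<in>UNIV. mp_eval (mp_partial i F) (($) v') * w $ i) =
        t ^ (d - 1) * (\<Sum>i\<in>UNIV. mp_eval (mp_partial i F) (($) v) * w $ i)"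
      by (simp add: sum_distrib_left mult.assoc)
    then show "(\<Sum>i\<in>UNIV. mp_eval (mp_partial i F) (($) v') * w $ i) = 0" using w F by simp
  qed
qed

text \<open>The equations in \<open>R\<close> are forms of the ideal, so the tangent cone lies
  between the space given by \<open>tng\<close> and their kernel, which coincide by
  \<open>tng_iff\<close>.\<close>

lemma (in frame) tangent_cone_frame:
  assumes x: "x \<in> X" "v \<in> hcoords x" and D: "mp_eval \<Delta> (($) v) \<noteq> 0"
  shows "tangent_cone X x = {w. tng X (($) v) (($) w)}"
    and "vec.dim (tangent_cone X x) = card (- R)"
proof -
  have v: "($) v \<in> C" using x by (rule cone_mem)
  let ?K = "{w. \<forall>i\<in>R. (\<Sum>j\<in>UNIV. Mv (($) v) i j * w $ j) = 0}"
  have K: "{w. tng X (($) v) (($) w)} = ?K" using tng_iff[OF v D] by auto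
  have "F i \<in> homogeneous_ideal X" if "i \<in> R" for i
    using F_VI[OF that] F_hom[OF that] by (auto simp: homogeneous_ideal_iff)
  then have "tangent_cone X x \<subseteq> ?K"
    unfolding tangent_cone_at[OF x(2)] by (auto simp: frame_row_def)
  moreover have "{w. tng X (($) v) (($) w)} \<subseteq> tangent_cone X x"
    unfolding tangent_cone_at[OF x(2)] tng_def by (auto simp: homogeneous_ideal_iff)
  ultimately show 1: "tangent_cone X x = {w. tng X (($) v) (($) w)}" using K by auto
  show "vec.dim (tangent_cone X x) = card (- R)"
    unfolding 1 K by (rule dim_kernel) (use D in \<open>simp add: eval_Delta\<close>)
qed

text \<open>Smoothness provides enough equations with independent gradients at \<open>x\<close>.
  That their cofactor fields are tangent to \<open>X\<close> is a dimension count at generic points,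
  where the tangent space has dimension at least n + 1.\<close>

lemma frame_at_smooth_point:
  fixes X :: "'m::finite proj set"
  assumes X: "subvariety X" and dim: "variety_dim X = enat n" and n: "n < CARD('m)"
    and x: "smooth_point X x" "v \<in> hcoords x"
  shows "\<exists>R F r dg. frame X R F r dg \<and> card (- R) = n + 1 \<and> mp_eval (mdet (frame_row R F r)) (($) v) \<noteq> 0"
proof -
  have xX: "x \<in> X" using x by (simp add: smooth_point_def)
  have v: "($) v \<in> affine_cone X" using xX x(2) by (rule cone_mem)
  have irrC: "irr (affine_cone X)" using X by (simp add: subvariety_def irr_cone)
  let ?Gr = "(\<lambda>F j. mp_eval (mp_partial j F) (($) v)) ` homogeneous_ideal X"
  obtain M and R :: "'m set" where M: "mdet M \<noteq> 0" and MR: "\<And>i. i \<in> R \<Longrightarrow> M i \<in> ?Gr"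
    and "vec.dim {w :: complex^'m. \<forall>g\<in>?Gr. (\<Sum>j\<in>UNIV. g j * w $ j) = 0} = card (- R)"
    by (rule frame_exists[of ?Gr], rule that)
  then have cR: "card (- R) = n + 1"
    using x(1) dim unfolding smooth_point_def tangent_cone_at[OF x(2)]
    by (simp add: one_enat_def)
  have "\<forall>i\<in>R. \<exists>F\<in>homogeneous_ideal X. M i = (\<lambda>j. mp_eval (mp_partial j F) (($) v))"
    using MR by blast
  then obtain F where F: "\<And>i. i \<in> R \<Longrightarrow> F i \<in> homogeneous_ideal X"
    "\<And>i. i \<in> R \<Longrightarrow> M i = (\<lambda>j. mp_eval (mp_partial j (F i)) (($) v))" by metis
  have "\<forall>i\<in>R. \<exists>d. homogeneous d (F i)" using F(1) by (auto simp: homogeneous_ideal_def)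
  from bchoice[OF this] obtain dg where dg: "\<And>i. i \<in> R \<Longrightarrow> homogeneous (dg i) (F i)" by blast
  let ?N = "frame_row R F M"
  have "(\<lambda>i j. mp_eval (?N i j) (($) v)) = M"
    using F(2) by (auto simp: frame_row_def fun_eq_iff)
  then have D: "mp_eval (mdet ?N) (($) v) \<noteq> 0"
    using M by (simp add: rhom_mdet[OF rhom_mp_eval])
  then have DV: "mdet ?N \<notin> VI (affine_cone X)" using v by (auto simp: VI_def)
  obtain Z where Z: "\<And>i. i \<le> n \<Longrightarrow> closedin zariski (Z i) \<and> irreducible_in zariski (Z i)"
    "\<And>i. i < n \<Longrightarrow> Z i \<subset> Z (Suc i)" "Z n \<subseteq> X" using krull_chain[OF X dim] by blast
  \<comment> \<open>The origin below the cones lengthens the chain by one step: the cone has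
    dimension n + 1.\<close>
  define C where "C = (\<lambda>i. case i of 0 \<Rightarrow> {\<lambda>_::'m. 0::complex} | Suc i \<Rightarrow> affine_cone (Z i))"
  have cone_mono: "VI (affine_cone B) \<subseteq> VI (affine_cone A)" if "A \<subseteq> B" for A B :: "'m proj set"
    using that by (auto simp: VI_def affine_cone_def)
  have "\<exists>(f :: 'm \<Rightarrow> 'm mpoly) Y. card Y = n + 1 \<and> (\<forall>F\<in>pring Y. meval Const F f \<in> VI (C (n + 1)) \<longrightarrow> F = 0)"
  proof (rule independent_elements)
    show "irr (C i)" if "i \<le> n + 1" for i
    proof (cases i)
      case 0
      then show ?thesis by (simp add: C_def irr_def)
    next
      case (Suc i')
      then show ?thesis using Z(1)[of i'] that by (simp add: C_def irr_cone)
    qed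
    show "VI (C (Suc i)) \<subseteq> VI (C i)" if "i < n + 1" for i
    proof (cases i)
      case 0
      show ?thesis
      proof
        fix F assume F: "F \<in> VI (C (Suc i))"
        obtain a where a: "a \<in> affine_cone (Z 0)"
          using irr_cone[of "Z 0"] Z(1)[of 0] by (auto simp: irr_def)
        obtain q where q: "\<And>t. poly q t = mp_eval F (\<lambda>i. t * a i)" using poly_scaled_eval by blast
        \<comment> \<open>The factor t covers the missing vertex; cancelling it yields the vanishing
          at t = 0.\<close>
        have "poly (q * [:0, 1:]) t = 0" for t
          using F cone_scale[OF a, of t] q[of t] by (auto simp: 0 C_def VI_def)
        then have "q * [:0, 1:] = 0" using poly_all_0_iff_0 by blast
        then have "q = 0" by simp
        then show "F \<in> VI (C i)" using q[of 0] by (simp add: 0 C_def VI_def)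
      qed
    next
      case (Suc i')
      then show ?thesis using cone_mono Z(2)[of i'] that by (auto simp: C_def)
    qed
    show "\<exists>g. g \<in> VI (C i) \<and> g \<notin> VI (C (Suc i))" if "i < n + 1" for i
    proof (cases i)
      case 0
      obtain a where a: "a \<in> affine_cone (Z 0)"
        using irr_cone[of "Z 0"] Z(1)[of 0] by (auto simp: irr_def)
      then obtain j where "a j \<noteq> 0" using cone_nonzero by blast
      then show ?thesis using a by (intro exI[of _ "Var j"]) (auto simp: 0 C_def VI_def)
    next
      case (Suc i')
      have "Z i' \<subset> Z i" using Z(2)[of i'] that Suc by simp
      then obtain p where p: "p \<in> Z i" "p \<notin> Z i'" by blast
      then obtain G d where "homogeneous d G" "\<not> vanishes G p" "\<forall>q\<in>Z i'. vanishes G q"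
        using closedin_zariski_separate[of "Z i'" p] Z(1)[of i'] \<open>i < n + 1\<close> Suc by auto
      then show ?thesis using p
        by (intro exI[of _ G]) (auto simp: Suc C_def cone_homogeneous)
    qed
    show "n + 1 \<le> CARD('m)" using n by simp
  qed
  then obtain f :: "'m \<Rightarrow> 'm mpoly" and Y where Y: "card Y = n + 1"
    and "\<And>F. F \<in> pring Y \<Longrightarrow> meval Const F f \<in> VI (C (n + 1)) \<Longrightarrow> F = 0" by blast
  then have ind: "\<And>F. F \<in> pring Y \<Longrightarrow> meval Const F f \<in> VI (affine_cone X) \<Longrightarrow> F = 0"
    using cone_mono[OF Z(3)] by (auto simp: C_def)
  obtain e where e: "e \<notin> VI (affine_cone X)" and t: "\<And>a. a \<in> affine_cone X \<Longrightarrow> mp_eval e a \<noteq> 0 \<Longrightarrow> (\<exists>t. \<forall>y.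
    (\<forall>F\<in>VI (affine_cone X). (\<Sum>k\<in>UNIV. t y k * mp_eval (mp_partial k F) a) = 0) \<and>
    (\<forall>l\<in>Y. (\<Sum>k\<in>UNIV. mp_eval (mp_partial k (f l)) a * t y k) = (if y = l then 1 else 0)))"
    using generic_dual_tangents[OF irrC ind] by blast
  have "vfield (cof ?N j) G \<in> VI (affine_cone X)" if G: "G \<in> VI (affine_cone X)" and j: "j \<notin> R" for G j
  proof -
    have "mp_eval (vfield (cof ?N j) G) a = 0"
      if a: "a \<in> affine_cone X" "mp_eval e a \<noteq> 0" "mp_eval (mdet ?N) a \<noteq> 0" for a
    proof -
      obtain t where t: "\<forall>y. (\<forall>F\<in>VI (affine_cone X). (\<Sum>k\<in>UNIV. t y k * mp_eval (mp_partial k F) a) = 0) \<and>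
        (\<forall>l\<in>Y. (\<Sum>k\<in>UNIV. mp_eval (mp_partial k (f l)) a * t y k) = (if y = l then 1 else 0))"
        using t[OF a(1,2)] by (rule exE)
      have t1: "(\<Sum>k\<in>UNIV. t y k * mp_eval (mp_partial k F) a) = 0" if "F \<in> VI (affine_cone X)" for y F
        using t that by blast
      have t2: "(\<Sum>k\<in>UNIV. mp_eval (mp_partial k (f l)) a * t y k) = (if y = l then 1 else 0)"
        if "l \<in> Y" for y l using t that by blast
      let ?N' = "\<lambda>i j. mp_eval (?N i j) a"
      let ?T = "{w :: complex^'m. \<forall>F\<in>VI (affine_cone X). (\<Sum>k\<in>UNIV. mp_eval (mp_partial k F) a * w $ k) = 0}"
      let ?K = "{w :: complex^'m. \<forall>i\<in>R. (\<Sum>j\<in>UNIV. ?N' i j * w $ j) = 0}"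
      let ?t = "\<lambda>y. \<chi> k. t y k"
      have indep: "inj_on ?t Y" "vec.independent (?t ` Y)"
        by (rule dual_independent[of Y "\<lambda>_. 1" "\<lambda>l k. mp_eval (mp_partial k (f l)) a"]; use t2 in simp)+
      have "?T \<subseteq> ?K"
        using F(1) by (auto simp: frame_row_def homogeneous_ideal_iff)
      moreover have "vec.subspace ?T"
        by (auto simp: vec.subspace_def distrib_left sum.distrib mult.left_commute[of _ "_::complex"]
            simp flip: sum_distrib_left)
      moreover have "vec.subspace ?K"
        by (auto simp: vec.subspace_def distrib_left sum.distrib mult.left_commute[of _ "_::complex"]
            simp flip: sum_distrib_left)
      moreover have "vec.dim ?K = n + 1"
        using dim_kernel[of ?N' R] a(3) cR by (simp add: rhom_mdet[OF rhom_mp_eval])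
      moreover have "n + 1 \<le> vec.dim ?T"
      proof -
        have "?t ` Y \<subseteq> ?T" using t1 by (auto simp: mult.commute)
        then show ?thesis
          using vec.independent_card_le_dim[OF _ indep(2)] Y by (simp add: card_image[OF indep(1)])
      qed
      \<comment> \<open>\<open>?T\<close> has dimension at least n + 1 and lies in
        \<open>?K\<close>, which has dimension n + 1.\<close>
      ultimately have "?T = ?K" using vec.subspace_dim_equal[of ?T ?K] by simp
      moreover have "(\<chi> k. cof ?N' j k) \<in> ?K"
        using j by (auto simp: row_cof[of ?N'])
      ultimately have "(\<chi> k. cof ?N' j k) \<in> ?T" by simp
      then show ?thesis using G
        by (simp add: vfield_def mp_eval_sum rhom_cof[OF rhom_mp_eval] mult.commute)
    qed
    then have "e * (mdet ?N * vfield (cof ?N j) G) \<in> VI (affine_cone X)" by (auto simp: VI_def)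
    then show ?thesis using irr_mult[OF irrC e] irr_mult[OF irrC DV] by blast
  qed
  then have "frame X R F M dg"
    using irrC F(1) dg DV by unfold_locales (auto simp: homogeneous_ideal_iff)
  then show ?thesis using cR D by blast
qed

text \<open>The hypothesis on \<open>G\<close> concerns generic points, but \<open>Tan X\<close> is
  built from all smooth points; a frame at each of them and \<open>vanishing_spreads\<close> close
  the gap. Tangent spaces are linear, so each homogeneous component of \<open>G\<close> vanishes as
  well and defines a closed set.\<close>

lemma tangents_dense:
  fixes X :: "'m::finite proj set"
  assumes X: "subvariety X" and dim: "variety_dim X = enat n" and n: "n < CARD('m)"
    and Tan: "Tan X = UNIV" and e: "e \<notin> VI (affine_cone X)"
    and G: "\<And>a w. a \<in> affine_cone X \<Longrightarrow> mp_eval e a \<noteq> 0 \<Longrightarrow> tng X a w \<Longrightarrow> mp_eval G w = 0"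
  shows "G = 0"
proof -
  obtain D c where c: "\<And>d. homogeneous d (c d)" "G = (\<Sum>d<D. c d)"
    using homogeneous_decomposition by metis
  have "c d = 0" if d: "d < D" for d
  proof -
    have cd: "mp_eval (c d) w = 0" if "a \<in> affine_cone X" "mp_eval e a \<noteq> 0" "tng X a w" for a w
    proof -
      have "tng X a (\<lambda>k. t * w k)" for t
        using that(3) by (simp add: tng_def mult.left_commute[of _ t] flip: sum_distrib_left)
      then have "mp_eval G (\<lambda>k. t * w k) = 0" for t using G that by blast
      then have "poly (\<Sum>d<D. monom (mp_eval (c d) w) d) t = 0" for t
        by (simp add: c(2) mp_eval_sum poly_sum poly_monom homogeneous_mp_eval[OF c(1)] mult.commute)
      then have "(\<Sum>d<D. monom (mp_eval (c d) w) d) = 0" using poly_all_0_iff_0 by blast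
      then have "coeff (\<Sum>d<D. monom (mp_eval (c d) w) d) d = 0" by simp
      then show ?thesis using d by (simp add: coeff_sum coeff_monom)
    qed
    have "tangent_space X x \<subseteq> {p. vanishes (c d) p}" if x: "smooth_point X x" for x
    proof
      fix p assume p: "p \<in> tangent_space X x"
      obtain v where v: "v \<in> hcoords x" using hcoords_nonempty by blast
      obtain R F r dg where fr: "frame X R F r dg" and D: "mp_eval (mdet (frame_row R F r)) (($) v) \<noteq> 0"
        using frame_at_smooth_point[OF X dim n x v] by blast
      obtain w where w: "w \<in> hcoords p" using hcoords_nonempty by blast
      have xX: "x \<in> X" using x by (simp add: smooth_point_def)
      have "w \<in> tangent_cone X x" using p w by (auto simp: tangent_space_def hcoords_def)
      then have "tng X (($) v) (($) w)"
        using frame.tangent_cone_frame(1)[OF fr xX v D] by auto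
      then have "mp_eval (c d) (($) w) = 0"
        by (intro frame.vanishing_spreads[OF fr e cd cone_mem[OF xX v] D])
      then show "p \<in> {p. vanishes (c d) p}" using vanishes_iff[OF c(1) w] by simp
    qed
    then have "(\<Union>x\<in>{x. smooth_point X x}. tangent_space X x) \<subseteq> {p. vanishes (c d) p}" by blast
    then have "Tan X \<subseteq> {p. vanishes (c d) p}"
      unfolding Tan_def by (rule closure_of_minimal) (rule closedin_vanishes[OF c(1)])
    then have van: "vanishes (c d) p" for p using Tan by auto
    have nz: "mp_eval (c d) (($) w) = 0" if "w \<noteq> 0" for w :: "complex^'m"
    proof -
      from obtain_proj[OF that] obtain p where "w \<in> hcoords p" by blast
      then show ?thesis using van[of p] by (simp add: vanishes_def)
    qed
    have "mp_eval (c d) a = 0" for a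
    proof (rule ccontr)
      assume "mp_eval (c d) a \<noteq> 0"
      \<comment> \<open>The point \<open>a\<close> could be the origin, which no projective point
        represents; multiplication by a variable moves it away.\<close>
      moreover have "mp_eval (Var undefined) (\<lambda>_. 1) \<noteq> 0" by simp
      ultimately obtain b where b: "mp_eval (c d) b \<noteq> 0" "mp_eval (Var undefined) b \<noteq> 0"
        using mp_eval_prod_nonzero by blast
      have "vec_lambda b \<noteq> 0" using b(2) by (force simp: vec_eq_iff)
      then show False using nz[of "vec_lambda b"] b(1) by (simp add: vec_lambda_inverse)
    qed
    then show ?thesis by (rule mpoly_eq_0_if_eval_0)
  qed
  then show ?thesis using c(2) by simp
qed

section \<open>Formal arcs\<close>

unbundle fps_syntax and no vec_syntax

lemma fps_primitive:
  fixes q :: "'m \<Rightarrow> complex fps"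
  assumes "q i \<noteq> 0"
  obtains k q' where "\<And>j. q j = fps_X ^ k * q' j" "\<exists>j. q' j $ 0 \<noteq> 0"
proof -
  define k where "k = (LEAST n. \<exists>j. q j $ n \<noteq> 0)"
  obtain n where "q i $ n \<noteq> 0" using assms fps_nonzero_nth by blast
  then have "\<exists>j. q j $ k \<noteq> 0" unfolding k_def by (rule LeastI[of "\<lambda>n. \<exists>j. q j $ n \<noteq> 0", OF exI])
  moreover have "q j $ n = 0" if "n < k" for j n
    using not_less_Least[OF that[unfolded k_def]] by blast
  then have "q j = fps_X ^ k * fps_shift k (q j)" for j
    by (simp add: fps_eq_iff fps_X_power_mult_nth)
  ultimately show ?thesis using that[of k "\<lambda>j. fps_shift k (q j)"] by auto
qed

text \<open>The kernel vector exists over the field of Laurent series and is rescaled by a power of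
  the variable.\<close>

lemma fps_kernel:
  fixes M :: "'m::finite \<Rightarrow> 'm \<Rightarrow> complex fps"
  assumes "mdet M = 0"
  obtains q where "\<And>i. (\<Sum>j\<in>UNIV. M i j * q j) = 0" "\<exists>j. q j $ 0 \<noteq> 0"
proof -
  have hom: "rhom (fps_to_fls :: complex fps \<Rightarrow> complex fls)"
    by (rule rhomI) (simp_all add: fls_times_fps_to_fls)
  have "mdet (\<lambda>i j. fps_to_fls (M i j)) = 0"
    using rhom_mdet[OF hom, of M] assms by simp
  then obtain z where z: "\<And>i. (\<Sum>j\<in>UNIV. fps_to_fls (M i j) * z j) = 0" and "z \<noteq> (\<lambda>_. 0)"
    using mdet_nonzero_iff_kernel[of "\<lambda>i j. fps_to_fls (M i j)"] by blast
  then obtain j0 where j0: "z j0 \<noteq> 0" by auto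
  \<comment> \<open>Zero entries count with subdegree 0, so the shift may be too large by a power of
    the variable; \<open>fps_primitive\<close> removes it.\<close>
  define s where "s = Min (fls_subdegree ` z ` UNIV)"
  define q where "q = (\<lambda>j. fls_regpart (fls_shift s (z j)))"
  have "s \<le> fls_subdegree (z j)" for j unfolding s_def by (rule Min_le) auto
  then have q: "fps_to_fls (q j) = fls_shift s (z j)" for j
    unfolding q_def by (cases "z j = 0") (auto intro!: fls_regpart_to_fls_trivial)
  have Mq: "(\<Sum>j\<in>UNIV. M i j * q j) = 0" for i
  proof -
    have sh: "fls_shift s (\<Sum>j\<in>A. g j) = (\<Sum>j\<in>A. fls_shift s (g j))" for A and g :: "'m \<Rightarrow> complex fls"
      by (induction A rule: infinite_finite_induct) auto
    have "fps_to_fls (\<Sum>j\<in>UNIV. M i j * q j) = fls_shift s (\<Sum>j\<in>UNIV. fps_to_fls (M i j) * z j)"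
      by (simp add: rhom_sum[OF hom] rhom_mult[OF hom] q sh fls_shifted_times_simps)
    then show ?thesis using z by simp
  qed
  have "q j0 \<noteq> 0" using q[of j0] j0 by (auto simp: fls_shift_eq0_iff)
  then obtain k q' where q': "\<And>j. q j = fps_X ^ k * q' j" "\<exists>j. q' j $ 0 \<noteq> 0"
    using fps_primitive by metis
  have "fps_X ^ k * (\<Sum>j\<in>UNIV. M i j * q' j) = 0" for i
    using Mq[of i] by (simp add: q' sum_distrib_left mult.left_commute)
  then have "(\<Sum>j\<in>UNIV. M i j * q' j) = 0" for i by simp
  then show ?thesis using that q'(2) by blast
qed

text \<open>The exponential (Lie series) of the derivation: the Taylor series of \<open>F\<close>
  along the integral curve of \<open>\<alpha>\<close> through \<open>a\<close>, whose coordinates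
  are the series of the variables.\<close>

definition flow :: "('v \<Rightarrow> ('v::finite) mpoly) \<Rightarrow> ('v \<Rightarrow> complex) \<Rightarrow> 'v mpoly \<Rightarrow> complex fps" where
  "flow \<alpha> a F = Abs_fps (\<lambda>k. mp_eval ((vfield \<alpha> ^^ k) F) a / fact k)"

lemma flow_nth_0 [simp]: "flow \<alpha> a F $ 0 = mp_eval F a"
  by (simp add: flow_def)

lemma flow_nth_1: "flow \<alpha> a F $ 1 = mp_eval (vfield \<alpha> F) a"
  by (simp add: flow_def)

lemma flow_deriv: "fps_deriv (flow \<alpha> a F) = flow \<alpha> a (vfield \<alpha> F)"
  by (rule fps_ext) (simp add: flow_def funpow_swap1 del: of_nat_Suc)

text \<open>Both sides of the multiplicativity law solve the same formal differential equation, so no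
  binomial sums are needed.\<close>

lemma rhom_flow: "rhom (flow \<alpha> a)"
proof (rule rhomI)
  have vadd: "(vfield \<alpha> ^^ k) (F + G) = (vfield \<alpha> ^^ k) F + (vfield \<alpha> ^^ k) G" for k F G
    by (induction k) (simp_all add: vfield_add)
  show add: "flow \<alpha> a (F + G) = flow \<alpha> a F + flow \<alpha> a G" for F G
    by (rule fps_ext) (simp add: flow_def vadd add_divide_distrib)
  show "flow \<alpha> a (F * G) = flow \<alpha> a F * flow \<alpha> a G" for F G
  proof (rule fps_ext)
    fix n
    show "flow \<alpha> a (F * G) $ n = (flow \<alpha> a F * flow \<alpha> a G) $ n"
    proof (induction n arbitrary: F G)
      case (Suc n)
      have "of_nat (n + 1) * flow \<alpha> a (F * G) $ (n + 1) = flow \<alpha> a (vfield \<alpha> (F * G)) $ n"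
        unfolding fps_deriv_nth[symmetric] flow_deriv ..
      also have "\<dots> = (flow \<alpha> a (vfield \<alpha> F) * flow \<alpha> a G + flow \<alpha> a F * flow \<alpha> a (vfield \<alpha> G)) $ n"
        by (simp add: vfield_mult add Suc.IH)
      also have "\<dots> = fps_deriv (flow \<alpha> a F * flow \<alpha> a G) $ n"
        by (simp only: fps_deriv_mult flow_deriv add.commute)
      also have "\<dots> = of_nat (n + 1) * (flow \<alpha> a F * flow \<alpha> a G) $ (n + 1)"
        by (rule fps_deriv_nth)
      finally show ?case by (simp del: of_nat_Suc of_nat_add)
    qed simp
  qed
  have "(vfield \<alpha> ^^ k) 1 = (if k = 0 then 1 else 0)" for k
    using vfield_Const[of \<alpha> 1] by (induction k) auto
  then show "flow \<alpha> a 1 = 1"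
    by (intro fps_ext) (simp add: flow_def)
qed

lemma flow_Const: "flow \<alpha> a (Const c) = fps_const c"
proof -
  have "(vfield \<alpha> ^^ k) (Const c) = (if k = 0 then Const c else 0)" for k
    by (induction k) auto
  then show ?thesis by (intro fps_ext) (simp add: flow_def)
qed

text \<open>The integral curve of a tangent field stays formally inside the closure of
  \<open>C\<close>.\<close>

lemma flow_VI:
  assumes "\<And>F. F \<in> VI C \<Longrightarrow> vfield \<alpha> F \<in> VI C" "F \<in> VI C" "a \<in> C"
  shows "flow \<alpha> a F = 0"
proof -
  have "(vfield \<alpha> ^^ k) F \<in> VI C" for k
    by (induction k) (use assms in auto)
  then show ?thesis using assms(3) by (intro fps_ext) (simp add: flow_def VI_def)
qed

lemma rhom_fps_const: "rhom (fps_const :: complex \<Rightarrow> complex fps)"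
  by (rule rhomI) simp_all

lemma fps_sum_mult_nth:
  fixes u v :: "'m::finite \<Rightarrow> complex fps"
  shows "(\<Sum>j\<in>UNIV. u j * v j) $ 0 = (\<Sum>j\<in>UNIV. u j $ 0 * v j $ 0)"
    "(\<Sum>j\<in>UNIV. u j * v j) $ 1 = (\<Sum>j\<in>UNIV. u j $ 0 * v j $ 1) + (\<Sum>j\<in>UNIV. u j $ 1 * v j $ 0)"
    "(\<Sum>j\<in>UNIV. u j * v j) $ 2 = (\<Sum>j\<in>UNIV. u j $ 0 * v j $ 2) + (\<Sum>j\<in>UNIV. u j $ 1 * v j $ 1) +
      (\<Sum>j\<in>UNIV. u j $ 2 * v j $ 0)"
  by (simp_all add: fps_sum_nth fps_mult_nth sum.distrib numeral_2_eq_2)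

text \<open>The tangent spaces at the two ends of a short arc meet near its initial point, displaced by
  half of the initial velocity: \<open>Y\<close> are the equations of the tangent space along the arc \<open>y\<close>,
  and \<open>p\<close> lies in the tangent spaces at both ends.\<close>

lemma local_expansion:
  fixes Y :: "'i \<Rightarrow> 'm::finite \<Rightarrow> complex fps"
  assumes Yy: "\<And>i. i \<in> R \<Longrightarrow> (\<Sum>j\<in>UNIV. Y i j * y j) = 0"
    and Yy': "\<And>i. i \<in> R \<Longrightarrow> (\<Sum>j\<in>UNIV. Y i j * fps_deriv (y j)) = 0"
    and ker: "\<And>z. (\<And>i. i \<in> R \<Longrightarrow> (\<Sum>j\<in>UNIV. Y i j $ 0 * z j) = 0) \<Longrightarrow>
      (\<And>i. i \<in> R \<Longrightarrow> (\<Sum>j\<in>UNIV. Y i j $ 1 * z j) = 0) \<Longrightarrow> \<exists>c. z = (\<lambda>j. c * y j $ 0)"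
    and p0: "\<And>i. i \<in> R \<Longrightarrow> (\<Sum>j\<in>UNIV. fps_const (Y i j $ 0) * p j) = 0"
    and Yp: "\<And>i. i \<in> R \<Longrightarrow> (\<Sum>j\<in>UNIV. Y i j * p j) = 0"
    and nz: "p k $ 0 \<noteq> 0"
  shows "\<exists>\<alpha> \<beta>. \<alpha> \<noteq> 0 \<and> (\<forall>j. p j $ 0 = \<alpha> * y j $ 0) \<and> (\<forall>j. p j $ 1 = \<alpha> / 2 * y j $ 1 + \<beta> * y j $ 0)"
proof -
  have J: "(\<Sum>j\<in>UNIV. Y i j $ 0 * p j $ n) = 0" if "i \<in> R" for i n
    using arg_cong[OF p0[OF that], of "\<lambda>f. f $ n"] by (simp add: fps_sum_nth)
  have "\<exists>\<alpha>. (\<lambda>j. p j $ 0) = (\<lambda>j. \<alpha> * y j $ 0)"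
  proof (rule ker)
    fix i assume i: "i \<in> R"
    show "(\<Sum>j\<in>UNIV. Y i j $ 0 * p j $ 0) = 0" by (rule J[OF i])
    show "(\<Sum>j\<in>UNIV. Y i j $ 1 * p j $ 0) = 0"
      using fps_sum_mult_nth(2)[of "Y i" p] J[OF i] by (simp add: Yp[OF i])
  qed
  then obtain \<alpha> where \<alpha>: "\<And>j. p j $ 0 = \<alpha> * y j $ 0" by metis
  have "\<exists>\<beta>. (\<lambda>j. p j $ 1 - \<alpha> / 2 * y j $ 1) = (\<lambda>j. \<beta> * y j $ 0)"
  proof (rule ker)
    fix i assume i: "i \<in> R"
    have Y0w: "(\<Sum>j\<in>UNIV. Y i j $ 0 * y j $ 1) = 0"
      using fps_sum_mult_nth(1)[of "Y i" "\<lambda>j. fps_deriv (y j)"] by (simp add: Yy'[OF i])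
    then show "(\<Sum>j\<in>UNIV. Y i j $ 0 * (p j $ 1 - \<alpha> / 2 * y j $ 1)) = 0"
      using J[OF i, of 1] by (simp add: right_diff_distrib sum_subtractf mult.left_commute[of _ "\<alpha> / 2"]
          flip: sum_distrib_left times_divide_eq_left)
    have "(\<Sum>j\<in>UNIV. Y i j $ 0 * (2 * y j $ 2)) + (\<Sum>j\<in>UNIV. Y i j $ 1 * y j $ 1) = 0"
      using fps_sum_mult_nth(2)[of "Y i" "\<lambda>j. fps_deriv (y j)"] by (simp add: Yy'[OF i] numeral_2_eq_2)
    then have 1: "2 * (\<Sum>j\<in>UNIV. Y i j $ 0 * y j $ 2) + (\<Sum>j\<in>UNIV. Y i j $ 1 * y j $ 1) = 0"
      by (simp add: mult.left_commute[of _ 2] flip: sum_distrib_left)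
    have 2: "(\<Sum>j\<in>UNIV. Y i j $ 0 * y j $ 2) + (\<Sum>j\<in>UNIV. Y i j $ 1 * y j $ 1) +
        (\<Sum>j\<in>UNIV. Y i j $ 2 * y j $ 0) = 0"
      using fps_sum_mult_nth(3)[of "Y i" y] by (simp add: Yy[OF i])
    have "(\<Sum>j\<in>UNIV. Y i j $ 1 * p j $ 1) + (\<Sum>j\<in>UNIV. Y i j $ 2 * p j $ 0) = 0"
      using fps_sum_mult_nth(3)[of "Y i" p] J[OF i, of 2] by (simp add: Yp[OF i])
    then have 3: "(\<Sum>j\<in>UNIV. Y i j $ 1 * p j $ 1) + \<alpha> * (\<Sum>j\<in>UNIV. Y i j $ 2 * y j $ 0) = 0"
      by (simp add: \<alpha> mult.left_commute[of _ \<alpha>] flip: sum_distrib_left)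
    \<comment> \<open>Origin of the factor 1/2: differentiation doubles the second coefficient of
      \<open>y\<close> in \<open>1\<close> but not in \<open>2\<close>, and elimination of that
      coefficient leaves half of the product of first-order terms.\<close>
    have "(\<Sum>j\<in>UNIV. Y i j $ 2 * y j $ 0) = - (\<Sum>j\<in>UNIV. Y i j $ 1 * y j $ 1) / 2"
      using 1 2 by algebra
    then have "(\<Sum>j\<in>UNIV. Y i j $ 1 * p j $ 1) - \<alpha> / 2 * (\<Sum>j\<in>UNIV. Y i j $ 1 * y j $ 1) = 0"
      using 3 by simp
    then show "(\<Sum>j\<in>UNIV. Y i j $ 1 * (p j $ 1 - \<alpha> / 2 * y j $ 1)) = 0"
      by (simp add: right_diff_distrib sum_subtractf sum_distrib_left mult_ac)
  qed
  then obtain \<beta> where \<beta>: "\<And>j. p j $ 1 - \<alpha> / 2 * y j $ 1 = \<beta> * y j $ 0" by metis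
  have "p j $ 1 = \<alpha> / 2 * y j $ 1 + \<beta> * y j $ 0" for j using \<beta>[of j] by (simp add: algebra_simps)
  moreover have "\<alpha> \<noteq> 0" using nz \<alpha>[of k] by auto
  ultimately show ?thesis using \<alpha> by blast
qed

text \<open>The cofactors along row \<open>l0\<close> give the intersection point of the tangent
  spaces at both ends of the arc, up to a power of the variable. After division by this power
  \<open>local_expansion\<close> applies, and a scalar series normalises the point to the form y(0)
  + t z.\<close>

lemma arc_limit:
  fixes Y :: "'m::finite \<Rightarrow> 'm \<Rightarrow> complex fps"
  assumes l0: "l0 \<notin> R" and \<sigma>: "bij_betw \<sigma> (- R - {l0}) R"
    and Yy: "\<And>i. i \<in> R \<Longrightarrow> (\<Sum>j\<in>UNIV. Y i j * y j) = 0"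
    and Yy': "\<And>i. i \<in> R \<Longrightarrow> (\<Sum>j\<in>UNIV. Y i j * fps_deriv (y j)) = 0"
    and ker: "\<And>z. (\<And>i. i \<in> R \<Longrightarrow> (\<Sum>j\<in>UNIV. Y i j $ 0 * z j) = 0) \<Longrightarrow>
      (\<And>i. i \<in> R \<Longrightarrow> (\<Sum>j\<in>UNIV. Y i j $ 1 * z j) = 0) \<Longrightarrow> \<exists>c. z = (\<lambda>j. c * y j $ 0)"
    and nz: "y k0 $ 0 \<noteq> 0"
    and M: "M = (\<lambda>i j. if i \<in> R then fps_const (Y i j $ 0) else if i = l0 then 0 else Y (\<sigma> i) j)"
    and G: "homogeneous d G" "meval fps_const G (cof M l0) = 0"
  shows "\<exists>z. meval fps_const G (\<lambda>j. fps_const (y j $ 0) + fps_X * z j) = 0 \<and>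
    (\<forall>i\<in>R. (\<Sum>j\<in>UNIV. fps_const (Y i j $ 0) * z j) = 0) \<and> (\<forall>j. z j $ 0 = y j $ 1 / 2)"
proof -
  have Rrow: "i \<noteq> l0" "M i j = fps_const (Y i j $ 0)" if "i \<in> R" for i j using that l0 M by auto
  have Yrow: "\<exists>i'. i' \<noteq> l0 \<and> M i' = Y i" if "i \<in> R" for i
  proof -
    have "i \<in> \<sigma> ` (- R - {l0})" using \<sigma> that by (simp add: bij_betw_def)
    then obtain i' where "i' \<in> - R - {l0}" "i = \<sigma> i'" by blast
    then show ?thesis using M by auto
  qed
  have exp: "\<exists>\<alpha> \<beta>. \<alpha> \<noteq> 0 \<and> (\<forall>j. q j $ 0 = \<alpha> * y j $ 0) \<and> (\<forall>j. q j $ 1 = \<alpha> / 2 * y j $ 1 + \<beta> * y j $ 0)"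
    if q: "\<And>i. i \<noteq> l0 \<Longrightarrow> (\<Sum>j\<in>UNIV. M i j * q j) = 0" and "\<exists>j. q j $ 0 \<noteq> 0" for q
  proof -
    from that(2) obtain k where k: "q k $ 0 \<noteq> 0" ..
    have 1: "(\<Sum>j\<in>UNIV. fps_const (Y i j $ 0) * q j) = 0" if "i \<in> R" for i
      using q[of i] Rrow[OF that] by simp
    have 2: "(\<Sum>j\<in>UNIV. Y i j * q j) = 0" if "i \<in> R" for i
      using q Yrow[OF that] by metis
    show ?thesis by (rule local_expansion[OF Yy Yy' ker 1 2 k])
  qed
  let ?e = "\<lambda>j. if j = k0 then 1 else 0 :: complex fps"
  \<comment> \<open>A primitive kernel vector would by \<open>exp\<close> start with a nonzero
    multiple of \<open>y\<close> at 0, although the added row forces its entry at \<open>k0\<close>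
    to be 0. So not all cofactors vanish.\<close>
  have "mdet (M(l0 := ?e)) \<noteq> 0"
  proof
    assume "mdet (M(l0 := ?e)) = 0"
    then obtain q where q: "\<And>i. (\<Sum>j\<in>UNIV. (M(l0 := ?e)) i j * q j) = 0" and q0: "\<exists>j. q j $ 0 \<noteq> 0"
      using fps_kernel by blast
    have "(\<Sum>j\<in>UNIV. M i j * q j) = 0" if "i \<noteq> l0" for i using q[of i] that by simp
    then obtain \<alpha> where "\<alpha> \<noteq> 0" "\<And>j. q j $ 0 = \<alpha> * y j $ 0" using exp[OF _ q0] by blast
    moreover have "(\<Sum>j\<in>UNIV. ?e j * q j) = q k0"
      by (subst sum.cong[OF refl, where h = "\<lambda>j. if j = k0 then q k0 else 0"]) auto
    then have "q k0 = 0" using q[of l0] by simp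
    ultimately show False using nz by (metis fps_zero_nth mult_eq_0_iff)
  qed
  then have "\<exists>k. cof M l0 k \<noteq> 0"
    unfolding sum_cof[symmetric] by (metis (no_types, lifting) mult_zero_right sum.neutral)
  then obtain m q where q: "\<And>j. cof M l0 j = fps_X ^ m * q j" "\<exists>j. q j $ 0 \<noteq> 0"
    using fps_primitive by metis
  have Mq: "(\<Sum>j\<in>UNIV. M i j * q j) = 0" if "i \<noteq> l0" for i
  proof -
    have "fps_X ^ m * (\<Sum>j\<in>UNIV. M i j * q j) = (\<Sum>j\<in>UNIV. M i j * cof M l0 j)"
      by (simp add: q sum_distrib_left mult_ac)
    then show ?thesis using that by (simp add: row_cof)
  qed
  have "meval fps_const G (\<lambda>j. fps_X ^ m * q j) = 0"
    using G(2) unfolding q(1)[symmetric] .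
  then have Gq: "meval fps_const G q = 0"
    by (simp add: homogeneous_eval[OF G(1)])
  obtain \<alpha> \<beta> where \<alpha>: "\<alpha> \<noteq> 0" and q0: "\<And>j. q j $ 0 = \<alpha> * y j $ 0"
    and q1: "\<And>j. q j $ 1 = \<alpha> / 2 * y j $ 1 + \<beta> * y j $ 0"
    using exp[OF Mq q(2)] by blast
  \<comment> \<open>The inverse of \<alpha> + \<beta> t up to order t: it turns the leading term
    into y(0) and removes the \<beta>-term.\<close>
  define c where "c = fps_const (1 / \<alpha>) * (1 - fps_const (\<beta> / \<alpha>) * fps_X)"
  have c01: "c $ 0 = 1 / \<alpha>" "c $ 1 = - \<beta> / \<alpha>\<^sup>2"
    by (simp_all add: c_def power2_eq_square)
  define z where "z = (\<lambda>j. fps_shift 1 (c * q j))"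
  have cq0: "(c * q j) $ 0 = y j $ 0" for j using \<alpha> by (simp add: c01 q0)
  have cq1: "(c * q j) $ 1 = y j $ 1 / 2" for j
    unfolding fps_mult_nth_1 c01 q0 q1 using \<alpha> by (simp add: field_simps power2_eq_square)
  have cq: "c * q j = fps_const (y j $ 0) + fps_X * z j" for j
  proof (rule fps_ext)
    fix n show "(c * q j) $ n = (fps_const (y j $ 0) + fps_X * z j) $ n"
      using cq0[of j] by (cases n) (simp_all add: z_def)
  qed
  show ?thesis
  proof (intro exI[of _ z] conjI ballI allI)
    show "meval fps_const G (\<lambda>j. fps_const (y j $ 0) + fps_X * z j) = 0"
      unfolding cq[symmetric] homogeneous_eval[OF G(1)] Gq by simp
    show "z j $ 0 = y j $ 1 / 2" for j using cq1[of j] by (simp add: z_def)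
    fix i assume i: "i \<in> R"
    have "(\<Sum>j\<in>UNIV. fps_const (Y i j $ 0) * (c * q j)) = c * (\<Sum>j\<in>UNIV. M i j * q j)"
      by (simp add: sum_distrib_left Rrow[OF i] mult_ac)
    also have "\<dots> = 0" by (simp only: Mq[OF Rrow(1)[OF i]] mult_zero_right)
    finally have "(\<Sum>j\<in>UNIV. fps_const (Y i j $ 0) * fps_const (y j $ 0)) +
        fps_X * (\<Sum>j\<in>UNIV. fps_const (Y i j $ 0) * z j) = 0"
      unfolding cq by (simp add: distrib_left sum.distrib sum_distrib_left mult_ac)
    moreover have "(\<Sum>j\<in>UNIV. fps_const (Y i j $ 0) * fps_const (y j $ 0)) =
        fps_const ((\<Sum>j\<in>UNIV. Y i j * y j) $ 0)"
      by (simp add: fps_sum_nth rhom_sum[OF rhom_fps_const])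
    ultimately have "fps_X * (\<Sum>j\<in>UNIV. fps_const (Y i j $ 0) * z j) = 0"
      by (simp add: Yy[OF i])
    then show "(\<Sum>j\<in>UNIV. fps_const (Y i j $ 0) * z j) = 0" by simp
  qed
qed

text \<open>Only the lowest-degree form of \<open>g\<close> contributes to the leading coefficient.\<close>

lemma vanishing_on_arcs:
  fixes g b :: "'v::finite mpoly"
  assumes b: "mp_eval b s1 \<noteq> 0"
    and arcs: "\<And>s0. mp_eval b s0 \<noteq> 0 \<Longrightarrow>
      \<exists>s. (\<forall>j. s j $ 0 = s0 j) \<and> meval fps_const g (\<lambda>j. fps_X * s j) = 0"
  shows "g = 0"
proof (rule ccontr)
  assume g0: "g \<noteq> 0"
  obtain D c where c: "\<And>d. homogeneous d (c d)" "g = (\<Sum>d<D. c d)"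
    using homogeneous_decomposition by metis
  have "\<exists>d. d < D \<and> c d \<noteq> 0"
  proof (rule ccontr)
    assume "\<not> ?thesis"
    then have "g = 0" unfolding c(2) by (intro sum.neutral) auto
    then show False using g0 by simp
  qed
  then obtain d where d: "d < D" "c d \<noteq> 0" and least: "\<And>e. e < d \<Longrightarrow> e < D \<Longrightarrow> c e = 0"
    using exists_least_iff[of "\<lambda>d. d < D \<and> c d \<noteq> 0"] by auto
  obtain s2 where "mp_eval (c d) s2 \<noteq> 0" using d mpoly_eq_0_if_eval_0 by blast
  \<comment> \<open>The initial direction avoids both the zeros of the lowest form and those of
    \<open>b\<close>.\<close>
  then obtain s0 where s0: "mp_eval (c d) s0 \<noteq> 0" "mp_eval b s0 \<noteq> 0"
    using mp_eval_prod_nonzero b by blast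
  obtain s where s: "\<And>j. s j $ 0 = s0 j" "meval fps_const g (\<lambda>j. fps_X * s j) = 0"
    using arcs[OF s0(2)] by blast
  have nth0: "rhom (\<lambda>f :: complex fps. f $ 0)" by (rule rhomI) simp_all
  have "meval fps_const (c d) s $ 0 = mp_eval (c d) s0"
    using meval_comp[OF rhom_fps_const nth0, of "c d" s] by (simp add: s mp_eval_meval)
  have "0 = meval fps_const g (\<lambda>j. fps_X * s j) $ d"
    by (simp add: s)
  also have "\<dots> = (\<Sum>e<D. (fps_X ^ e * meval fps_const (c e) s) $ d)"
    unfolding c(2) rhom_sum[OF rhom_meval[OF rhom_fps_const]] homogeneous_eval[OF c(1)] fps_sum_nth ..
  also have "\<dots> = (\<Sum>e<D. if e = d then meval fps_const (c d) s $ 0 else 0)"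
  proof (rule sum.cong)
    fix e assume "e \<in> {..<D}"
    then show "(fps_X ^ e * meval fps_const (c e) s) $ d = (if e = d then meval fps_const (c d) s $ 0 else 0)"
      using least[of e] by (cases e d rule: linorder_cases)
        (auto simp: fps_X_power_mult_nth rhom_0[OF rhom_meval[OF rhom_fps_const]])
  qed simp
  also have "\<dots> = mp_eval (c d) s0"
    using d \<open>meval fps_const (c d) s $ 0 = mp_eval (c d) s0\<close> by simp
  finally show False using s0 by simp
qed


unbundle no fps_syntax and vec_syntax

section \<open>The second fundamental form\<close>

text \<open>For tangent \<open>w\<close> and \<open>z\<close> the values for the equations of a
  frame are the coordinates of the second fundamental form.\<close>

definition hess :: "('m::finite) mpoly \<Rightarrow> ('m \<Rightarrow> complex) \<Rightarrow> ('m \<Rightarrow> complex) \<Rightarrow> ('m \<Rightarrow> complex) \<Rightarrow> complex" where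
  "hess F a w z = (\<Sum>l\<in>UNIV. (\<Sum>k\<in>UNIV. mp_eval (mp_partial l (mp_partial k F)) a * w k) * z l)"

lemma mp_partial_commute: "mp_partial i (mp_partial j F) = mp_partial j (mp_partial i (F :: 'v::finite mpoly))"
  by (induction F rule: mpoly_induct) (auto simp: mp_partial_add mp_partial_mult add_ac)

lemma Euler_eval:
  assumes "homogeneous d F"
  shows "(\<Sum>i\<in>UNIV. mp_eval (mp_partial i F) a * a i) = of_nat d * mp_eval F a"
  using arg_cong[OF Euler_homogeneous[OF assms], of "\<lambda>F. mp_eval F a"]
  by (simp add: mp_eval_sum rhom_of_nat[OF rhom_mp_eval])

text \<open>Since \<open>card (- R) = n + 1\<close> and \<open>card R = n\<close>, the rows outside \<open>R\<close> can hold a second copy of the \<open>n\<close>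
  equations, by \<open>\<sigma>\<close>, with one row \<open>l0\<close> to spare.\<close>

locale filling = frame X R F r dg for X :: "('m::finite) proj set" and R F r dg +
  fixes l0 :: 'm and \<sigma> :: "'m \<Rightarrow> 'm"
  assumes l0: "l0 \<notin> R" and \<sigma>: "bij_betw \<sigma> (- R - {l0}) R"
    and dense: "\<And>e G. e \<notin> VI (affine_cone X) \<Longrightarrow>
      (\<And>a w. a \<in> affine_cone X \<Longrightarrow> mp_eval e a \<noteq> 0 \<Longrightarrow> tng X a w \<Longrightarrow> mp_eval G w = 0) \<Longrightarrow> G = 0"
begin

text \<open>Linear coordinates \<open>s j\<close>, for \<open>j\<close> outside \<open>R\<close>, on
  the span of the cofactor vectors at \<open>a\<close>.\<close>

definition tvec :: "('m \<Rightarrow> complex) \<Rightarrow> ('m \<Rightarrow> complex) \<Rightarrow> 'm \<Rightarrow> complex" where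
  "tvec a s k = (\<Sum>j\<in>-R. s j * mp_eval (cof M j k) a)"

lemma tng_tvec: "a \<in> C \<Longrightarrow> tng X a (tvec a s)"
  unfolding tvec_def by (rule tng_cof)

lemma tng_eq_tvec: "a \<in> C \<Longrightarrow> mp_eval \<Delta> a \<noteq> 0 \<Longrightarrow> tng X a w \<Longrightarrow> \<exists>s. w = tvec a s"
  unfolding tvec_def by (rule exI, rule tng_representation)

text \<open>The tangent bundle of the cone in parametrised form; the fibre over \<open>a\<close> is
  the full tangent space where \<open>\<Delta>\<close> does not vanish.\<close>

definition TX :: "('m + 'm \<Rightarrow> complex) set" where
  "TX = {case_sum a (tvec a s) | a s. a \<in> C}"

definition at_s :: "('m \<Rightarrow> complex) \<Rightarrow> ('m + 'm) mpoly \<Rightarrow> 'm mpoly" where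
  "at_s s H = meval Const H (case_sum Var (\<lambda>k. \<Sum>j\<in>-R. Const (s j) * cof M j k))"

definition at_a :: "('m \<Rightarrow> complex) \<Rightarrow> ('m + 'm) mpoly \<Rightarrow> 'm mpoly" where
  "at_a a H = meval Const H (case_sum (\<lambda>i. Const (a i)) (\<lambda>k. \<Sum>j\<in>-R. Var j * Const (mp_eval (cof M j k) a)))"

lemma eval_at_s: "mp_eval (at_s s H) a = mp_eval H (case_sum a (tvec a s))"
  unfolding at_s_def mp_eval_subst
  by (rule arg_cong[of _ _ "mp_eval H"]) (auto simp: fun_eq_iff tvec_def mp_eval_sum split: sum.splits)

lemma eval_at_a: "mp_eval (at_a a H) s = mp_eval H (case_sum a (tvec a s))"
  unfolding at_a_def mp_eval_subst
  by (rule arg_cong[of _ _ "mp_eval H"]) (auto simp: fun_eq_iff tvec_def mp_eval_sum split: sum.splits)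

text \<open>With \<open>s1\<close> and \<open>s2\<close> fixed, irreducibility of the cone provides
  a common base point; in the fibre over it, irreducibility of affine space provides a common
  direction.\<close>

lemma irr_TX: "irr TX"
  unfolding irr_def
proof (intro conjI allI impI)
  obtain a where "a \<in> C" using irrC by (auto simp: irr_def)
  then show "TX \<noteq> {}" unfolding TX_def by blast
  fix H1 H2 :: "('m + 'm) mpoly"
  assume "\<exists>a\<in>TX. mp_eval H1 a \<noteq> 0" "\<exists>a\<in>TX. mp_eval H2 a \<noteq> 0"
  then obtain a1 s1 a2 s2 where "a1 \<in> C" "mp_eval (at_s s1 H1) a1 \<noteq> 0" "a2 \<in> C" "mp_eval (at_s s2 H2) a2 \<noteq> 0"
    unfolding TX_def by (auto simp: eval_at_s)
  then obtain a where a: "a \<in> C" "mp_eval (at_s s1 H1) a \<noteq> 0" "mp_eval (at_s s2 H2) a \<noteq> 0"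
    using irr_mult[OF irrC, of "at_s s1 H1" "at_s s2 H2"] by (auto simp: VI_def)
  then have "mp_eval (at_a a H1) s1 \<noteq> 0" "mp_eval (at_a a H2) s2 \<noteq> 0"
    by (simp_all add: eval_at_a eval_at_s)
  then obtain s where "mp_eval (at_a a H1) s \<noteq> 0" "mp_eval (at_a a H2) s \<noteq> 0"
    using mp_eval_prod_nonzero by blast
  then show "\<exists>a\<in>TX. mp_eval H1 a \<noteq> 0 \<and> mp_eval H2 a \<noteq> 0"
    using a(1) unfolding TX_def eval_at_a by blast
qed

text \<open>This is dominance of the projection of the tangent bundle to the ambient space, in the
  form that \<open>generic_submersion\<close> requires.\<close>

lemma directions_independent:
  assumes "H \<in> VI TX" "H \<in> pring (range Inr)"
  shows "H = 0"
proof -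
  obtain G where G: "H = ren Inr G" using pring_ren[OF assms(2)] by blast
  have "mp_eval G (tvec a s) = 0" if "a \<in> C" for a s
    using assms(1) that by (force simp: VI_def TX_def G)
  then have "mp_eval G w = 0" if "a \<in> C" "mp_eval \<Delta> a \<noteq> 0" "tng X a w" for a w
    using tng_eq_tvec[OF that] that(1) by blast
  then have "G = 0" by (rule dense[OF Delta_VI])
  then show ?thesis by (simp add: G rhom_0[OF rhom_ren])
qed

text \<open>A tangent vector \<open>(z, u)\<close> of the tangent bundle at \<open>(a, w)\<close> satisfies \<open>hess F a w z + dF u = 0\<close>.
  As the tangent bundle dominates the ambient space, \<open>u\<close> is arbitrary.\<close>

lemma hess_surj:
  "\<exists>e. e \<notin> VI TX \<and> (\<forall>a w. a \<in> C \<longrightarrow> mp_eval \<Delta> a \<noteq> 0 \<longrightarrow> tng X a w \<longrightarrow> mp_eval e (case_sum a w) \<noteq> 0 \<longrightarrow>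
    (\<forall>c. \<exists>z. tng X a z \<and> (\<forall>i\<in>R. hess (F i) a w z = c i)))"
proof -
  obtain e where e: "e \<notin> VI TX" and sub: "\<And>b \<beta>. b \<in> TX \<Longrightarrow> mp_eval e b \<noteq> 0 \<Longrightarrow>
      \<exists>\<alpha>. (\<forall>l\<in>range Inr. \<alpha> l = \<beta> l) \<and> (\<forall>F\<in>VI TX. (\<Sum>l\<in>UNIV. \<alpha> l * mp_eval (mp_partial l F) b) = 0)"
    using generic_submersion[OF irr_TX directions_independent] by blast
  have "\<exists>z. tng X a z \<and> (\<forall>i\<in>R. hess (F i) a w z = c i)"
    if a: "a \<in> C" "mp_eval \<Delta> a \<noteq> 0" and w: "tng X a w" "mp_eval e (case_sum a w) \<noteq> 0" for a w c
  proof -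
    \<comment> \<open>The rows in \<open>R\<close> are the gradients, so \<open>u\<close> is a
      vector on which the differential of \<open>F i\<close> takes the value - c i.\<close>
    obtain u where u: "\<And>i. (\<Sum>j\<in>UNIV. Mv a i j * u j) = - c i"
      using mdet_solve[of "Mv a" "\<lambda>i. - c i"] a(2) by (auto simp: eval_Delta)
    have mem: "case_sum a w \<in> TX" using tng_eq_tvec[OF a w(1)] a(1) by (auto simp: TX_def)
    obtain \<alpha> where \<alpha>: "\<And>k. \<alpha> (Inr k) = u k"
      "\<And>F. F \<in> VI TX \<Longrightarrow> (\<Sum>l\<in>UNIV. \<alpha> l * mp_eval (mp_partial l F) (case_sum a w)) = 0"
      using sub[OF mem w(2), of "case_sum (\<lambda>_. 0) u"] by auto
    have pr: "mp_partial (Inr i) (ren Inl F) = 0" "mp_partial (Inl i) (ren Inl F) = ren Inl (mp_partial i F)"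
      for i and F :: "'m mpoly"
      by (auto intro!: mp_partial_ren_0 mp_partial_ren)
    define z where "z = (\<lambda>l. \<alpha> (Inl l))"
    have z: "tng X a z"
      unfolding tng_def
    proof
      fix G assume "G \<in> VI C"
      then have "ren Inl G \<in> VI TX" by (auto simp: VI_def TX_def)
      from \<alpha>(2)[OF this] show "(\<Sum>k\<in>UNIV. mp_eval (mp_partial k G) a * z k) = 0"
        by (simp add: sum_plus_UNIV pr z_def mult.commute)
    qed
    moreover have "hess (F i) a w z = c i" if i: "i \<in> R" for i
    proof -
      \<comment> \<open>The equation of the tangent bundle derived from \<open>F i\<close>. Its
        differential has the Hessian term in the base directions and the gradient in the fibre
        directions.\<close>
      let ?H = "\<Sum>k\<in>UNIV. ren Inl (mp_partial k (F i)) * Var (Inr k)"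
      have "mp_eval ?H (case_sum b (tvec b s)) = 0" if "b \<in> C" for b s
        using tng_tvec[OF that] F_VI[OF i] by (simp add: mp_eval_sum tng_def)
      then have "?H \<in> VI TX" by (auto simp: VI_def TX_def)
      moreover have "mp_eval (mp_partial (Inl l) ?H) (case_sum a w) =
          (\<Sum>k\<in>UNIV. mp_eval (mp_partial l (mp_partial k (F i))) a * w k)" for l
        by (simp add: mp_partial_sum mp_partial_mult pr mp_eval_sum)
      moreover have "mp_eval (mp_partial (Inr j) ?H) (case_sum a w) = mp_eval (mp_partial j (F i)) a" for j
      proof -
        have "mp_partial (Inr j) (ren Inl (mp_partial k (F i)) * Var (Inr k)) =
            (if k = j then ren Inl (mp_partial j (F i)) else 0)" for k
          by (auto simp: mp_partial_mult pr)
        then show ?thesis by (simp add: mp_partial_sum)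
      qed
      ultimately have "(\<Sum>l\<in>UNIV. z l * (\<Sum>k\<in>UNIV. mp_eval (mp_partial l (mp_partial k (F i))) a * w k)) +
          (\<Sum>k\<in>UNIV. u k * mp_eval (mp_partial k (F i)) a) = 0"
        using \<alpha>(2)[of ?H] by (simp add: sum_plus_UNIV z_def \<alpha>(1))
      moreover have "(\<Sum>k\<in>UNIV. u k * mp_eval (mp_partial k (F i)) a) = - c i"
        using u[of i] i by (simp add: frame_row_def mult.commute)
      ultimately show ?thesis by (simp add: hess_def mult.commute)
    qed
    ultimately show ?thesis by blast
  qed
  then show ?thesis using e by blast
qed

text \<open>Euler's relation for the first partial derivatives turns the Hessian term into a
  multiple of the differential applied to \<open>w\<close>, which is tangent.\<close>

lemma hess_radial:
  assumes "a \<in> C" "tng X a w" "i \<in> R"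
  shows "hess (F i) a w a = 0"
proof -
  have hom: "homogeneous (dg i - 1) (mp_partial k (F i))" for k
    by (rule homogeneous_partial[OF F_hom[OF assms(3)]])
  have "hess (F i) a w a = (\<Sum>k\<in>UNIV. w k * (\<Sum>l\<in>UNIV. mp_eval (mp_partial l (mp_partial k (F i))) a * a l))"
    unfolding hess_def sum_distrib_left sum_distrib_right by (subst sum.swap) (simp add: mult_ac)
  also have "\<dots> = of_nat (dg i - 1) * (\<Sum>k\<in>UNIV. mp_eval (mp_partial k (F i)) a * w k)"
    unfolding Euler_eval[OF hom] by (simp add: sum_distrib_left mult_ac)
  also have "\<dots> = 0" using assms F_VI by (simp add: tng_def)
  finally show ?thesis .
qed

lemma tng_radial: "a \<in> C \<Longrightarrow> i \<in> R \<Longrightarrow> (\<Sum>k\<in>UNIV. mp_eval (mp_partial k (F i)) a * a k) = 0"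
  unfolding Euler_eval[OF F_hom] using F_VI by (simp add: VI_def)

lemma hess_add: "hess G a w (\<lambda>k. s * z k + z' k) = s * hess G a w z + hess G a w z'"
  by (simp add: hess_def distrib_left sum.distrib sum_distrib_left mult_ac)

text \<open>A surjection from the (n + 1)-dimensional tangent space onto n coordinates has a
  one-dimensional kernel, and it contains \<open>a\<close>. The count is made by the square matrix
  \<open>Q\<close>, whose spare row reads off a coordinate in which \<open>a\<close> is
  nonzero.\<close>

lemma hess_kernel:
  assumes a: "a \<in> C" "mp_eval \<Delta> a \<noteq> 0" and w: "tng X a w"
    and surj: "\<And>c. \<exists>z. tng X a z \<and> (\<forall>i\<in>R. hess (F i) a w z = c i)"
    and z: "\<And>i. i \<in> R \<Longrightarrow> (\<Sum>j\<in>UNIV. mp_eval (mp_partial j (F i)) a * z j) = 0"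
    "\<And>i. i \<in> R \<Longrightarrow> hess (F i) a w z = 0"
  shows "\<exists>c. z = (\<lambda>j. c * a j)"
proof -
  obtain k0 where k0: "a k0 \<noteq> 0" using cone_nonzero[OF a(1)] by blast
  define Q where "Q = (\<lambda>i j. if i \<in> R then mp_eval (mp_partial j (F i)) a
     else if i = l0 then (if j = k0 then 1 else 0)
     else (\<Sum>k\<in>UNIV. mp_eval (mp_partial j (mp_partial k (F (\<sigma> i)))) a * w k))"
  have QR: "(\<Sum>j\<in>UNIV. Q i j * v j) = (\<Sum>j\<in>UNIV. mp_eval (mp_partial j (F i)) a * v j)" if "i \<in> R" for i v
    using that by (simp add: Q_def)
  have Ql: "(\<Sum>j\<in>UNIV. Q l0 j * v j) = v k0" for v
  proof -
    have "(\<Sum>j\<in>UNIV. Q l0 j * v j) = (\<Sum>j\<in>UNIV. if j = k0 then v k0 else 0)"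
      by (rule sum.cong) (use l0 in \<open>auto simp: Q_def\<close>)
    then show ?thesis by simp
  qed
  have Qh: "(\<Sum>j\<in>UNIV. Q i j * v j) = hess (F (\<sigma> i)) a w v" if "i \<notin> R" "i \<noteq> l0" for i v
    using that by (simp add: Q_def hess_def)
  have \<sigma>R: "\<sigma> i \<in> R" if "i \<notin> R" "i \<noteq> l0" for i
    using \<sigma> that by (auto simp: bij_betw_def)
  have Q0: "mdet Q \<noteq> 0"
  proof (rule mdet_nonzero_if_surj)
    fix c :: "'m \<Rightarrow> complex"
    obtain z1 where z1: "\<And>i. (\<Sum>j\<in>UNIV. Mv a i j * z1 j) = c i"
      using mdet_solve[of "Mv a" c] a(2) by (auto simp: eval_Delta)
    let ?\<tau> = "inv_into (- R - {l0}) \<sigma>"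
    obtain t where t: "tng X a t" "\<And>i. i \<in> R \<Longrightarrow> hess (F i) a w t = c (?\<tau> i) - hess (F i) a w z1"
      using surj[of "\<lambda>i. c (?\<tau> i) - hess (F i) a w z1"] by blast
    \<comment> \<open>The radial vector is killed by all rows but \<open>l0\<close>, so it can
      correct the coordinate \<open>k0\<close> at the end.\<close>
    let ?s = "(c l0 - z1 k0 - t k0) / a k0"
    let ?z = "\<lambda>k. ?s * a k + (1 * z1 k + t k)"
    have "(\<Sum>j\<in>UNIV. Q i j * ?z j) = c i" for i
    proof -
      consider "i \<in> R" | "i = l0" | "i \<notin> R" "i \<noteq> l0" by blast
      then show ?thesis
      proof cases
        case 1
        have "(\<Sum>j\<in>UNIV. Q i j * ?z j) = ?s * (\<Sum>j\<in>UNIV. mp_eval (mp_partial j (F i)) a * a j) +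
            ((\<Sum>j\<in>UNIV. Mv a i j * z1 j) + (\<Sum>j\<in>UNIV. mp_eval (mp_partial j (F i)) a * t j))"
          unfolding QR[OF 1] using 1
          by (simp add: distrib_left distrib_right sum.distrib sum_distrib_left mult_ac frame_row_def)
        then show ?thesis
          using z1 tng_radial[OF a(1) 1] t(1) F_VI[OF 1] by (simp add: tng_def)
      next
        case 2
        then show ?thesis using k0 by (simp add: Ql)
      next
        case 3
        have "?\<tau> (\<sigma> i) = i" using \<sigma> 3 by (simp add: bij_betw_def)
        then show ?thesis
          unfolding Qh[OF 3] hess_add using hess_radial[OF a(1) w] t(2) \<sigma>R[OF 3] by simp
      qed
    qed
    then show "\<exists>z. \<forall>i. (\<Sum>j\<in>UNIV. Q i j * z j) = c i" by (intro exI[of _ ?z] allI)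
  qed
  define s where "s = - z k0 / a k0"
  let ?z = "\<lambda>k. s * a k + z k"
  have "(\<Sum>j\<in>UNIV. Q i j * ?z j) = 0" for i
  proof -
    consider "i \<in> R" | "i = l0" | "i \<notin> R" "i \<noteq> l0" by blast
    then show ?thesis
    proof cases
      case 1
      have "(\<Sum>j\<in>UNIV. Q i j * ?z j) = s * (\<Sum>j\<in>UNIV. mp_eval (mp_partial j (F i)) a * a j) +
          (\<Sum>j\<in>UNIV. mp_eval (mp_partial j (F i)) a * z j)"
        unfolding QR[OF 1] by (simp add: distrib_left sum.distrib sum_distrib_left mult_ac)
      then show ?thesis using z(1)[OF 1] tng_radial[OF a(1) 1] by simp
    next
      case 2
      then show ?thesis using k0 by (simp add: Ql s_def)
    next
      case 3
      then show ?thesis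
        unfolding Qh[OF 3] hess_add using hess_radial[OF a(1) w] z(2) \<sigma>R[OF 3] by simp
    qed
  qed
  then have "?z = (\<lambda>_. 0)"
    by (intro mdet_nonzero_iff_kernel[THEN iffD1, OF Q0, rule_format])
  then have "z = (\<lambda>k. - s * a k)"
    by (simp add: fun_eq_iff eq_neg_iff_add_eq_0 add.commute)
  then show ?thesis by blast
qed

section \<open>Intersections of two tangent spaces\<close>

text \<open>The 2n equations of two tangent spaces. The zero in row \<open>l0\<close> is a
  placeholder, overwritten in the cofactors along that row.\<close>

definition pair_row :: "('m \<Rightarrow> complex) \<Rightarrow> ('m \<Rightarrow> complex) \<Rightarrow> 'm \<Rightarrow> 'm \<Rightarrow> complex" where
  "pair_row a b i j = (if i \<in> R then mp_eval (mp_partial j (F i)) a else if i = l0 then 0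
     else mp_eval (mp_partial j (F (\<sigma> i))) b)"

text \<open>For generic \<open>s0\<close> an arc leaves \<open>a\<close> with velocity
  \<open>tvec\<close> of 2 s0, and by \<open>arc_limit\<close> the form \<open>G\<close> vanishes at
  a + t \<open>tvec\<close> of a series with constant term \<open>s0\<close>. As polynomial in the
  direction, \<open>G\<close> on the affine space through \<open>a\<close> is then zero by
  \<open>vanishing_on_arcs\<close>.\<close>

lemma tangents_vanish:
  assumes G: "homogeneous d G"
    and P: "\<And>b. b \<in> C \<Longrightarrow> mp_eval \<Delta> b \<noteq> 0 \<Longrightarrow> mp_eval G (cof (pair_row a b) l0) = 0"
    and a: "a \<in> C" "mp_eval \<Delta> a \<noteq> 0"
    and e: "\<And>w c. tng X a w \<Longrightarrow> mp_eval e (case_sum a w) \<noteq> 0 \<Longrightarrow>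
      \<exists>z. tng X a z \<and> (\<forall>i\<in>R. hess (F i) a w z = c i)"
    and w1: "tng X a w1" "mp_eval e (case_sum a w1) \<noteq> 0"
    and w: "tng X a w"
  shows "mp_eval G w = 0"
proof -
  define g where "g = meval Const G (\<lambda>k. Const (a k) + (\<Sum>j\<in>-R. Var j * Const (mp_eval (cof M j k) a)))"
  have ev_g: "mp_eval g s = mp_eval G (\<lambda>k. a k + tvec a s k)" for s
    by (simp add: g_def mp_eval_subst mp_eval_sum tvec_def)
  \<comment> \<open>The doubling compensates the factor 1/2 in the position of the intersection
    point.\<close>
  define b where "b = meval Const (at_a a e) (\<lambda>j. Const 2 * Var j)"
  have ev_b: "mp_eval b s = mp_eval e (case_sum a (tvec a (\<lambda>j. 2 * s j)))" for s
    by (simp add: b_def mp_eval_subst eval_at_a)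
  obtain s1 where s1: "w1 = tvec a s1" using tng_eq_tvec[OF a w1(1)] by blast
  have "g = 0"
  proof (rule vanishing_on_arcs)
    show "mp_eval b (\<lambda>j. s1 j / 2) \<noteq> 0" using w1 by (simp add: ev_b s1)
    fix s0 assume s0: "mp_eval b s0 \<noteq> 0"
    define w0 where "w0 = tvec a (\<lambda>j. 2 * s0 j)"
    have w0: "tng X a w0" unfolding w0_def by (rule tng_tvec[OF a(1)])
    define \<alpha> where "\<alpha> = (\<lambda>k. \<Sum>j\<in>-R. Const (2 * s0 j) * cof M j k)"
    have \<alpha>a: "mp_eval (\<alpha> k) a = w0 k" for k
      by (simp add: \<alpha>_def w0_def tvec_def mp_eval_sum)
    have \<alpha>_VI: "vfield \<alpha> H \<in> VI C" if "H \<in> VI C" for H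
    proof -
      have "vfield \<alpha> H = (\<Sum>j\<in>-R. Const (2 * s0 j) * vfield (cof M j) H)"
        unfolding vfield_def \<alpha>_def sum_distrib_left sum_distrib_right
        by (subst sum.swap) (simp add: mult_ac)
      then show ?thesis using vfield_VI[OF that] by (simp only:) (intro VI_sum VI_mult, simp)
    qed
    let ?\<phi> = "flow \<alpha> a"
    have \<phi>VI: "?\<phi> H = 0" if "H \<in> VI C" for H
      by (rule flow_VI[OF \<alpha>_VI that a(1)])
    define y where "y = (\<lambda>j. ?\<phi> (Var j))"
    define Y where "Y = (\<lambda>i j. ?\<phi> (mp_partial j (F i)))"
    have hessY: "(\<Sum>j\<in>UNIV. fps_nth (Y i j) 1 * z j) = hess (F i) a w0 z" for i z
    proof -
      have "fps_nth (Y i j) 1 = (\<Sum>k\<in>UNIV. mp_eval (mp_partial j (mp_partial k (F i))) a * w0 k)" for j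
        unfolding Y_def flow_nth_1 vfield_def mp_eval_sum
        by (simp add: \<alpha>a mp_partial_commute[of j] mult.commute)
      then show ?thesis by (simp add: hess_def)
    qed
    define Q where "Q = (\<lambda>i j. if i \<in> R then fps_const (fps_nth (Y i j) 0) else if i = l0 then 0 else Y (\<sigma> i) j)"
    \<comment> \<open>A polynomial matrix in the second base point whose image under the flow is the
      matrix \<open>Q\<close> along the arc.\<close>
    define Qp where "Qp = (\<lambda>i j. if i \<in> R then Const (mp_eval (mp_partial j (F i)) a)
      else if i = l0 then 0 else mp_partial j (F (\<sigma> i)))"
    have \<phi>Qp: "?\<phi> (Qp i j) = Q i j" for i j
      by (simp add: Qp_def Q_def Y_def flow_Const rhom_0[OF rhom_flow])
    have evQp: "(\<lambda>i j. mp_eval (Qp i j) x) = pair_row a x" for x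
      by (auto simp: Qp_def pair_row_def fun_eq_iff)
    define H where "H = meval Const G (cof Qp l0)"
    have "mp_eval H x = mp_eval G (cof (pair_row a x) l0)" for x
      by (simp add: H_def mp_eval_subst rhom_cof[OF rhom_mp_eval] evQp)
    \<comment> \<open>\<open>P\<close> speaks of points with nonzero determinant; the factor takes
      care of the others and is cancelled by primality.\<close>
    then have "\<Delta> * H \<in> VI C" using P by (auto simp: VI_def)
    then have "H \<in> VI C" using irr_mult[OF irrC Delta_VI] by blast
    then have "?\<phi> H = 0" by (rule \<phi>VI)
    moreover have "?\<phi> H = meval fps_const G (cof Q l0)"
      unfolding H_def
      by (subst meval_comp[OF rhom_Const rhom_flow]) (simp add: flow_Const rhom_cof[OF rhom_flow] \<phi>Qp)
    ultimately have GQ: "meval fps_const G (cof Q l0) = 0" by simp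
    obtain k0 where k0: "a k0 \<noteq> 0" using cone_nonzero[OF a(1)] by blast
    have y1: "fps_nth (y j) 1 = w0 j" for j
      unfolding y_def flow_nth_1 vfield_Var \<alpha>a ..
    have "\<exists>z. meval fps_const G (\<lambda>j. fps_const (fps_nth (y j) 0) + fps_X * z j) = 0 \<and>
      (\<forall>i\<in>R. (\<Sum>j\<in>UNIV. fps_const (fps_nth (Y i j) 0) * z j) = 0) \<and> (\<forall>j. fps_nth (z j) 0 = fps_nth (y j) 1 / 2)"
    proof (rule arc_limit[OF l0 \<sigma> _ _ _ _ Q_def G GQ])
      fix i assume i: "i \<in> R"
      have "(\<Sum>j\<in>UNIV. mp_partial j (F i) * Var j) \<in> VI C"
        unfolding Euler_homogeneous[OF F_hom[OF i]] by (rule VI_mult(2)[OF F_VI[OF i]])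
      from \<phi>VI[OF this] show "(\<Sum>j\<in>UNIV. Y i j * y j) = 0"
        by (simp add: Y_def y_def rhom_sum[OF rhom_flow] rhom_mult[OF rhom_flow])
      have "(\<Sum>j\<in>UNIV. mp_partial j (F i) * \<alpha> j) \<in> VI C"
        using \<alpha>_VI[OF F_VI[OF i]] by (simp add: vfield_def mult.commute)
      from \<phi>VI[OF this] show "(\<Sum>j\<in>UNIV. Y i j * fps_deriv (y j)) = 0"
        by (simp add: Y_def y_def flow_deriv rhom_sum[OF rhom_flow] rhom_mult[OF rhom_flow])
    next
      fix z assume z: "\<And>i. i \<in> R \<Longrightarrow> (\<Sum>j\<in>UNIV. fps_nth (Y i j) 0 * z j) = 0"
        "\<And>i. i \<in> R \<Longrightarrow> (\<Sum>j\<in>UNIV. fps_nth (Y i j) 1 * z j) = 0"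
      have "\<exists>c. z = (\<lambda>j. c * a j)"
      proof (rule hess_kernel[OF a w0])
        show "\<exists>z. tng X a z \<and> (\<forall>i\<in>R. hess (F i) a w0 z = c i)" for c
          using e[OF w0] s0 by (simp add: ev_b w0_def)
      qed (use z hessY in \<open>auto simp: Y_def\<close>)
      then show "\<exists>c. z = (\<lambda>j. c * fps_nth (y j) 0)" by (simp add: y_def)
    next
      show "fps_nth (y k0) 0 \<noteq> 0" using k0 by (simp add: y_def)
    qed
    then obtain z where z: "meval fps_const G (\<lambda>j. fps_const (a j) + fps_X * z j) = 0"
      "\<And>i. i \<in> R \<Longrightarrow> (\<Sum>j\<in>UNIV. fps_const (Mv a i j) * z j) = 0" "\<And>j. fps_nth (z j) 0 = w0 j / 2"
      unfolding y1 by (auto simp: y_def Y_def frame_row_def)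
    \<comment> \<open>The cofactor coordinates of \<open>z\<close> by Cramer's rule; on
      \<open>R\<close> a filler with the required constant term.\<close>
    define s where "s = (\<lambda>j. if j \<in> R then fps_const (s0 j)
      else fps_const (1 / mdet (Mv a)) * (\<Sum>l\<in>UNIV. fps_const (Mv a j l) * z l))"
    have Mz: "(\<Sum>l\<in>UNIV. Mv a i l * fps_nth (z l) n) = 0" if "i \<in> R" for i n
      using arg_cong[OF z(2)[OF that], of "\<lambda>f. fps_nth f n"] by (simp add: fps_sum_nth)
    have D: "mdet (Mv a) \<noteq> 0" using a(2) by (simp add: eval_Delta)
    have zs: "z k = (\<Sum>j\<in>-R. s j * fps_const (mp_eval (cof M j k) a))" for k
    proof (rule fps_ext)
      fix n
      have "fps_nth (z k) n = (\<Sum>j\<in>-R. (\<Sum>l\<in>UNIV. Mv a j l * fps_nth (z l) n) / mdet (Mv a) * cof (Mv a) j k)"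
        by (rule kernel_representation[OF D Mz])
      also have "\<dots> = fps_nth (\<Sum>j\<in>-R. s j * fps_const (mp_eval (cof M j k) a)) n"
        by (simp add: s_def fps_sum_nth eval_cof)
      finally show "fps_nth (z k) n = \<dots>" .
    qed
    have "fps_nth (s j) 0 = s0 j" for j
    proof (cases "j \<in> R")
      case False
      have "w0 l = 2 * tvec a s0 l" for l
        by (simp add: w0_def tvec_def sum_distrib_left mult_ac)
      then have "fps_nth (z l) 0 = (\<Sum>i\<in>-R. s0 i * cof (Mv a) i l)" for l
        by (simp add: z(3) tvec_def eval_cof)
      then have "(\<Sum>l\<in>UNIV. Mv a j l * fps_nth (z l) 0) = (\<Sum>i\<in>-R. s0 i * (\<Sum>l\<in>UNIV. Mv a j l * cof (Mv a) i l))"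
        unfolding sum_distrib_left by (subst sum.swap) (simp add: sum_distrib_left mult_ac)
      also have "\<dots> = (\<Sum>i\<in>-R. if i = j then s0 j * mdet (Mv a) else 0)"
        unfolding row_cof[of "Mv a"] by (rule sum.cong) auto
      also have "\<dots> = s0 j * mdet (Mv a)" using False by simp
      finally show ?thesis using False D by (simp add: s_def fps_sum_nth)
    qed (simp add: s_def)
    moreover have "meval fps_const g (\<lambda>j. fps_X * s j) = 0"
    proof -
      have "meval fps_const g (\<lambda>j. fps_X * s j) = meval fps_const G (\<lambda>k. fps_const (a k) + fps_X * z k)"
        unfolding g_def
        by (subst meval_comp[OF rhom_Const rhom_meval[OF rhom_fps_const]])
          (simp add: rhom_fps_const meval_add rhom_sum[OF rhom_meval[OF rhom_fps_const]] meval_mult zs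
            sum_distrib_left mult_ac)
      then show ?thesis using z(1) by simp
    qed
    ultimately show "\<exists>s. (\<forall>j. fps_nth (s j) 0 = s0 j) \<and> meval fps_const g (\<lambda>j. fps_X * s j) = 0" by blast
  qed
  \<comment> \<open>By Euler's relation \<open>a\<close> itself is tangent, so the translate of the
    tangent space by \<open>a\<close> is that space.\<close>
  have "tng X a (\<lambda>k. w k - a k)"
    unfolding tng_iff[OF a]
  proof
    fix i assume i: "i \<in> R"
    have "(\<Sum>j\<in>UNIV. Mv a i j * (w j - a j)) =
        (\<Sum>j\<in>UNIV. Mv a i j * w j) - (\<Sum>k\<in>UNIV. mp_eval (mp_partial k (F i)) a * a k)"
      using i by (simp add: right_diff_distrib sum_subtractf frame_row_def)
    then show "(\<Sum>j\<in>UNIV. Mv a i j * (w j - a j)) = 0"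
      using w i tng_radial[OF a(1) i] unfolding tng_iff[OF a] by simp
  qed
  then obtain s where "(\<lambda>k. w k - a k) = tvec a s" using tng_eq_tvec[OF a] by blast
  then have "w = (\<lambda>k. a k + tvec a s k)" by (auto simp: fun_eq_iff algebra_simps dest: fun_cong)
  then show ?thesis using ev_g[of s] \<open>g = 0\<close> by simp
qed

text \<open>One constant coefficient vector \<open>s1\<close> gives a direction at every point;
  where \<open>e\<close> is nonzero on it and \<open>\<Delta>\<close> is nonzero, \<open>G\<close>
  vanishes on the tangent space, which is the generic hypothesis of \<open>dense\<close>.\<close>

lemma intersections_dense:
  assumes G: "homogeneous d G"
    and P: "\<And>a b. a \<in> C \<Longrightarrow> b \<in> C \<Longrightarrow> mp_eval \<Delta> a \<noteq> 0 \<Longrightarrow> mp_eval \<Delta> b \<noteq> 0 \<Longrightarrow>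
      mp_eval G (cof (pair_row a b) l0) = 0"
  shows "G = 0"
proof -
  obtain e where e: "e \<notin> VI TX" and surj: "\<And>a w c. a \<in> C \<Longrightarrow> mp_eval \<Delta> a \<noteq> 0 \<Longrightarrow> tng X a w \<Longrightarrow>
      mp_eval e (case_sum a w) \<noteq> 0 \<Longrightarrow> \<exists>z. tng X a z \<and> (\<forall>i\<in>R. hess (F i) a w z = c i)"
    using hess_surj by blast
  obtain s1 a1 where "a1 \<in> C" "mp_eval (at_s s1 e) a1 \<noteq> 0"
    using e by (auto simp: VI_def TX_def eval_at_s)
  then have "at_s s1 e \<notin> VI C" by (auto simp: VI_def)
  then have "at_s s1 e * \<Delta> \<notin> VI C" by (rule irr_mult[OF irrC _ Delta_VI])
  then show ?thesis
  proof (rule dense)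
    fix a w assume a: "a \<in> C" "mp_eval (at_s s1 e * \<Delta>) a \<noteq> 0" and w: "tng X a w"
    then have a': "mp_eval (at_s s1 e) a \<noteq> 0" "mp_eval \<Delta> a \<noteq> 0" by auto
    show "mp_eval G w = 0"
      by (rule tangents_vanish[OF G P[OF a(1) _ a'(2)] a(1) a'(2) surj[OF a(1) a'(2)] tng_tvec[OF a(1)] _ w])
        (use a'(1) in \<open>simp_all add: eval_at_s\<close>)
  qed
qed

end

section \<open>Bihomogeneous minors and the rational map to the intersection point\<close>

lemma whomog_zero_weight: "whomog (\<lambda>_. 0) 0 F"
  by (simp add: whomog_def)

lemma whomog_ren_Inl: "whomog f d F \<Longrightarrow> whomog (case_sum f g) d (ren Inl F)"
  unfolding ren_def by (erule whomog_meval) (use whomog_Var[of "case_sum f g" "Inl _"] in simp)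

lemma whomog_ren_Inr: "whomog g d F \<Longrightarrow> whomog (case_sum f g) d (ren Inr F)"
  unfolding ren_def by (erule whomog_meval) (use whomog_Var[of "case_sum f g" "Inr _"] in simp)

context filling begin

definition pair_poly :: "'m \<Rightarrow> 'm \<Rightarrow> ('m + 'm) mpoly" where
  "pair_poly i j = (if i \<in> R then ren Inl (mp_partial j (F i)) else if i = l0 then 0
     else ren Inr (mp_partial j (F (\<sigma> i))))"

lemma eval_cof_pair_poly:
  "mp_eval (cof pair_poly l0 k) (case_sum a b) = cof (pair_row a b) l0 k"
proof -
  have "(\<lambda>i j. mp_eval (pair_poly i j) (case_sum a b)) = pair_row a b"
    by (auto simp: pair_poly_def pair_row_def fun_eq_iff)
  then show ?thesis by (simp add: rhom_cof[OF rhom_mp_eval])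
qed

lemma \<sigma>_R: "i \<notin> R \<Longrightarrow> i \<noteq> l0 \<Longrightarrow> \<sigma> i \<in> R"
  using \<sigma> by (auto simp: bij_betw_def)

lemma \<sigma>_surj: "i \<in> R \<Longrightarrow> \<exists>i'. i' \<notin> R \<and> i' \<noteq> l0 \<and> \<sigma> i' = i"
proof -
  assume "i \<in> R"
  then have "i \<in> \<sigma> ` (- R - {l0})" using \<sigma> by (simp add: bij_betw_def)
  then show ?thesis by auto
qed

lemma homogeneous_F_partial: "i \<in> R \<Longrightarrow> homogeneous (dg i - 1) (mp_partial j (F i))"
  by (rule homogeneous_partial[OF F_hom])

definition "deg1 = (\<Sum>i\<in>UNIV. if i \<in> R then dg i - 1 else 0)"
definition "deg2 = (\<Sum>i\<in>UNIV. if i \<in> R \<or> i = l0 then 0 else dg (\<sigma> i) - 1)"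

lemma bihomogeneous_cof: "bihomogeneous deg1 deg2 (cof pair_poly l0 k)"
  unfolding bihomogeneous_whomog deg1_def deg2_def
proof (intro conjI whomog_cof)
  have hom: "whomog (\<lambda>_. 1) (dg i - 1) (mp_partial j (F i))" if "i \<in> R" for i j
    using homogeneous_F_partial[OF that] unfolding homogeneous_whomog .
  fix i j assume i: "i \<noteq> l0"
  show "whomog (case_sum (\<lambda>_. 1) (\<lambda>_. 0)) (if i \<in> R then dg i - 1 else 0) (pair_poly i j)"
    by (cases "i \<in> R") (simp_all only: pair_poly_def if_True if_False i whomog_ren_Inl hom whomog_ren_Inr whomog_zero_weight)
  show "whomog (case_sum (\<lambda>_. 0) (\<lambda>_. 1)) (if i \<in> R \<or> i = l0 then 0 else dg (\<sigma> i) - 1) (pair_poly i j)"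
    using i \<sigma>_R[of i] by (cases "i \<in> R")
      (simp_all only: pair_poly_def if_True if_False simp_thms whomog_ren_Inl hom whomog_ren_Inr whomog_zero_weight)
qed (simp_all add: l0)

lemma homogeneous_Delta: "homogeneous (\<Sum>i\<in>UNIV. if i \<in> R then dg i - 1 else 0) \<Delta>"
  unfolding homogeneous_whomog
proof (rule whomog_mdet)
  fix i j
  show "whomog (\<lambda>_. 1) (if i \<in> R then dg i - 1 else 0) (M i j)"
    using homogeneous_F_partial[of i j]
    by (simp only: frame_row_def homogeneous_whomog whomog_Const if_True if_False split: if_split) simp
qed

text \<open>One bihomogeneous polynomial per minor combines the conditions that both frames are
  nondegenerate and that this minor is nonzero.\<close>

definition U_poly :: "'m \<Rightarrow> ('m + 'm) mpoly" where
  "U_poly k = ren Inl \<Delta> * ren Inr \<Delta> * cof pair_poly l0 k"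

lemma bihomogeneous_U_poly: "\<exists>d e. bihomogeneous d e (U_poly k)"
proof -
  obtain D where D: "whomog (\<lambda>_. 1) D \<Delta>" using homogeneous_Delta unfolding homogeneous_whomog by blast
  have "bihomogeneous (D + 0 + deg1) (0 + D + deg2) (U_poly k)"
    using bihomogeneous_cof unfolding U_poly_def bihomogeneous_whomog
    by (intro conjI whomog_mult whomog_ren_Inl whomog_ren_Inr whomog_zero_weight D) blast+
  then show ?thesis by blast
qed

lemma eval_U_poly:
  "mp_eval (U_poly k) (case_sum a b) = mp_eval \<Delta> a * mp_eval \<Delta> b * cof (pair_row a b) l0 k"
  by (simp add: U_poly_def eval_cof_pair_poly)

definition U :: "('m proj \<times> 'm proj) set" where
  "U = {(x, y) \<in> X \<times> X. \<exists>k. \<not> vanishes2 (U_poly k) (x, y)}"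

lemma U_iff:
  assumes "x \<in> X" "y \<in> X" "v \<in> hcoords x" "w \<in> hcoords y"
  shows "(x, y) \<in> U \<longleftrightarrow> mp_eval \<Delta> (($) v) \<noteq> 0 \<and> mp_eval \<Delta> (($) w) \<noteq> 0 \<and>
    (\<exists>k. cof (pair_row (($) v) (($) w)) l0 k \<noteq> 0)"
proof -
  have "vanishes2 (U_poly k) (x, y) \<longleftrightarrow> mp_eval (U_poly k) (case_sum (($) v) (($) w)) = 0" for k
    using bihomogeneous_U_poly[of k] vanishes2_iff[OF _ assms(3,4)] by blast
  then show ?thesis using assms(1,2) by (simp add: U_def eval_U_poly)
qed

lemma openin_U: "openin (subtopology zariski2 (X \<times> X)) U"
proof -
  have "openin zariski2 {z. \<not> vanishes2 (U_poly k) z}" for k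
    unfolding zariski2_def using bihomogeneous_U_poly[of k]
    by (intro topology_generated_by_Basis) blast
  then have "openin zariski2 (\<Union>k. {z. \<not> vanishes2 (U_poly k) z})" by blast
  moreover have "U = (\<Union>k. {z. \<not> vanishes2 (U_poly k) z}) \<inter> (X \<times> X)"
    by (auto simp: U_def)
  ultimately show ?thesis unfolding openin_subtopology by blast
qed

text \<open>The minor vector solves all equations. If its entry \<open>k\<close> is nonzero, the
  \<open>k\<close>-th unit vector completes the equations to an invertible matrix, so a solution is
  determined by its entry \<open>k\<close>.\<close>

lemma tangent_cones_meet:
  assumes U: "(x, y) \<in> U" and v: "v \<in> hcoords x" "w \<in> hcoords y"
  defines "P \<equiv> \<chi> k. cof (pair_row (($) v) (($) w)) l0 k"
  shows "tangent_cone X x \<inter> tangent_cone X y = vec.span {P}" "P \<noteq> 0"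
proof -
  have xy: "x \<in> X" "y \<in> X" using U by (auto simp: U_def)
  have D: "mp_eval \<Delta> (($) v) \<noteq> 0" "mp_eval \<Delta> (($) w) \<noteq> 0"
    and "\<exists>k. cof (pair_row (($) v) (($) w)) l0 k \<noteq> 0"
    using U U_iff[OF xy v] by auto
  then obtain k where k: "P $ k \<noteq> 0" by (auto simp: P_def)
  then show "P \<noteq> 0" by auto
  let ?Q = "pair_row (($) v) (($) w)"
  have Tx: "z \<in> tangent_cone X x \<longleftrightarrow> (\<forall>i\<in>R. (\<Sum>j\<in>UNIV. mp_eval (mp_partial j (F i)) (($) v) * z $ j) = 0)" for z
    unfolding tangent_cone_frame(1)[OF xy(1) v(1) D(1)] mem_Collect_eq tng_iff[OF cone_mem[OF xy(1) v(1)] D(1)]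
    by (simp add: frame_row_def)
  have Ty: "z \<in> tangent_cone X y \<longleftrightarrow> (\<forall>i\<in>R. (\<Sum>j\<in>UNIV. mp_eval (mp_partial j (F i)) (($) w) * z $ j) = 0)" for z
    unfolding tangent_cone_frame(1)[OF xy(2) v(2) D(2)] mem_Collect_eq tng_iff[OF cone_mem[OF xy(2) v(2)] D(2)]
    by (simp add: frame_row_def)
  have T: "z \<in> tangent_cone X x \<inter> tangent_cone X y \<longleftrightarrow> (\<forall>i. i \<noteq> l0 \<longrightarrow> (\<Sum>j\<in>UNIV. ?Q i j * z $ j) = 0)" for z
  proof
    assume z: "z \<in> tangent_cone X x \<inter> tangent_cone X y"
    show "\<forall>i. i \<noteq> l0 \<longrightarrow> (\<Sum>j\<in>UNIV. ?Q i j * z $ j) = 0"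
    proof (intro allI impI)
      fix i assume "i \<noteq> l0"
      then show "(\<Sum>j\<in>UNIV. ?Q i j * z $ j) = 0"
        using z Tx[of z] Ty[of z] \<sigma>_R[of i] by (cases "i \<in> R") (auto simp: pair_row_def)
    qed
  next
    assume z: "\<forall>i. i \<noteq> l0 \<longrightarrow> (\<Sum>j\<in>UNIV. ?Q i j * z $ j) = 0"
    have "(\<Sum>j\<in>UNIV. mp_eval (mp_partial j (F i)) (($) v) * z $ j) = 0" if "i \<in> R" for i
    proof -
      have "i \<noteq> l0" using l0 that by auto
      then show ?thesis using z that by (auto simp: pair_row_def dest!: spec[of _ i])
    qed
    moreover have "(\<Sum>j\<in>UNIV. mp_eval (mp_partial j (F i)) (($) w) * z $ j) = 0" if "i \<in> R" for i
      using z \<sigma>_surj[OF that] by (auto simp: pair_row_def)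
    ultimately show "z \<in> tangent_cone X x \<inter> tangent_cone X y"
      using Tx[of z] Ty[of z] by blast
  qed
  have P: "P \<in> tangent_cone X x \<inter> tangent_cone X y"
    unfolding T by (auto simp: P_def row_cof)
  show "tangent_cone X x \<inter> tangent_cone X y = vec.span {P}"
  proof
    show "vec.span {P} \<subseteq> tangent_cone X x \<inter> tangent_cone X y"
    proof
      fix z assume "z \<in> vec.span {P}"
      then obtain c where c: "z = c *s P" by (auto simp: vec.span_singleton)
      have "(\<Sum>j\<in>UNIV. ?Q i j * z $ j) = c * (\<Sum>j\<in>UNIV. ?Q i j * P $ j)" for i
        by (simp add: c sum_distrib_left mult_ac)
      then show "z \<in> tangent_cone X x \<inter> tangent_cone X y" using P unfolding T by simp
    qed
    show "tangent_cone X x \<inter> tangent_cone X y \<subseteq> vec.span {P}"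
    proof
      fix z assume z: "z \<in> tangent_cone X x \<inter> tangent_cone X y"
      let ?E = "?Q(l0 := \<lambda>j. if j = k then 1 else 0)"
      let ?u = "\<lambda>j. z $ j - z $ k / P $ k * P $ j"
      have E: "mdet ?E \<noteq> 0" using k by (simp add: P_def cof_def)
      have "(\<Sum>j\<in>UNIV. ?E i j * ?u j) = 0" for i
      proof (cases "i = l0")
        case True
        have "(\<Sum>j\<in>UNIV. ?E i j * ?u j) = (\<Sum>j\<in>UNIV. if j = k then ?u k else 0)"
          by (rule sum.cong) (auto simp: True)
        then show ?thesis using k by simp
      next
        case False
        have "(\<Sum>j\<in>UNIV. ?E i j * ?u j) = (\<Sum>j\<in>UNIV. ?Q i j * z $ j) - z $ k / P $ k * (\<Sum>j\<in>UNIV. ?Q i j * P $ j)"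
          using False by (simp add: right_diff_distrib sum_subtractf sum_distrib_left mult_ac)
        then show ?thesis using z P False unfolding T by simp
      qed
      then have "?u = (\<lambda>_. 0)"
        by (intro mdet_nonzero_iff_kernel[THEN iffD1, OF E, rule_format])
      note u = fun_cong[OF this]
      have "z $ j = z $ k / P $ k * P $ j" for j
        using u[of j] by (simp only: right_minus_eq)
      then have "z = (z $ k / P $ k) *s P"
        unfolding vec_eq_iff vector_smult_component by (intro allI)
      then obtain c where c: "z = c *s P" by (rule that)
      show "z \<in> vec.span {P}" unfolding c by (intro vec.span_scale vec.span_base) simp
    qed
  qed
qed

text \<open>Meaningful on \<open>U\<close>, where the two linear spaces meet in a line.\<close>

definition P :: "'m proj \<times> 'm proj \<Rightarrow> 'm proj" where
  "P z = Abs_proj (tangent_cone X (fst z) \<inter> tangent_cone X (snd z))"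

lemma hcoords_P:
  assumes "(x, y) \<in> U" "v \<in> hcoords x" "w \<in> hcoords y"
  shows "(\<chi> k. cof (pair_row (($) v) (($) w)) l0 k) \<in> hcoords (P (x, y))"
    and "Rep_proj (P (x, y)) = tangent_cone X x \<inter> tangent_cone X y"
proof -
  let ?v = "\<chi> k. cof (pair_row (($) v) (($) w)) l0 k"
  note m = tangent_cones_meet[OF assms]
  obtain p where p: "?v \<in> hcoords p" "Rep_proj p = vec.span {?v}" using obtain_proj[OF m(2)] by blast
  then have "P (x, y) = p" by (simp add: P_def m(1) flip: p(2)) (rule Rep_proj_inverse)
  then show "?v \<in> hcoords (P (x, y))" "Rep_proj (P (x, y)) = tangent_cone X x \<inter> tangent_cone X y"
    using p m(1) by simp_all
qed

lemma tangent_spaces_meet: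
  assumes "(x, y) \<in> U"
  shows "tangent_space X x \<inter> tangent_space X y = {P (x, y)}"
proof -
  obtain v w where "v \<in> hcoords x" "w \<in> hcoords y" using hcoords_nonempty by metis
  note R = hcoords_P(2)[OF assms this]
  have "p = P (x, y)" if "Rep_proj p \<subseteq> Rep_proj (P (x, y))" for p
  proof -
    have "Rep_proj p = Rep_proj (P (x, y))"
      using that by (intro vec.subspace_dim_equal) (simp_all add: proj_line)
    then show ?thesis by (simp add: Rep_proj_inject)
  qed
  then show ?thesis using R by (auto simp: tangent_space_def)
qed

lemma regular_P: "regular_map_on U P"
  unfolding regular_map_on_def
proof
  fix z assume z: "z \<in> U"
  show "\<exists>V d e. \<exists>F :: 'm \<Rightarrow> ('m + 'm) mpoly.
     openin (subtopology zariski2 U) V \<and> z \<in> V \<and> (\<forall>i. bihomogeneous d e (F i)) \<and>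
     (\<forall>(p, q)\<in>V. \<forall>v\<in>hcoords p. \<forall>w\<in>hcoords q.
        (\<chi> i. mp_eval (F i) (case_sum (($) v) (($) w))) \<in> hcoords (P (p, q)))"
  proof (intro exI conjI)
    have "U \<subseteq> topspace zariski2"
      using openin_subset[OF openin_U] by (simp add: topspace_subtopology)
    then show "openin (subtopology zariski2 U) U"
      by (simp add: openin_subtopology_refl)
    show "\<forall>i. bihomogeneous deg1 deg2 (cof pair_poly l0 i)" using bihomogeneous_cof by blast
    show "\<forall>(p, q)\<in>U. \<forall>v\<in>hcoords p. \<forall>w\<in>hcoords q.
        (\<chi> i. mp_eval (cof pair_poly l0 i) (case_sum (($) v) (($) w))) \<in> hcoords (P (p, q))"
      using hcoords_P(1) by (auto simp: eval_cof_pair_poly)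
  qed (rule z)
qed

text \<open>Otherwise every minor vector over nondegenerate pairs would be zero, and a coordinate
  form would vanish on all of them.\<close>

lemma U_nonempty: "U \<noteq> {}"
proof
  assume U: "U = {}"
  have "Var undefined = (0 :: 'm mpoly)"
  proof (rule intersections_dense)
    show "homogeneous 1 (Var undefined :: 'm mpoly)"
      using whomog_Var[of "\<lambda>_. 1"] by (simp add: homogeneous_whomog)
    fix a b assume ab: "a \<in> C" "b \<in> C" "mp_eval \<Delta> a \<noteq> 0" "mp_eval \<Delta> b \<noteq> 0"
    then obtain x y where xy: "x \<in> X" "vec_lambda a \<in> hcoords x" "y \<in> X" "vec_lambda b \<in> hcoords y"
      by (auto simp: affine_cone_def)
    then show "mp_eval (Var undefined) (cof (pair_row a b) l0) = 0"
      using U_iff[OF xy(1,3,2,4)] U ab by (simp add: vec_lambda_inverse)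
  qed
  then have "mp_eval (Var undefined :: 'm mpoly) (\<lambda>_. 1) = 0" by simp
  then show False by simp
qed

lemma dominant_P: "dominant_on U P"
proof (rule ccontr)
  let ?K = "zariski closure_of (P ` U)"
  assume "\<not> dominant_on U P"
  then obtain p where "p \<notin> ?K" by (auto simp: dominant_on_def)
  then obtain G d where G: "homogeneous d G" "\<not> vanishes G p" "\<And>q. q \<in> ?K \<Longrightarrow> vanishes G q"
    using closedin_zariski_separate[OF closedin_closure_of] by blast
  have van: "vanishes G (P z)" if "z \<in> U" for z
    using G(3) closure_of_subset[of "P ` U" zariski] that by auto
  obtain u where u: "u \<in> hcoords p" using hcoords_nonempty by blast
  obtain k where k: "u $ k \<noteq> 0" using hcoords_nonzero[OF u] by (auto simp: vec_eq_iff)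
  \<comment> \<open>Outside \<open>U\<close> the minor vector is zero; the extra variable makes the
    form vanish there whatever the degree of \<open>G\<close>.\<close>
  have "G * Var k = 0"
  proof (rule intersections_dense)
    show "homogeneous (d + 1) (G * Var k)"
      using G(1) whomog_Var[of "\<lambda>_. 1" k] by (simp only: homogeneous_whomog whomog_mult)
    fix a b assume ab: "a \<in> C" "b \<in> C" "mp_eval \<Delta> a \<noteq> 0" "mp_eval \<Delta> b \<noteq> 0"
    then obtain x y where xy: "x \<in> X" "vec_lambda a \<in> hcoords x" "y \<in> X" "vec_lambda b \<in> hcoords y"
      by (auto simp: affine_cone_def)
    show "mp_eval (G * Var k) (cof (pair_row a b) l0) = 0"
    proof (cases "(x, y) \<in> U")
      case True
      have "(\<chi> k. cof (pair_row a b) l0 k) \<in> hcoords (P (x, y))"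
        using hcoords_P(1)[OF True xy(2,4)] by (simp add: vec_lambda_inverse)
      with van[OF True] have "mp_eval G (($) (\<chi> k. cof (pair_row a b) l0 k)) = 0"
        unfolding vanishes_def by (rule bspec)
      then show ?thesis by (simp add: vec_lambda_inverse)
    next
      case False
      then show ?thesis
        using U_iff[OF xy(1,3,2,4)] ab by (simp add: vec_lambda_inverse)
    qed
  qed
  then have "mp_eval (G * Var k) (($) u) = 0" by simp
  then show False using G(2) vanishes_iff[OF G(1) u] k by simp
qed

end

theorem mainTheorem2:
  fixes N n :: nat and X :: "('m::finite) proj set"
  assumes "CARD('m) = N + 1" and "N = 2 * n"
    and "subvariety X" and "variety_dim X = enat n"
    and "Tan X = UNIV"
  shows "\<exists>U (P :: 'm proj \<times> 'm proj \<Rightarrow> 'm proj).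
    (\<forall>(x, y)\<in>U. smooth_point X x \<and> smooth_point X y \<and>
       tangent_space X x \<inter> tangent_space X y = {P (x, y)}) \<and>
    represents_rational_map (X \<times> X) U P \<and> dominant_on U P"
proof -
  have n: "n < CARD('m)" using assms by simp
  have "{x. smooth_point X x} \<noteq> {}"
  proof
    assume "{x. smooth_point X x} = {}"
    then have "Tan X = {}" by (simp add: Tan_def)
    then show False using assms(5) by auto
  qed
  then obtain x where x: "smooth_point X x" by blast
  obtain v where v: "v \<in> hcoords x" using hcoords_nonempty by blast
  obtain R F r dg where fr: "frame X R F r dg" and R: "card (- R) = n + 1"
    using frame_at_smooth_point[OF assms(3,4) n x v] by blast
  then obtain l0 where l0: "l0 \<in> - R" by (metis Suc_eq_plus1 card.empty ex_in_conv nat.distinct(1))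
  have "card R + card (- R) = CARD('m)"
    using card_Un_disjoint[of R "- R"] by simp
  \<comment> \<open>Here (2n + 1) - (n + 1) = n: the rows outside \<open>R\<close> hold a second set
    of n equations and one spare row exactly because N = 2n.\<close>
  then have "card (- R - {l0}) = card R" using R l0 assms(1,2) by simp
  then obtain \<sigma> where \<sigma>: "bij_betw \<sigma> (- R - {l0}) R"
    using finite_same_card_bij[of "- R - {l0}" R] by auto
  interpret filling X R F r dg l0 \<sigma>
    using fr l0 \<sigma> tangents_dense[OF assms(3,4) n assms(5)]
    by (intro filling.intro filling_axioms.intro) auto
  have smooth: "smooth_point X x" if "x \<in> X" "w \<in> hcoords x" "mp_eval \<Delta> (($) w) \<noteq> 0" for x w
    using tangent_cone_frame(2)[OF that] that(1) R assms(4)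
    by (simp add: smooth_point_def one_enat_def)
  have "\<forall>(x, y)\<in>U. smooth_point X x \<and> smooth_point X y \<and>
    tangent_space X x \<inter> tangent_space X y = {P (x, y)}"
  proof (intro ballI, unfold split_beta)
    fix z assume "z \<in> U"
    then have z: "(fst z, snd z) \<in> U" by simp
    obtain v w where vw: "v \<in> hcoords (fst z)" "w \<in> hcoords (snd z)" using hcoords_nonempty by metis
    have "fst z \<in> X" "snd z \<in> X" using z by (auto simp: U_def)
    then show "smooth_point X (fst z) \<and> smooth_point X (snd z) \<and>
        tangent_space X (fst z) \<inter> tangent_space X (snd z) = {P (fst z, snd z)}"
      using U_iff[OF _ _ vw] z smooth vw tangent_spaces_meet[OF z] by blast
  qed
  moreover have "represents_rational_map (X \<times> X) U P"
    using openin_U U_nonempty regular_P by (simp add: represents_rational_map_def)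
  ultimately show ?thesis using dominant_P by blast
qed

end
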